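(* Let $k$ be a field and let $\mathcal D$ be the cluster category of Dynkin type $A_\infty$ over $k$. Let $\mathcal A$ be a subcategory of $\mathcal D$ and let $\mathfrak A$ be the corresponding set of arcs. Then $\mathcal A$ is precovering in $\mathcal D$ if and only if each right fountain of $\mathfrak A$ is in fact a fountain of $\mathfrak A$.
   Context: The category $\mathcal D$: let $k[T]$ be the DG algebra over the field $k$ with $T$ in homological degree $1$ and zero differential; $\mathcal D = D^{f}(k[T])$ is the finite derived category, i.e. the full subcategory of the derived category of DG $k[T]$-modules consisting of those whose total homology is finite dimensional over $k$. It is $k$-linear, Hom-finite, Krull-Schmidt, triangulated with suspension $\Sigma$, and $2$-Calabi-Yau. (Equivalently, $\mathcal D$ is the algebraic triangulated category generated by a $2$-spherical object.) Write $(x,y)$ for the space of morphisms $x\to y$ in $\mathcal D$. Coordinates: the Auslander-Reiten quiver of $\mathcal D$ is $\mathbb Z A_\infty$. Its vertices (isomorphism classes of indecomposable objects) are labelled by the pairs of integers $(m,n)$ with $n-m\ge 2$, with arrows $(m,n)\to(m,n+1)$, and $(m,n)\to(m+1,n)$ whenever $n-m\ge 3$, and with $\Sigma(m,n)=\tau(m,n)=(m-1,n-1)$, where $\tau$ is the AR translation; one such labelling is fixed. Arcs: an arc is a pair $(m,n)$ of integers with $n-m\ge 2$; it ends in $m$ and in $n$. So arcs are identified with indecomposable objects. Subcategories: a subcategory of $\mathcal D$ always means a full subcategory closed under (finite) direct sums and direct summands (hence isomorphisms). Subcategories correspond bijectively to sets of arcs: a set of arcs $\mathfrak A$ corresponds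 to the subcategory of all finite direct sums of the indecomposable objects labelled by elements of $\mathfrak A$. Fountains: a left fountain (resp. right fountain) of $\mathfrak A$ is an integer $n$ for which there are infinitely many arcs of the form $(m,n)$ (resp. $(n,m)$) in $\mathfrak A$. A fountain is an integer which is both a left and a right fountain. Precovering: an $\mathcal A$-precover of $d\in\mathcal D$ is a morphism $a\to d$ with $a\in\mathcal A$ through which every morphism $a'\to d$ with $a'\in\mathcal A$ factors. $\mathcal A$ is precovering if every object of $\mathcal D$ has an $\mathcal A$-precover. *)

theory Defs
  imports Complex_Main "HOL-Library.FuncSet"
begin

text \<open>
  A DG module over \<open>k[T]\<close> (\<open>T\<close> in homological degree 1, zero differential) is a family of
  \<open>k\<close>-vector spaces indexed by the integers with a differential of degree -1 and an action of
  \<open>T\<close> of degree +1. We use right DG modules: the Leibniz rule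
  \<open>d (m T) = d m T + (-1)^|m| m (d T)\<close> then says that \<open>d\<close> and \<open>T\<close> commute, and degree one
  homotopies and the suspension involve no sign in the \<open>T\<close>-action. Setting
  \<open>m T = (-1)^|m| T m\<close> identifies them with left DG modules.

  The graded pieces are subspaces of one ambient vector space of infinite dimension, which plays
  the role of a universe. Every vector space of at most that dimension is isomorphic to a subspace,
  and pieces of different degrees may overlap, since they are only used together with their
  degree. The values of the functions below outside the relevant pieces are irrelevant.
\<close>

record 'v dgm =
  piece :: "int \<Rightarrow> 'v set"
  diff :: "int \<Rightarrow> 'v \<Rightarrow> 'v"
  act :: "int \<Rightarrow> 'v \<Rightarrow> 'v"

text \<open>A roof \<open>src \<leftarrow> apex \<rightarrow> tgt\<close>.\<close>

record 'v roof =
  src :: "'v dgm"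
  apex :: "'v dgm"
  tgt :: "'v dgm"
  bwd :: "int \<Rightarrow> 'v \<Rightarrow> 'v"
  fwd :: "int \<Rightarrow> 'v \<Rightarrow> 'v"

definition gcomp :: "(int \<Rightarrow> 'v \<Rightarrow> 'v) \<Rightarrow> (int \<Rightarrow> 'v \<Rightarrow> 'v) \<Rightarrow> int \<Rightarrow> 'v \<Rightarrow> 'v" where
  "gcomp g f = (\<lambda>i x. g i (f i x))"

subsection \<open>Arcs\<close>

definition arcs :: "(int \<times> int) set" where
  "arcs = {(m, n). n - m \<ge> 2}"

definition left_fountain :: "(int \<times> int) set \<Rightarrow> int \<Rightarrow> bool" where
  "left_fountain U n \<longleftrightarrow> infinite {m. (m, n) \<in> U}"

definition right_fountain :: "(int \<times> int) set \<Rightarrow> int \<Rightarrow> bool" where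
  "right_fountain U n \<longleftrightarrow> infinite {m. (n, m) \<in> U}"

definition fountain :: "(int \<times> int) set \<Rightarrow> int \<Rightarrow> bool" where
  "fountain U n \<longleftrightarrow> left_fountain U n \<and> right_fountain U n"

definition arcs_of :: "(int \<times> int \<Rightarrow> 'v dgm) \<Rightarrow> 'v dgm set \<Rightarrow> (int \<times> int) set" where
  "arcs_of L A = {a \<in> arcs. L a \<in> A}"

locale dg_universe = vector_space scale
  for scale :: "'k::field \<Rightarrow> 'v::ab_group_add \<Rightarrow> 'v"  (infixr \<open>*s\<close> 75) +
  assumes infinite_dim: "finite B \<Longrightarrow> span B \<noteq> UNIV"
begin

subsection \<open>DG modules\<close>

definition lin_on :: "'v set \<Rightarrow> ('v \<Rightarrow> 'v) \<Rightarrow> bool" where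
  "lin_on S f \<longleftrightarrow>
     (\<forall>x\<in>S. \<forall>y\<in>S. f (x + y) = f x + f y) \<and> (\<forall>c. \<forall>x\<in>S. f (c *s x) = c *s f x)"

definition dg_module :: "'v dgm \<Rightarrow> bool" where
  "dg_module M \<longleftrightarrow> (\<forall>i.
     subspace (piece M i) \<and>
     diff M i \<in> piece M i \<rightarrow> piece M (i - 1) \<and> lin_on (piece M i) (diff M i) \<and>
     act M i \<in> piece M i \<rightarrow> piece M (i + 1) \<and> lin_on (piece M i) (act M i) \<and>
     (\<forall>x\<in>piece M i. diff M (i - 1) (diff M i x) = 0) \<and>
     (\<forall>x\<in>piece M i. diff M (i + 1) (act M i x) = act M (i - 1) (diff M i x)))"

definition dg_map :: "'v dgm \<Rightarrow> 'v dgm \<Rightarrow> (int \<Rightarrow> 'v \<Rightarrow> 'v) \<Rightarrow> bool" where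
  "dg_map M N f \<longleftrightarrow> (\<forall>i.
     f i \<in> piece M i \<rightarrow> piece N i \<and> lin_on (piece M i) (f i) \<and>
     (\<forall>x\<in>piece M i. diff N i (f i x) = f (i - 1) (diff M i x)) \<and>
     (\<forall>x\<in>piece M i. act N i (f i x) = f (i + 1) (act M i x)))"

definition homotopic ::
  "'v dgm \<Rightarrow> 'v dgm \<Rightarrow> (int \<Rightarrow> 'v \<Rightarrow> 'v) \<Rightarrow> (int \<Rightarrow> 'v \<Rightarrow> 'v) \<Rightarrow> bool" where
  "homotopic M N f g \<longleftrightarrow> (\<exists>h. \<forall>i.
     h i \<in> piece M i \<rightarrow> piece N (i + 1) \<and> lin_on (piece M i) (h i) \<and>
     (\<forall>x\<in>piece M i. act N (i + 1) (h i x) = h (i + 1) (act M i x)) \<and>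
     (\<forall>x\<in>piece M i. f i x - g i x = diff N (i + 1) (h i x) + h (i - 1) (diff M i x)))"

definition cycles :: "'v dgm \<Rightarrow> int \<Rightarrow> 'v set" where
  "cycles M i = {x \<in> piece M i. diff M i x = 0}"

definition boundaries :: "'v dgm \<Rightarrow> int \<Rightarrow> 'v set" where
  "boundaries M i = diff M (i + 1) ` piece M (i + 1)"

text \<open>Injectivity and surjectivity of the induced maps
  \<open>cycles M i / boundaries M i \<rightarrow> cycles N i / boundaries N i\<close>.\<close>

definition quasi_iso :: "'v dgm \<Rightarrow> 'v dgm \<Rightarrow> (int \<Rightarrow> 'v \<Rightarrow> 'v) \<Rightarrow> bool" where
  "quasi_iso M N f \<longleftrightarrow> dg_map M N f \<and> (\<forall>i.
     (\<forall>x\<in>cycles M i. f i x \<in> boundaries N i \<longrightarrow> x \<in> boundaries M i) \<and>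
     (\<forall>y\<in>cycles N i. \<exists>x\<in>cycles M i. y - f i x \<in> boundaries N i))"

text \<open>The direct sum over all \<open>i\<close> of \<open>cycles M i / boundaries M i\<close> is finite dimensional.\<close>

definition finite_homology :: "'v dgm \<Rightarrow> bool" where
  "finite_homology M \<longleftrightarrow>
     finite {i. cycles M i \<noteq> boundaries M i} \<and>
     (\<forall>i. \<exists>F. finite F \<and> F \<subseteq> cycles M i \<and> cycles M i = span (F \<union> boundaries M i))"

definition susp :: "'v dgm \<Rightarrow> 'v dgm" where
  "susp M = \<lparr> piece = \<lambda>i. piece M (i - 1),
              diff = \<lambda>i x. - diff M (i - 1) x,
              act = \<lambda>i. act M (i - 1) \<rparr>"

text \<open>\<open>C\<close> is a mapping cone of \<open>f\<close>: \<open>C i\<close> is the direct sum of \<open>N i\<close> and \<open>M (i - 1)\<close>, as graded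
  modules, with differential \<open>(n, m) \<mapsto> (d n + f m, - d m)\<close>. Here \<open>e\<close> and \<open>p\<close> are the canonical
  maps \<open>N \<rightarrow> C\<close> and \<open>C \<rightarrow> susp M\<close>, and \<open>j\<close> is the inclusion of the second summand.\<close>

definition mapping_cone ::
  "'v dgm \<Rightarrow> 'v dgm \<Rightarrow> (int \<Rightarrow> 'v \<Rightarrow> 'v) \<Rightarrow>
   'v dgm \<Rightarrow> (int \<Rightarrow> 'v \<Rightarrow> 'v) \<Rightarrow> (int \<Rightarrow> 'v \<Rightarrow> 'v) \<Rightarrow> bool" where
  "mapping_cone M N f C e p \<longleftrightarrow>
     dg_module M \<and> dg_module N \<and> dg_module C \<and>
     dg_map M N f \<and> dg_map N C e \<and> dg_map C (susp M) p \<and>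
     (\<exists>j. \<forall>i.
        lin_on (piece M (i - 1)) (j i) \<and>
        bij_betw (\<lambda>(n, m). e i n + j i m) (piece N i \<times> piece M (i - 1)) (piece C i) \<and>
        (\<forall>n\<in>piece N i. \<forall>m\<in>piece M (i - 1). p i (e i n + j i m) = m) \<and>
        (\<forall>m\<in>piece M (i - 1).
           act C i (j i m) = j (i + 1) (act M (i - 1) m) \<and>
           diff C i (j i m) = e (i - 1) (f (i - 1) m) - j (i - 1) (diff M (i - 1) m)))"

subsection \<open>The derived category\<close>

text \<open>The localisation of the homotopy category at the quasi-isomorphisms, by calculus of
  fractions. The operations on morphisms are written without choices: each is the set of all
  roofs equivalent to a result computed from some representatives.\<close>

definition is_roof :: "'v roof \<Rightarrow> bool" where
  "is_roof r \<longleftrightarrow>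
     dg_module (src r) \<and> dg_module (apex r) \<and> dg_module (tgt r) \<and>
     quasi_iso (apex r) (src r) (bwd r) \<and> dg_map (apex r) (tgt r) (fwd r)"

definition roof_eq :: "'v roof \<Rightarrow> 'v roof \<Rightarrow> bool" where
  "roof_eq r r' \<longleftrightarrow> is_roof r \<and> is_roof r' \<and> src r = src r' \<and> tgt r = tgt r' \<and>
     (\<exists>W g g'. dg_module W \<and> dg_map W (apex r) g \<and> dg_map W (apex r') g' \<and>
        quasi_iso W (src r) (gcomp (bwd r) g) \<and>
        homotopic W (src r) (gcomp (bwd r) g) (gcomp (bwd r') g') \<and>
        homotopic W (tgt r) (gcomp (fwd r) g) (gcomp (fwd r') g'))"

definition roof_class :: "'v roof \<Rightarrow> 'v roof set" where
  "roof_class r = {r'. roof_eq r r'}"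

definition dHom :: "'v dgm \<Rightarrow> 'v dgm \<Rightarrow> 'v roof set set" where
  "dHom M N = {roof_class r |r. is_roof r \<and> src r = M \<and> tgt r = N}"

definition dmor :: "'v dgm \<Rightarrow> 'v dgm \<Rightarrow> (int \<Rightarrow> 'v \<Rightarrow> 'v) \<Rightarrow> 'v roof set" where
  "dmor M N f = roof_class \<lparr> src = M, apex = M, tgt = N, bwd = \<lambda>i x. x, fwd = f \<rparr>"

definition dId :: "'v dgm \<Rightarrow> 'v roof set" where
  "dId M = dmor M M (\<lambda>i x. x)"

definition dZero :: "'v dgm \<Rightarrow> 'v dgm \<Rightarrow> 'v roof set" where
  "dZero M N = dmor M N (\<lambda>i x. 0)"

definition dComp :: "'v roof set \<Rightarrow> 'v roof set \<Rightarrow> 'v roof set"  (infixl \<open>\<cdot>\<close> 70) where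
  "b \<cdot> a = {r''. \<exists>r\<in>a. \<exists>r'\<in>b. \<exists>W u h.
      tgt r = src r' \<and> dg_module W \<and> quasi_iso W (apex r) u \<and> dg_map W (apex r') h \<and>
      homotopic W (tgt r) (gcomp (fwd r) u) (gcomp (bwd r') h) \<and>
      roof_eq \<lparr> src = src r, apex = W, tgt = tgt r',
                bwd = gcomp (bwd r) u, fwd = gcomp (fwd r') h \<rparr> r''}"

definition dAdd :: "'v roof set \<Rightarrow> 'v roof set \<Rightarrow> 'v roof set"  (infixl \<open>\<boxplus>\<close> 65) where
  "a \<boxplus> b = {r''. \<exists>r\<in>a. \<exists>r'\<in>b.
      src r = src r' \<and> apex r = apex r' \<and> tgt r = tgt r' \<and> bwd r = bwd r' \<and>
      roof_eq (r\<lparr> fwd := \<lambda>i x. fwd r i x + fwd r' i x \<rparr>) r''}"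

definition dSusp :: "'v roof set \<Rightarrow> 'v roof set" where
  "dSusp a = {r''. \<exists>r\<in>a.
      roof_eq \<lparr> src = susp (src r), apex = susp (apex r), tgt = susp (tgt r),
                bwd = \<lambda>i. bwd r (i - 1), fwd = \<lambda>i. fwd r (i - 1) \<rparr> r''}"

definition iso_mor :: "'v dgm \<Rightarrow> 'v dgm \<Rightarrow> 'v roof set \<Rightarrow> bool" where
  "iso_mor X Y f \<longleftrightarrow> f \<in> dHom X Y \<and> (\<exists>g\<in>dHom Y X. g \<cdot> f = dId X \<and> f \<cdot> g = dId Y)"

definition isomorphic :: "'v dgm \<Rightarrow> 'v dgm \<Rightarrow> bool" where
  "isomorphic X Y \<longleftrightarrow> (\<exists>f. iso_mor X Y f)"

definition split_mono :: "'v dgm \<Rightarrow> 'v dgm \<Rightarrow> 'v roof set \<Rightarrow> bool" where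
  "split_mono X Y f \<longleftrightarrow> f \<in> dHom X Y \<and> (\<exists>g\<in>dHom Y X. g \<cdot> f = dId X)"

definition split_epi :: "'v dgm \<Rightarrow> 'v dgm \<Rightarrow> 'v roof set \<Rightarrow> bool" where
  "split_epi X Y f \<longleftrightarrow> f \<in> dHom X Y \<and> (\<exists>g\<in>dHom Y X. f \<cdot> g = dId Y)"

definition direct_sum :: "'v dgm \<Rightarrow> 'v dgm \<Rightarrow> 'v dgm \<Rightarrow> bool" where
  "direct_sum S A B \<longleftrightarrow>
     (\<exists>i1\<in>dHom A S. \<exists>i2\<in>dHom B S. \<exists>p1\<in>dHom S A. \<exists>p2\<in>dHom S B.
        p1 \<cdot> i1 = dId A \<and> p2 \<cdot> i2 = dId B \<and> p1 \<cdot> i2 = dZero B A \<and> p2 \<cdot> i1 = dZero A B \<and>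
        i1 \<cdot> p1 \<boxplus> i2 \<cdot> p2 = dId S)"

definition distinguished ::
  "'v dgm \<Rightarrow> 'v dgm \<Rightarrow> 'v dgm \<Rightarrow> 'v roof set \<Rightarrow> 'v roof set \<Rightarrow> 'v roof set \<Rightarrow> bool" where
  "distinguished X Y Z u v w \<longleftrightarrow>
     u \<in> dHom X Y \<and> v \<in> dHom Y Z \<and> w \<in> dHom Z (susp X) \<and>
     (\<exists>M N f C e p a b c.
        mapping_cone M N f C e p \<and> iso_mor M X a \<and> iso_mor N Y b \<and> iso_mor C Z c \<and>
        b \<cdot> dmor M N f = u \<cdot> a \<and>
        c \<cdot> dmor N C e = v \<cdot> b \<and>
        dSusp a \<cdot> dmor C (susp M) p = w \<cdot> c)"

subsection \<open>The finite derived category\<close>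

definition Df :: "'v dgm set" where
  "Df = {M. dg_module M \<and> finite_homology M}"

definition zero_object :: "'v dgm \<Rightarrow> bool" where
  "zero_object X \<longleftrightarrow> X \<in> Df \<and> dId X = dZero X X"

definition indecomposable :: "'v dgm \<Rightarrow> bool" where
  "indecomposable X \<longleftrightarrow> X \<in> Df \<and> \<not> zero_object X \<and>
     (\<forall>A\<in>Df. \<forall>B\<in>Df. direct_sum X A B \<longrightarrow> zero_object A \<or> zero_object B)"

definition irreducible_mor :: "'v dgm \<Rightarrow> 'v dgm \<Rightarrow> 'v roof set \<Rightarrow> bool" where
  "irreducible_mor X Y f \<longleftrightarrow> f \<in> dHom X Y \<and> \<not> split_mono X Y f \<and> \<not> split_epi X Y f \<and>
     (\<forall>W\<in>Df. \<forall>g\<in>dHom X W. \<forall>h\<in>dHom W Y. f = h \<cdot> g \<longrightarrow> split_mono X W g \<or> split_epi W Y h)"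

definition AR_triangle ::
  "'v dgm \<Rightarrow> 'v dgm \<Rightarrow> 'v dgm \<Rightarrow> 'v roof set \<Rightarrow> 'v roof set \<Rightarrow> 'v roof set \<Rightarrow> bool" where
  "AR_triangle X Y Z u v w \<longleftrightarrow>
     distinguished X Y Z u v w \<and> indecomposable X \<and> Y \<in> Df \<and> indecomposable Z \<and>
     w \<noteq> dZero Z (susp X) \<and>
     (\<forall>W\<in>Df. \<forall>g\<in>dHom W Z. \<not> split_epi W Z g \<longrightarrow> (\<exists>g'\<in>dHom W Y. g = v \<cdot> g'))"

text \<open>\<open>X\<close> is the AR translate of \<open>Z\<close> (determined up to isomorphism).\<close>

definition AR_translate :: "'v dgm \<Rightarrow> 'v dgm \<Rightarrow> bool" where
  "AR_translate Z X \<longleftrightarrow> (\<exists>Y u v w. AR_triangle X Y Z u v w)"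

definition subcategory :: "'v dgm set \<Rightarrow> bool" where
  "subcategory A \<longleftrightarrow> A \<subseteq> Df \<and>
     (\<forall>X. zero_object X \<longrightarrow> X \<in> A) \<and>
     (\<forall>X\<in>A. \<forall>Y\<in>A. \<forall>S\<in>Df. direct_sum S X Y \<longrightarrow> S \<in> A) \<and>
     (\<forall>S\<in>A. \<forall>X\<in>Df. \<forall>Y\<in>Df. direct_sum S X Y \<longrightarrow> X \<in> A \<and> Y \<in> A)"

definition precover :: "'v dgm set \<Rightarrow> 'v dgm \<Rightarrow> 'v dgm \<Rightarrow> 'v roof set \<Rightarrow> bool" where
  "precover A D X f \<longleftrightarrow> X \<in> A \<and> f \<in> dHom X D \<and>
     (\<forall>X'\<in>A. \<forall>f'\<in>dHom X' D. \<exists>g\<in>dHom X' X. f' = f \<cdot> g)"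

definition precovering :: "'v dgm set \<Rightarrow> bool" where
  "precovering A \<longleftrightarrow> (\<forall>D\<in>Df. \<exists>X f. precover A D X f)"

subsection \<open>Coordinates on the Auslander-Reiten quiver\<close>

text \<open>Only the values of \<open>L\<close> on \<open>arcs\<close> matter. An arrow of the AR quiver is an irreducible
  morphism between the representing indecomposable objects.\<close>

definition AR_labelling :: "(int \<times> int \<Rightarrow> 'v dgm) \<Rightarrow> bool" where
  "AR_labelling L \<longleftrightarrow>
     (\<forall>a\<in>arcs. indecomposable (L a)) \<and>
     (\<forall>X. indecomposable X \<longrightarrow> (\<exists>!a. a \<in> arcs \<and> isomorphic X (L a))) \<and>
     (\<forall>(m, n)\<in>arcs. \<forall>b\<in>arcs.
        (\<exists>f. irreducible_mor (L (m, n)) (L b) f) \<longleftrightarrow>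
        b = (m, n + 1) \<or> (n - m \<ge> 3 \<and> b = (m + 1, n))) \<and>
     (\<forall>(m, n)\<in>arcs. isomorphic (susp (L (m, n))) (L (m - 1, n - 1))) \<and>
     (\<forall>(m, n)\<in>arcs. AR_translate (L (m, n)) (L (m - 1, n - 1)))"

end

end

theory Submission
  imports Defs
begin

text \<open>
  Since \<open>k[T]\<close> is hereditary, every DG module is quasi-isomorphic to its homology. A module \<open>N\<close> with
  zero differential is resolved by the cone of
  \<open>T \<otimes> 1 - 1 \<otimes> T : k[T] \<otimes> \<Sigma>N \<rightarrow> k[T] \<otimes> N\<close>, so that a morphism in the derived category from \<open>N\<close> to
  another such module \<open>N'\<close> is a pair \<open>(s, t)\<close> of a \<open>T\<close>-linear map \<open>s\<close> of degree 0 and a linear map \<open>t\<close>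
  of degree 2, the latter modulo \<open>T p - p T\<close>; the composite of \<open>(s, t)\<close> and \<open>(s', t')\<close> is
  \<open>(s' s, s' t + t' s)\<close>.

  The indecomposable objects are the interval modules \<open>E a b\<close>, with homology \<open>k\<close> in the degrees from \<open>a\<close>
  to \<open>b\<close>, and irreducible morphisms shorten an interval at the top or lengthen it at the bottom by one.
  This forces the arc \<open>(m, n)\<close> to be \<open>E (s - n + 2) (s - m)\<close> for a constant \<open>s\<close>. Up to scalars there is
  one map \<open>E a b \<rightarrow> E c d\<close> of degree 0 if \<open>c \<le> a \<le> d \<le> b\<close>, one of degree 2 if
  \<open>a + 2 \<le> c \<le> b + 2 \<le> d\<close>, and no other. Only the maps of degree 2 from
  infinitely many \<open>E a b\<close> with the same \<open>b\<close> (a right fountain) obstruct a finite precover.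
  They all factor through \<open>E (b + 2) e\<close> for any \<open>e \<ge> d\<close>, and when \<open>c = b + 2\<close> and \<open>a\<close> is small nothing else can absorb
  them, so the condition is that such \<open>e\<close> are unbounded (a left fountain).
\<close>

text \<open>Morphisms of the derived category are given as sets of roofs, so nothing can be computed
  before each object has a resolution on which all roofs out of it can be compared: they become
  homotopy classes of maps. The resolution has to live in the same ambient space as the modules;
  infinite dimension makes room, since the space then contains independent copies of itself.

  Why right and left are not symmetric: a map of degree 0 into \<open>E c d\<close> confines the
  bottom of its source between \<open>c\<close> and \<open>d\<close> and leaves the top unbounded
  above, but it factors through shorter sources with the same bottom, and there is a shortest one
  reaching \<open>d\<close>. A map of degree 2 confines the top \<open>b\<close> and leaves the
  bottom unbounded below; it factors through longer sources with the same top, and among infinitely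
  many there is no longest.

  An integer \<open>n\<close> prescribes the top \<open>s - n\<close> of the intervals whose arc
  starts in \<open>n\<close> and the bottom \<open>s - n + 2\<close> of those whose arc ends in
  \<open>n\<close>. The 2 is the degree of the second kind of map, which leads from the top of an
  interval of the first sort to the bottom of one of the second sort.\<close>

context dg_universe
begin

subsection \<open>Linear algebra\<close>

lemma lin_on_add: "lin_on S f \<Longrightarrow> x \<in> S \<Longrightarrow> y \<in> S \<Longrightarrow> f (x + y) = f x + f y"
  by (auto simp: lin_on_def)

lemma lin_on_scale: "lin_on S f \<Longrightarrow> x \<in> S \<Longrightarrow> f (c *s x) = c *s f x"
  by (auto simp: lin_on_def)

lemma lin_on_zero: "lin_on S f \<Longrightarrow> subspace S \<Longrightarrow> f 0 = 0"
  using lin_on_scale[of S f 0 0] by (simp add: subspace_0)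

lemma lin_on_minus: "lin_on S f \<Longrightarrow> x \<in> S \<Longrightarrow> f (- x) = - f x"
  using lin_on_scale[of S f x "- 1"] by simp

lemma lin_on_diff: "lin_on S f \<Longrightarrow> subspace S \<Longrightarrow> x \<in> S \<Longrightarrow> y \<in> S \<Longrightarrow> f (x - y) = f x - f y"
  using lin_on_add[of S f x "- y"] lin_on_minus[of S f y] by (simp add: subspace_neg)

lemma lin_onI:
  assumes "\<And>x y. x \<in> S \<Longrightarrow> y \<in> S \<Longrightarrow> f (x + y) = f x + f y"
    and "\<And>c x. x \<in> S \<Longrightarrow> f (c *s x) = c *s f x"
  shows "lin_on S f"
  using assms by (auto simp: lin_on_def)

lemma lin_on_mono: "lin_on S f \<Longrightarrow> S' \<subseteq> S \<Longrightarrow> lin_on S' f"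
  by (auto simp: lin_on_def subset_iff)

lemma lin_on_ident: "lin_on S (\<lambda>x. x)"
  by (auto simp: lin_on_def)

lemma lin_on_const0: "lin_on S (\<lambda>x. 0)"
  by (auto simp: lin_on_def)

lemma lin_on_comp: "lin_on S f \<Longrightarrow> f \<in> S \<rightarrow> S' \<Longrightarrow> lin_on S' g \<Longrightarrow> lin_on S (\<lambda>x. g (f x))"
  by (auto simp: lin_on_def Pi_iff)

lemma lin_on_plus: "lin_on S f \<Longrightarrow> lin_on S g \<Longrightarrow> lin_on S (\<lambda>x. f x + g x)"
  by (auto simp: lin_on_def scale_right_distrib)

lemma lin_on_uminus: "lin_on S f \<Longrightarrow> lin_on S (\<lambda>x. - f x)"
  by (auto simp: lin_on_def)

lemma lin_on_sub: "lin_on S f \<Longrightarrow> lin_on S g \<Longrightarrow> lin_on S (\<lambda>x. f x - g x)"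
  by (auto simp: lin_on_def scale_right_diff_distrib)

lemma lin_on_scaled: "lin_on S f \<Longrightarrow> lin_on S (\<lambda>x. c *s f x)"
  by (auto simp: lin_on_def scale_right_distrib scale_left_commute)

lemma lin_on_UNIV_iff: "lin_on UNIV f \<longleftrightarrow> Vector_Spaces.linear scale scale f"
  by (auto simp: lin_on_def Vector_Spaces.linear_iff vector_space_axioms)

lemma lin_on_eq_on_span:
  assumes "lin_on S f" "lin_on S g" "subspace S" "B \<subseteq> S" "\<And>b. b \<in> B \<Longrightarrow> f b = g b" "x \<in> span B"
  shows "f x = g x"
proof -
  have "x \<in> S \<and> f x = g x"
    using assms(6)
  proof (induction rule: span_induct_alt)
    case base
    show ?case using assms lin_on_zero subspace_0 by metis
  next
    case (step c x y)
    then show ?case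
      using assms(1-5) by (auto simp: lin_on_add lin_on_scale subspace_scale subspace_add subset_iff)
  qed
  then show ?thesis ..
qed

text \<open>Values chosen on a basis of \<open>S\<close> extend linearly, and closure of
  \<open>R\<close> under sums and scalar multiples carries the property from the basis to its span.
  In this way lifts and null-homotopies can be found one element at a time and still be chosen
  linear.\<close>

lemma linear_choice:
  assumes S: "subspace S" and ex: "\<And>x. x \<in> S \<Longrightarrow> \<exists>y. R x y"
    and add: "\<And>x y x' y'. x \<in> S \<Longrightarrow> x' \<in> S \<Longrightarrow> R x y \<Longrightarrow> R x' y' \<Longrightarrow> R (x + x') (y + y')"
    and sc: "\<And>c x y. x \<in> S \<Longrightarrow> R x y \<Longrightarrow> R (c *s x) (c *s y)"
  shows "\<exists>f. lin_on UNIV f \<and> (\<forall>x\<in>S. R x (f x))"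
proof -
  interpret vector_space_pair scale scale by unfold_locales
  obtain B where B: "B \<subseteq> S" "independent B" "S \<subseteq> span B"
    by (rule maximal_independent_subset)
  obtain f0 where f0: "\<And>x. x \<in> B \<Longrightarrow> R x (f0 x)"
    using ex B(1) by (metis subsetD)
  define g where "g = construct B f0"
  have lg: "lin_on UNIV g"
    unfolding g_def lin_on_UNIV_iff by (rule linear_construct[OF B(2)])
  have g0: "g 0 = 0"
    using lin_on_zero[OF lg] by simp
  \<comment> \<open>Any witness for 0, multiplied by the scalar 0; this starts the induction over
    the span.\<close>
  have R0: "R 0 0"
  proof -
    obtain y where "R 0 y" using ex S subspace_0 by blast
    then show ?thesis using sc[of 0 y 0] S by (simp add: subspace_0)
  qed
  have "x \<in> S \<and> R x (g x)" if "x \<in> span B" for x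
    using that
  proof (induction rule: span_induct_alt)
    case base
    show ?case using R0 g0 S by (simp add: subspace_0)
  next
    case (step c x y)
    have "g (c *s x + y) = c *s f0 x + g y"
      using lg construct_basis[OF B(2) step(1), of f0]
      by (simp add: lin_on_add lin_on_scale g_def)
    moreover have "x \<in> S" using step B by auto
    ultimately show ?case
      using step S f0[OF step(1)] by (auto intro!: add sc simp: subspace_add subspace_scale)
  qed
  then show ?thesis using lg B(3) by blast
qed

lemma linear_choice_graded:
  fixes S :: "int \<Rightarrow> 'v set"
  assumes "\<And>i. subspace (S i)" "\<And>i x. x \<in> S i \<Longrightarrow> \<exists>y. R i x y"
    and "\<And>i x y x' y'. x \<in> S i \<Longrightarrow> x' \<in> S i \<Longrightarrow> R i x y \<Longrightarrow> R i x' y' \<Longrightarrow> R i (x + x') (y + y')"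
    and "\<And>i c x y. x \<in> S i \<Longrightarrow> R i x y \<Longrightarrow> R i (c *s x) (c *s y)"
  obtains f where "\<And>i. lin_on UNIV (f i)" "\<And>i x. x \<in> S i \<Longrightarrow> R i x (f i x)"
proof -
  have "\<exists>f. lin_on UNIV f \<and> (\<forall>x\<in>S i. R i x (f x))" for i
    by (rule linear_choice) (use assms in auto)
  then obtain f where "\<forall>i. lin_on UNIV (f i) \<and> (\<forall>x\<in>S i. R i x (f i x))" by metis
  then show ?thesis using that by metis
qed

lemma projection_exists:
  assumes "subspace U"
  shows "\<exists>g. lin_on UNIV g \<and> (\<forall>x\<in>U. g x = x) \<and> (\<forall>x. g x \<in> U)"
proof -
  interpret vector_space_pair scale scale by unfold_locales
  obtain B where B: "B \<subseteq> U" "independent B" "U \<subseteq> span B"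
    by (rule maximal_independent_subset)
  have sB: "span B = U"
    using B assms by (simp add: subset_antisym span_minimal)
  obtain g where g: "Vector_Spaces.linear scale scale g" "\<forall>x\<in>B. g x = x" "range g = span ((\<lambda>x. x) ` B)"
    using linear_independent_extend_subspace[OF B(2), of "\<lambda>x. x"] by auto
  have "g x = x" if "x \<in> U" for x
    by (rule lin_on_eq_on_span[of UNIV g "\<lambda>x. x" B])
      (use g sB that in \<open>auto simp: lin_on_UNIV_iff[symmetric] lin_on_ident subspace_UNIV\<close>)
  moreover have "g x \<in> U" for x using g(3) sB by auto
  ultimately show ?thesis using g(1) lin_on_UNIV_iff by blast
qed

lemma functional_exists:
  assumes "y \<noteq> 0"
  shows "\<exists>g. lin_on UNIV g \<and> g y = v \<and> (\<forall>x. g x \<in> span {v})"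
proof -
  interpret vector_space_pair scale scale by unfold_locales
  have "independent {y}" using assms by simp
  from linear_independent_extend_subspace[OF this, of "\<lambda>_. v"]
  obtain g where "Vector_Spaces.linear scale scale g" "g y = v" "range g = span {v}"
    by auto
  then show ?thesis using lin_on_UNIV_iff by (metis rangeI)
qed

text \<open>A basis \<open>B\<close> is infinite, so two disjoint copies of \<open>B\<close> embed
  into \<open>B\<close>. The two halves of this embedding extend to injections \<open>j1\<close> and
  \<open>j2\<close> with independent images, and their partial inverses on the basis extend to the
  projections.\<close>

lemma doubling_exists:
  "\<exists>j1 j2 p1 p2. lin_on UNIV j1 \<and> lin_on UNIV j2 \<and> lin_on UNIV p1 \<and> lin_on UNIV p2 \<and>
     (\<forall>x. p1 (j1 x) = x) \<and> (\<forall>x. p2 (j2 x) = x) \<and> (\<forall>x. p1 (j2 x) = 0) \<and> (\<forall>x. p2 (j1 x) = 0)"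
proof -
  interpret vector_space_pair scale scale by unfold_locales
  obtain B where B: "independent B" "UNIV \<subseteq> span B"
    using maximal_independent_subset[of UNIV] by metis
  then have sB: "span B = UNIV" by auto
  have "infinite B" using infinite_dim sB by blast
  then obtain h where h: "inj_on h (B <+> B)" "h ` (B <+> B) \<subseteq> B"
    using card_of_ordLeq[of "B <+> B" B] card_of_Plus_infinite1[of B B] card_of_mono1[of B B]
      ordIso_imp_ordLeq by blast
  \<comment> \<open>Partial inverse of the first half of \<open>h\<close>. Basis vectors outside its
    image go to 0, which makes the resulting projection vanish on the second copy.\<close>
  define k1 where "k1 b = (if \<exists>c\<in>B. b = h (Inl c) then SOME c. c \<in> B \<and> b = h (Inl c) else 0)" for b
  define k2 where "k2 b = (if \<exists>c\<in>B. b = h (Inr c) then SOME c. c \<in> B \<and> b = h (Inr c) else 0)" for b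
  have inj: "h (Inl b) = h (Inl c) \<longleftrightarrow> b = c" "h (Inr b) = h (Inr c) \<longleftrightarrow> b = c"
    "h (Inl b) \<noteq> h (Inr c)" "h (Inr b) \<noteq> h (Inl c)" if "b \<in> B" "c \<in> B" for b c
    using inj_on_eq_iff[OF h(1)] that by (auto simp: InlI InrI)
  have k: "k1 (h (Inl b)) = b" "k2 (h (Inr b)) = b" "k1 (h (Inr b)) = 0" "k2 (h (Inl b)) = 0"
    if "b \<in> B" for b
    using that unfolding k1_def k2_def by (auto simp: inj cong: conj_cong)
  have hB: "h (Inl b) \<in> B" "h (Inr b) \<in> B" if "b \<in> B" for b
    using h(2) that by (auto simp: image_subset_iff)
  let ?C = "construct B"
  have lin: "lin_on UNIV (?C f)" for f
    by (simp add: lin_on_UNIV_iff linear_construct[OF B(1)])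
  have eq: "?C f (?C g x) = ?C e x"
    if "\<And>b. b \<in> B \<Longrightarrow> g b \<in> B" "\<And>b. b \<in> B \<Longrightarrow> f (g b) = e b" for f g e x
  proof (rule lin_on_eq_on_span[of UNIV "\<lambda>x. ?C f (?C g x)" _ B])
    show "lin_on UNIV (\<lambda>x. ?C f (?C g x))" by (rule lin_on_comp[OF lin _ lin]) simp
  qed (use that sB in \<open>auto simp: lin construct_basis[OF B(1)] subspace_UNIV\<close>)
  have id: "?C (\<lambda>b. b) x = x" for x
    by (rule lin_on_eq_on_span[of UNIV _ _ B])
      (use sB in \<open>auto simp: lin lin_on_ident construct_basis[OF B(1)] subspace_UNIV\<close>)
  have zero: "?C (\<lambda>b. 0) x = 0" for x
    by (rule lin_on_eq_on_span[of UNIV _ _ B])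
      (use sB in \<open>auto simp: lin lin_on_const0 construct_basis[OF B(1)] subspace_UNIV\<close>)
  show ?thesis
    by (rule exI[of _ "?C (\<lambda>b. h (Inl b))"], rule exI[of _ "?C (\<lambda>b. h (Inr b))"],
        rule exI[of _ "?C k1"], rule exI[of _ "?C k2"])
      (auto simp: lin hB k eq[where e = "\<lambda>b. b"] eq[where e = "\<lambda>b. 0"] id zero)
qed

text \<open>Injections \<open>sg\<close>, \<open>e0\<close>, \<open>e1\<close> of the universe into itself with independent images, and
  projections \<open>rh\<close>, \<open>p0\<close>, \<open>p1\<close> onto these images. Multiplication by \<open>T\<close> on free modules will
  be \<open>sg\<close>.\<close>

definition split_maps ::
  "('v \<Rightarrow> 'v) \<times> ('v \<Rightarrow> 'v) \<times> ('v \<Rightarrow> 'v) \<times> ('v \<Rightarrow> 'v) \<times> ('v \<Rightarrow> 'v) \<times> ('v \<Rightarrow> 'v) \<Rightarrow> bool" where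
  "split_maps = (\<lambda>(sg, rh, e0, p0, e1, p1).
     lin_on UNIV sg \<and> lin_on UNIV rh \<and> lin_on UNIV e0 \<and> lin_on UNIV p0 \<and>
     lin_on UNIV e1 \<and> lin_on UNIV p1 \<and>
     (\<forall>x. rh (sg x) = x \<and> p0 (sg x) = 0 \<and> p1 (sg x) = 0 \<and>
          rh (e0 x) = 0 \<and> p0 (e0 x) = x \<and> p1 (e0 x) = 0 \<and>
          rh (e1 x) = 0 \<and> p0 (e1 x) = 0 \<and> p1 (e1 x) = x))"

text \<open>One choice fixed for good, so that resolutions and direct sums become functions of the
  modules.\<close>

definition "the_split_maps = (SOME u. split_maps u)"
definition "sg = fst the_split_maps"
definition "rh = fst (snd the_split_maps)"
definition "e0 = fst (snd (snd the_split_maps))"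
definition "p0 = fst (snd (snd (snd the_split_maps)))"
definition "e1 = fst (snd (snd (snd (snd the_split_maps))))"
definition "p1 = snd (snd (snd (snd (snd the_split_maps))))"

lemma split_maps_all: "split_maps (sg, rh, e0, p0, e1, p1)"
proof -
  obtain j1 j2 q1 q2 where j:
    "lin_on UNIV j1" "lin_on UNIV j2" "lin_on UNIV q1" "lin_on UNIV q2"
    "\<And>x. q1 (j1 x) = x" "\<And>x. q2 (j2 x) = x" "\<And>x. q1 (j2 x) = 0" "\<And>x. q2 (j1 x) = 0"
    using doubling_exists by metis
  have z: "q1 0 = 0" "q2 0 = 0"
    using lin_on_zero[OF j(3)] lin_on_zero[OF j(4)] by simp_all
  have c: "lin_on UNIV (\<lambda>x. f (g x))" if "lin_on UNIV f" "lin_on UNIV g" for f g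
    by (rule lin_on_comp[OF that(2) _ that(1)]) simp
  \<comment> \<open>Two doublings give three independent copies: the second half of the first
    doubling for \<open>sg\<close>, and the first half, split again, for \<open>e0\<close> and
    \<open>e1\<close>.\<close>
  have "split_maps (j2, q2, \<lambda>x. j1 (j1 x), \<lambda>x. q1 (q1 x), \<lambda>x. j1 (j2 x), \<lambda>x. q2 (q1 x))"
    by (simp add: split_maps_def j z c)
  then have "split_maps the_split_maps"
    unfolding the_split_maps_def by (rule someI)
  then show ?thesis
    by (simp add: sg_def rh_def e0_def p0_def e1_def p1_def)
qed

lemma split_lin:
  "lin_on UNIV sg" "lin_on UNIV rh" "lin_on UNIV e0" "lin_on UNIV p0" "lin_on UNIV e1" "lin_on UNIV p1"
  using split_maps_all by (auto simp: split_maps_def)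

lemma split_simps [simp]:
  "rh (sg x) = x" "p0 (sg x) = 0" "p1 (sg x) = 0"
  "rh (e0 x) = 0" "p0 (e0 x) = x" "p1 (e0 x) = 0"
  "rh (e1 x) = 0" "p0 (e1 x) = 0" "p1 (e1 x) = x"
  using split_maps_all by (auto simp: split_maps_def)

lemma split_add [simp]:
  "sg (x + y) = sg x + sg y" "rh (x + y) = rh x + rh y" "e0 (x + y) = e0 x + e0 y"
  "p0 (x + y) = p0 x + p0 y" "e1 (x + y) = e1 x + e1 y" "p1 (x + y) = p1 x + p1 y"
  using split_lin by (auto simp: lin_on_def)

lemma split_scale [simp]:
  "sg (c *s x) = c *s sg x" "rh (c *s x) = c *s rh x" "e0 (c *s x) = c *s e0 x"
  "p0 (c *s x) = c *s p0 x" "e1 (c *s x) = c *s e1 x" "p1 (c *s x) = c *s p1 x"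
  using split_lin by (auto simp: lin_on_def)

lemma split_zero [simp]: "sg 0 = 0" "rh 0 = 0" "e0 0 = 0" "p0 0 = 0" "e1 0 = 0" "p1 0 = 0"
  by (simp_all add: split_lin lin_on_zero[of UNIV])

lemma split_uminus [simp]:
  "sg (- x) = - sg x" "rh (- x) = - rh x" "e0 (- x) = - e0 x"
  "p0 (- x) = - p0 x" "e1 (- x) = - e1 x" "p1 (- x) = - p1 x"
  by (simp_all add: split_lin lin_on_minus[of UNIV])

lemma split_diff [simp]:
  "sg (x - y) = sg x - sg y" "rh (x - y) = rh x - rh y" "e0 (x - y) = e0 x - e0 y"
  "p0 (x - y) = p0 x - p0 y" "e1 (x - y) = e1 x - e1 y" "p1 (x - y) = p1 x - p1 y"
  by (simp_all add: split_lin lin_on_diff[of UNIV])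

subsection \<open>DG modules, homotopies and quasi-isomorphisms\<close>

lemma dg_moduleD:
  assumes "dg_module M"
  shows piece_subspace: "subspace (piece M i)"
    and diff_in: "x \<in> piece M i \<Longrightarrow> diff M i x \<in> piece M (i - 1)"
    and act_in: "x \<in> piece M i \<Longrightarrow> act M i x \<in> piece M (i + 1)"
    and diff_lin: "lin_on (piece M i) (diff M i)"
    and act_lin: "lin_on (piece M i) (act M i)"
    and diff_diff: "x \<in> piece M i \<Longrightarrow> diff M (i - 1) (diff M i x) = 0"
    and diff_act: "x \<in> piece M i \<Longrightarrow> diff M (i + 1) (act M i x) = act M (i - 1) (diff M i x)"
  using assms by (auto simp: dg_module_def Pi_iff)

lemma diff_in': "dg_module M \<Longrightarrow> x \<in> piece M (i + 1) \<Longrightarrow> diff M (i + 1) x \<in> piece M i"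
  using diff_in[of M x "i + 1"] by simp

lemma act_in': "dg_module M \<Longrightarrow> x \<in> piece M (i - 1) \<Longrightarrow> act M (i - 1) x \<in> piece M i"
  using act_in[of M x "i - 1"] by simp

lemma diff_diff': "dg_module M \<Longrightarrow> x \<in> piece M (i + 1) \<Longrightarrow> diff M i (diff M (i + 1) x) = 0"
  using diff_diff[of M x "i + 1"] by simp

lemma piece_closed:
  assumes "dg_module M"
  shows "0 \<in> piece M i"
    and "x \<in> piece M i \<Longrightarrow> y \<in> piece M i \<Longrightarrow> x + y \<in> piece M i"
    and "x \<in> piece M i \<Longrightarrow> y \<in> piece M i \<Longrightarrow> x - y \<in> piece M i"
    and "x \<in> piece M i \<Longrightarrow> c *s x \<in> piece M i"
    and "x \<in> piece M i \<Longrightarrow> - x \<in> piece M i"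
  using piece_subspace[OF assms, of i]
  by (auto simp: subspace_0 subspace_add subspace_diff subspace_scale subspace_neg)

lemma diff_linear:
  assumes "dg_module M"
  shows "diff M i 0 = 0"
    and "x \<in> piece M i \<Longrightarrow> y \<in> piece M i \<Longrightarrow> diff M i (x + y) = diff M i x + diff M i y"
    and "x \<in> piece M i \<Longrightarrow> y \<in> piece M i \<Longrightarrow> diff M i (x - y) = diff M i x - diff M i y"
    and "x \<in> piece M i \<Longrightarrow> diff M i (c *s x) = c *s diff M i x"
    and "x \<in> piece M i \<Longrightarrow> diff M i (- x) = - diff M i x"
  using diff_lin[OF assms, of i] piece_subspace[OF assms, of i]
  by (auto simp: lin_on_zero lin_on_add lin_on_diff lin_on_scale lin_on_minus)

lemma act_linear:
  assumes "dg_module M"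
  shows "act M i 0 = 0"
    and "x \<in> piece M i \<Longrightarrow> y \<in> piece M i \<Longrightarrow> act M i (x + y) = act M i x + act M i y"
    and "x \<in> piece M i \<Longrightarrow> y \<in> piece M i \<Longrightarrow> act M i (x - y) = act M i x - act M i y"
    and "x \<in> piece M i \<Longrightarrow> act M i (c *s x) = c *s act M i x"
    and "x \<in> piece M i \<Longrightarrow> act M i (- x) = - act M i x"
  using act_lin[OF assms, of i] piece_subspace[OF assms, of i]
  by (auto simp: lin_on_zero lin_on_add lin_on_diff lin_on_scale lin_on_minus)

lemma dg_mapD:
  assumes "dg_map M N f"
  shows map_in: "x \<in> piece M i \<Longrightarrow> f i x \<in> piece N i"
    and map_lin: "lin_on (piece M i) (f i)"
    and map_diff: "x \<in> piece M i \<Longrightarrow> diff N i (f i x) = f (i - 1) (diff M i x)"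
    and map_act: "x \<in> piece M i \<Longrightarrow> act N i (f i x) = f (i + 1) (act M i x)"
  using assms by (auto simp: dg_map_def Pi_iff)

lemma map_linear:
  assumes "dg_module M" "dg_map M N f"
  shows "f i 0 = 0"
    and "x \<in> piece M i \<Longrightarrow> y \<in> piece M i \<Longrightarrow> f i (x + y) = f i x + f i y"
    and "x \<in> piece M i \<Longrightarrow> y \<in> piece M i \<Longrightarrow> f i (x - y) = f i x - f i y"
    and "x \<in> piece M i \<Longrightarrow> f i (c *s x) = c *s f i x"
    and "x \<in> piece M i \<Longrightarrow> f i (- x) = - f i x"
  using map_lin[OF assms(2), of i] piece_subspace[OF assms(1), of i]
  by (auto simp: lin_on_zero lin_on_add lin_on_diff lin_on_scale lin_on_minus)

lemma dg_map_id: "dg_map M M (\<lambda>i x. x)"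
  by (simp add: dg_map_def lin_on_ident)

lemma dg_map_comp:
  assumes "dg_map M N f" "dg_map N Y g"
  shows "dg_map M Y (gcomp g f)"
proof -
  note f = dg_mapD[OF assms(1)] and g = dg_mapD[OF assms(2)]
  have "lin_on (piece M i) (\<lambda>x. g i (f i x))" for i
    by (rule lin_on_comp[OF f(2) _ g(2)]) (use f(1) in auto)
  then show ?thesis
    by (auto simp: dg_map_def gcomp_def f(1) f(3,4)[symmetric] g(1,3,4))
qed

lemma dg_map_zero: "dg_module N \<Longrightarrow> dg_map M N (\<lambda>i x. 0)"
  by (simp add: dg_map_def lin_on_const0 piece_closed diff_linear act_linear)

lemma dg_map_add:
  "dg_module N \<Longrightarrow> dg_map M N f \<Longrightarrow> dg_map M N g \<Longrightarrow> dg_map M N (\<lambda>i x. f i x + g i x)"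
  unfolding dg_map_def Pi_iff by (auto intro: lin_on_plus simp: piece_closed diff_linear act_linear)

lemma dg_map_sub:
  "dg_module N \<Longrightarrow> dg_map M N f \<Longrightarrow> dg_map M N g \<Longrightarrow> dg_map M N (\<lambda>i x. f i x - g i x)"
  unfolding dg_map_def Pi_iff by (auto intro: lin_on_sub simp: piece_closed diff_linear act_linear)

lemma gcomp_assoc: "gcomp (gcomp h g) f = gcomp h (gcomp g f)"
  by (simp add: gcomp_def)

lemma gcomp_id [simp]: "gcomp (\<lambda>i x. x) f = f" "gcomp f (\<lambda>i x. x) = f"
  by (simp_all add: gcomp_def)

lemma homotopicI:
  assumes "\<And>i x. x \<in> piece M i \<Longrightarrow> h i x \<in> piece N (i + 1)" "\<And>i. lin_on (piece M i) (h i)"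
    "\<And>i x. x \<in> piece M i \<Longrightarrow> act N (i + 1) (h i x) = h (i + 1) (act M i x)"
    "\<And>i x. x \<in> piece M i \<Longrightarrow> f i x - g i x = diff N (i + 1) (h i x) + h (i - 1) (diff M i x)"
  shows "homotopic M N f g"
  unfolding homotopic_def using assms by (intro exI[of _ h]) auto

lemma homotopicE:
  assumes "homotopic M N f g"
  obtains h where "\<And>i x. x \<in> piece M i \<Longrightarrow> h i x \<in> piece N (i + 1)" "\<And>i. lin_on (piece M i) (h i)"
    "\<And>i x. x \<in> piece M i \<Longrightarrow> act N (i + 1) (h i x) = h (i + 1) (act M i x)"
    "\<And>i x. x \<in> piece M i \<Longrightarrow> f i x - g i x = diff N (i + 1) (h i x) + h (i - 1) (diff M i x)"
proof -
  obtain h where "\<forall>i. h i \<in> piece M i \<rightarrow> piece N (i + 1) \<and> lin_on (piece M i) (h i) \<and>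
     (\<forall>x\<in>piece M i. act N (i + 1) (h i x) = h (i + 1) (act M i x)) \<and>
     (\<forall>x\<in>piece M i. f i x - g i x = diff N (i + 1) (h i x) + h (i - 1) (diff M i x))"
    using assms unfolding homotopic_def by blast
  then show ?thesis by (intro that[of h]) (auto simp: Pi_iff)
qed

lemma homotopic_eq:
  assumes "dg_module N" "\<And>i x. x \<in> piece M i \<Longrightarrow> f i x = g i x"
  shows "homotopic M N f g"
  by (rule homotopicI[of M "\<lambda>i x. 0"])
    (use assms in \<open>auto simp: piece_closed lin_on_const0 act_linear diff_linear\<close>)

lemma homotopic_refl: "dg_module N \<Longrightarrow> homotopic M N f f"
  by (rule homotopic_eq) simp_all

lemma homotopic_sym:
  assumes "dg_module M" "dg_module N" "homotopic M N f g"
  shows "homotopic M N g f"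
proof -
  obtain h where h: "\<And>i x. x \<in> piece M i \<Longrightarrow> h i x \<in> piece N (i + 1)" "\<And>i. lin_on (piece M i) (h i)"
    "\<And>i x. x \<in> piece M i \<Longrightarrow> act N (i + 1) (h i x) = h (i + 1) (act M i x)"
    "\<And>i x. x \<in> piece M i \<Longrightarrow> f i x - g i x = diff N (i + 1) (h i x) + h (i - 1) (diff M i x)"
    by (rule homotopicE[OF assms(3)]) blast
  show ?thesis
  proof (rule homotopicI[of M "\<lambda>i x. - h i x"])
    show "g i x - f i x = diff N (i + 1) (- h i x) + - h (i - 1) (diff M i x)" if "x \<in> piece M i"
        for i x
    proof -
      have "g i x - f i x = - (f i x - g i x)" by simp
      then show ?thesis using h(4)[OF that] h(1)[OF that] assms(2) by (simp add: diff_linear)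
    qed
  qed (use h assms in \<open>auto simp: piece_closed lin_on_uminus act_linear\<close>)
qed

lemma homotopic_add:
  assumes "dg_module N" "homotopic M N f g" "homotopic M N f' g'"
  shows "homotopic M N (\<lambda>i x. f i x + f' i x) (\<lambda>i x. g i x + g' i x)"
proof -
  obtain h where h: "\<And>i x. x \<in> piece M i \<Longrightarrow> h i x \<in> piece N (i + 1)" "\<And>i. lin_on (piece M i) (h i)"
    "\<And>i x. x \<in> piece M i \<Longrightarrow> act N (i + 1) (h i x) = h (i + 1) (act M i x)"
    "\<And>i x. x \<in> piece M i \<Longrightarrow> f i x - g i x = diff N (i + 1) (h i x) + h (i - 1) (diff M i x)"
    by (rule homotopicE[OF assms(2)]) blast
  obtain k where k: "\<And>i x. x \<in> piece M i \<Longrightarrow> k i x \<in> piece N (i + 1)" "\<And>i. lin_on (piece M i) (k i)"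
    "\<And>i x. x \<in> piece M i \<Longrightarrow> act N (i + 1) (k i x) = k (i + 1) (act M i x)"
    "\<And>i x. x \<in> piece M i \<Longrightarrow> f' i x - g' i x = diff N (i + 1) (k i x) + k (i - 1) (diff M i x)"
    by (rule homotopicE[OF assms(3)]) blast
  show ?thesis
  proof (rule homotopicI[of M "\<lambda>i x. h i x + k i x"])
    show "f i x + f' i x - (g i x + g' i x) =
      diff N (i + 1) (h i x + k i x) + (h (i - 1) (diff M i x) + k (i - 1) (diff M i x))"
      if "x \<in> piece M i" for i x
      using h(4)[OF that] k(4)[OF that] h(1)[OF that] k(1)[OF that] assms(1)
      by (simp add: diff_linear algebra_simps)
  qed (use h k assms in \<open>auto simp: piece_closed lin_on_plus act_linear\<close>)
qed

text \<open>A homotopy only sees the difference of the two maps. Adding the given homotopies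
  compares \<open>f + g\<close> with \<open>g + k\<close>, whose difference is that of
  \<open>f\<close> and \<open>k\<close>.\<close>

lemma homotopic_trans:
  assumes "dg_module N" "homotopic M N f g" "homotopic M N g k"
  shows "homotopic M N f k"
proof -
  have "homotopic M N (\<lambda>i x. f i x + g i x) (\<lambda>i x. g i x + k i x)"
    by (rule homotopic_add[OF assms])
  then show ?thesis by (simp add: homotopic_def)
qed

lemma homotopic_diff0: "homotopic M N f g \<longleftrightarrow> homotopic M N (\<lambda>i x. f i x - g i x) (\<lambda>i x. 0)"
  by (simp add: homotopic_def)

lemma homotopic_post:
  assumes "dg_module N" "homotopic M N f g" "dg_map N Y u"
    "\<And>i x. x \<in> piece M i \<Longrightarrow> f i x \<in> piece N i" "\<And>i x. x \<in> piece M i \<Longrightarrow> g i x \<in> piece N i"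
    "\<And>i x. x \<in> piece M i \<Longrightarrow> diff M i x \<in> piece M (i - 1)"
  shows "homotopic M Y (gcomp u f) (gcomp u g)"
proof -
  obtain h where h: "\<And>i x. x \<in> piece M i \<Longrightarrow> h i x \<in> piece N (i + 1)" "\<And>i. lin_on (piece M i) (h i)"
    "\<And>i x. x \<in> piece M i \<Longrightarrow> act N (i + 1) (h i x) = h (i + 1) (act M i x)"
    "\<And>i x. x \<in> piece M i \<Longrightarrow> f i x - g i x = diff N (i + 1) (h i x) + h (i - 1) (diff M i x)"
    by (rule homotopicE[OF assms(2)]) blast
  show ?thesis
  proof (rule homotopicI[of M "\<lambda>i x. u (i + 1) (h i x)"])
    show "lin_on (piece M i) (\<lambda>x. u (i + 1) (h i x))" for i
      by (rule lin_on_comp[OF h(2) _ map_lin[OF assms(3)]]) (use h(1) in auto)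
    show "act Y (i + 1) (u (i + 1) (h i x)) = u (i + 1 + 1) (h (i + 1) (act M i x))"
      if "x \<in> piece M i" for i x
      using map_act[OF assms(3) h(1)[OF that]] h(3)[OF that] by simp
    show "gcomp u f i x - gcomp u g i x =
       diff Y (i + 1) (u (i + 1) (h i x)) + u (i - 1 + 1) (h (i - 1) (diff M i x))"
      if x: "x \<in> piece M i" for i x
    proof -
      have 1: "h (i - 1) (diff M i x) \<in> piece N i" using h(1)[OF assms(6)[OF x]] by simp
      have 2: "diff N (i + 1) (h i x) \<in> piece N i" using diff_in'[OF assms(1) h(1)[OF x]] .
      have "u i (f i x) - u i (g i x) = u i (f i x - g i x)"
        using map_linear[OF assms(1,3)] assms(4,5) x by simp
      also have "\<dots> = u i (diff N (i + 1) (h i x)) + u i (h (i - 1) (diff M i x))"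
        using h(4)[OF x] map_linear(2)[OF assms(1,3) 2 1] by simp
      also have "u i (diff N (i + 1) (h i x)) = diff Y (i + 1) (u (i + 1) (h i x))"
        using map_diff[OF assms(3) h(1)[OF x]] by simp
      finally show ?thesis by (simp add: gcomp_def)
    qed
  qed (use h map_in[OF assms(3)] in auto)
qed

lemma homotopic_post_map:
  assumes "dg_module M" "dg_module N" "homotopic M N f g" "dg_map N Y u" "dg_map M N f" "dg_map M N g"
  shows "homotopic M Y (gcomp u f) (gcomp u g)"
  by (rule homotopic_post[OF assms(2-4)]) (use assms in \<open>auto simp: map_in diff_in\<close>)

lemma homotopic_pre:
  assumes "homotopic M N f g" "dg_map W M u"
  shows "homotopic W N (gcomp f u) (gcomp g u)"
proof -
  obtain h where h: "\<And>i x. x \<in> piece M i \<Longrightarrow> h i x \<in> piece N (i + 1)" "\<And>i. lin_on (piece M i) (h i)"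
    "\<And>i x. x \<in> piece M i \<Longrightarrow> act N (i + 1) (h i x) = h (i + 1) (act M i x)"
    "\<And>i x. x \<in> piece M i \<Longrightarrow> f i x - g i x = diff N (i + 1) (h i x) + h (i - 1) (diff M i x)"
    by (rule homotopicE[OF assms(1)]) blast
  show ?thesis
  proof (rule homotopicI[of W "\<lambda>i x. h i (u i x)"])
    show "lin_on (piece W i) (\<lambda>x. h i (u i x))" for i
      by (rule lin_on_comp[OF map_lin[OF assms(2)] _ h(2)]) (use map_in[OF assms(2)] in auto)
  qed (use h map_in[OF assms(2)] map_act[OF assms(2)] map_diff[OF assms(2)] in \<open>auto simp: gcomp_def\<close>)
qed

lemma cyclesI: "x \<in> piece M i \<Longrightarrow> diff M i x = 0 \<Longrightarrow> x \<in> cycles M i"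
  by (simp add: cycles_def)

lemma boundariesI: "x \<in> piece M (i + 1) \<Longrightarrow> y = diff M (i + 1) x \<Longrightarrow> y \<in> boundaries M i"
  by (simp add: boundaries_def)

lemma boundariesE:
  assumes "y \<in> boundaries M i" obtains x where "x \<in> piece M (i + 1)" "y = diff M (i + 1) x"
  using assms by (auto simp: boundaries_def)

lemma boundaries_cycles: "dg_module M \<Longrightarrow> x \<in> boundaries M i \<Longrightarrow> x \<in> cycles M i"
  by (auto simp: boundaries_def cycles_def diff_in' diff_diff')

lemma cycles_subspace: "dg_module M \<Longrightarrow> subspace (cycles M i)"
  by (rule subspaceI) (auto simp: cycles_def piece_closed diff_linear)

lemma boundaries_subspace: assumes "dg_module M" shows "subspace (boundaries M i)"
proof (rule subspaceI)
  show "0 \<in> boundaries M i"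
    by (rule boundariesI[of 0]) (simp_all add: assms piece_closed diff_linear)
  fix x y c assume "x \<in> boundaries M i"
  then obtain x' where x': "x' \<in> piece M (i + 1)" "x = diff M (i + 1) x'" by (rule boundariesE)
  show "c *s x \<in> boundaries M i"
    by (rule boundariesI[of "c *s x'"]) (simp_all add: assms x' piece_closed diff_linear)
  assume "y \<in> boundaries M i"
  then obtain y' where y': "y' \<in> piece M (i + 1)" "y = diff M (i + 1) y'" by (rule boundariesE)
  show "x + y \<in> boundaries M i"
    by (rule boundariesI[of "x' + y'"]) (simp_all add: assms x' y' piece_closed diff_linear)
qed

lemma map_cycles: "dg_module M \<Longrightarrow> dg_map M N f \<Longrightarrow> x \<in> cycles M i \<Longrightarrow> f i x \<in> cycles N i"
  by (auto simp: cycles_def map_in map_diff map_linear)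

lemma map_boundaries: "dg_map M N f \<Longrightarrow> x \<in> boundaries M i \<Longrightarrow> f i x \<in> boundaries N i"
  unfolding boundaries_def using map_diff[of M N f _ "i + 1"] map_in[of M N f _ "i + 1"] by force

lemma act_cycles: "dg_module M \<Longrightarrow> x \<in> cycles M i \<Longrightarrow> act M i x \<in> cycles M (i + 1)"
  by (auto simp: cycles_def act_in diff_act act_linear)

lemma quasi_isoD:
  assumes "quasi_iso M N f"
  shows qi_map: "dg_map M N f"
    and qi_inj: "x \<in> cycles M i \<Longrightarrow> f i x \<in> boundaries N i \<Longrightarrow> x \<in> boundaries M i"
    and qi_surj: "y \<in> cycles N i \<Longrightarrow> \<exists>x\<in>cycles M i. y - f i x \<in> boundaries N i"
  using assms by (auto simp: quasi_iso_def)

lemma quasi_iso_id: "dg_module M \<Longrightarrow> quasi_iso M M (\<lambda>i x. x)"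
  unfolding quasi_iso_def using boundaries_subspace[of M] by (auto simp: dg_map_id intro!: bexI
      subspace_0)

lemma quasi_iso_comp:
  assumes "dg_module M" "dg_module N" "dg_module Y" "quasi_iso M N f" "quasi_iso N Y g"
  shows "quasi_iso M Y (gcomp g f)"
  unfolding quasi_iso_def
proof (intro conjI allI ballI impI)
  note mf = qi_map[OF assms(4)] and mg = qi_map[OF assms(5)]
  show "dg_map M Y (gcomp g f)" using dg_map_comp mf mg by blast
  show "x \<in> boundaries M i" if "x \<in> cycles M i" "gcomp g f i x \<in> boundaries Y i" for i x
    using that qi_inj[OF assms(4)] qi_inj[OF assms(5)] map_cycles[OF assms(1) mf]
    by (auto simp: gcomp_def)
  fix i y assume "y \<in> cycles Y i"
  then obtain z where z: "z \<in> cycles N i" "y - g i z \<in> boundaries Y i" using qi_surj[OF assms(5)]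
      by blast
  then obtain x where x: "x \<in> cycles M i" "z - f i x \<in> boundaries N i" using qi_surj[OF assms(4)]
      by blast
  have "g i (z - f i x) = g i z - g i (f i x)"
    using z x map_cycles[OF assms(1) mf x(1)] by (auto simp: cycles_def intro: map_linear[OF
        assms(2) mg])
  with map_boundaries[OF mg x(2)] have "g i z - g i (f i x) \<in> boundaries Y i" by simp
  with z(2) have "(y - g i z) + (g i z - g i (f i x)) \<in> boundaries Y i"
    using boundaries_subspace[OF assms(3)] by (blast intro: subspace_add)
  then show "\<exists>x\<in>cycles M i. y - gcomp g f i x \<in> boundaries Y i"
    using x(1) by (auto simp: gcomp_def)
qed

lemma homotopic_boundary:
  assumes "dg_module M" "dg_module N" "homotopic M N f g" "x \<in> cycles M i"
  shows "f i x - g i x \<in> boundaries N i"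
proof -
  obtain h where h: "\<And>i x. x \<in> piece M i \<Longrightarrow> h i x \<in> piece N (i + 1)" "\<And>i. lin_on (piece M i) (h i)"
    "\<And>i x. x \<in> piece M i \<Longrightarrow> act N (i + 1) (h i x) = h (i + 1) (act M i x)"
    "\<And>i x. x \<in> piece M i \<Longrightarrow> f i x - g i x = diff N (i + 1) (h i x) + h (i - 1) (diff M i x)"
    by (rule homotopicE[OF assms(3)]) blast
  have "h (i - 1) 0 = 0" using lin_on_zero[OF h(2) piece_subspace[OF assms(1)]] .
  then show ?thesis
    using h(1)[of x i] h(4)[of x i] assms(4) by (auto simp: cycles_def intro: boundariesI)
qed

lemma quasi_iso_homotopic:
  assumes "dg_module M" "dg_module N" "quasi_iso M N f" "dg_map M N g" "homotopic M N f g"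
  shows "quasi_iso M N g"
  unfolding quasi_iso_def
proof (intro conjI allI ballI impI)
  show "dg_map M N g" by fact
  note b = homotopic_boundary[OF assms(1,2,5)] and s = boundaries_subspace[OF assms(2)]
  show "x \<in> boundaries M i" if "x \<in> cycles M i" "g i x \<in> boundaries N i" for i x
    using qi_inj[OF assms(3) that(1)] b[OF that(1)] subspace_add[OF s that(2)] by fastforce
  fix i y assume "y \<in> cycles N i"
  then obtain x where x: "x \<in> cycles M i" "y - f i x \<in> boundaries N i"
    using qi_surj[OF assms(3)] by blast
  have "(y - f i x) + (f i x - g i x) \<in> boundaries N i"
    by (rule subspace_add[OF s x(2) b[OF x(1)]])
  then show "\<exists>x\<in>cycles M i. y - g i x \<in> boundaries N i" using x(1) by auto
qed

subsection \<open>Resolutions\<close>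

text \<open>The bound from below is part of the notion because the pieces of the resolution and the
  maps out of it are defined by recursion on the degree. Objects with finite total homology have
  models of this kind (\<open>homology_model\<close>).\<close>

definition zero_diff :: "'v dgm \<Rightarrow> bool" where
  "zero_diff N \<longleftrightarrow> dg_module N \<and> (\<forall>i. \<forall>x\<in>piece N i. diff N i x = 0) \<and> (\<exists>l. \<forall>i<l. piece N i = {0})"

definition low :: "'v dgm \<Rightarrow> int" where
  "low N = (SOME l. \<forall>i<l. piece N i = {0})"

lemma low:
  assumes "zero_diff N" "i < low N"
  shows "piece N i = {0}"
proof -
  have "\<exists>l. \<forall>i<l. piece N i = {0}" using assms(1) by (simp add: zero_diff_def)
  from someI_ex[OF this] show ?thesis using assms(2) unfolding low_def by blast
qed

lemma zero_diff_module: "zero_diff N \<Longrightarrow> dg_module N"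
  by (simp add: zero_diff_def)

lemma zero_diff_diff: "zero_diff N \<Longrightarrow> x \<in> piece N i \<Longrightarrow> diff N i x = 0"
  by (simp add: zero_diff_def)

text \<open>The free graded module on generators \<open>e0 x\<close> of degree \<open>i\<close> and \<open>e1 x\<close> of degree \<open>i + 2\<close>, linear in
  \<open>x \<in> piece N i\<close>. The recursion splits off the multiples of \<open>T\<close>; it is well-founded since \<open>N\<close> is
  bounded below.\<close>

function res_piece :: "'v dgm \<Rightarrow> int \<Rightarrow> 'v set" where
  "res_piece N i = (if i < low N then {0} else
     {sg v + e0 x + e1 y | v x y. v \<in> res_piece N (i - 1) \<and> x \<in> piece N i \<and> y \<in> piece N (i - 2)})"
  by pat_completeness auto
termination by (relation "measure (\<lambda>(N, i). nat (i + 1 - low N))") auto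

declare res_piece.simps [simp del]

lemma int_induct_from:
  fixes i :: int
  assumes "\<And>i. i < l \<Longrightarrow> P i" "\<And>i. \<not> i < l \<Longrightarrow> P (i - 1) \<Longrightarrow> P i"
  shows "P i"
proof (cases "i < l")
  case False
  then have "l - 1 \<le> i" by simp
  then show ?thesis
  proof (induction i rule: int_ge_induct)
    case base
    show ?case by (rule assms(1)) simp
  next
    case (step i)
    show ?case by (rule assms(2)) (use step in auto)
  qed
qed (rule assms(1))

text \<open>The recursive clause also holds below \<open>low N\<close>, where all three ingredients
  are zero; later uses are thereby free of the case distinction.\<close>

lemma res_piece_iff:
  assumes "zero_diff N"
  shows "v \<in> res_piece N i \<longleftrightarrow>
    (\<exists>u x y. v = sg u + e0 x + e1 y \<and> u \<in> res_piece N (i - 1) \<and> x \<in> piece N i \<and> y \<in> piece N (i - 2))"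
proof (cases "i < low N")
  case True
  then have "piece N i = {0}" "piece N (i - 2) = {0}" "res_piece N (i - 1) = {0}"
    using low[OF assms] by (auto simp: res_piece.simps[of N "i - 1"])
  then show ?thesis using True by (simp add: res_piece.simps[of N i])
next
  case False
  then show ?thesis by (subst res_piece.simps) auto
qed

lemma res_piece_0:
  assumes "zero_diff N"
  shows "0 \<in> res_piece N i"
proof (induction i rule: int_induct_from[where l = "low N"])
  case (1 i)
  then show ?case by (simp add: res_piece.simps)
next
  case (2 i)
  then show ?case
    using piece_closed(1)[OF zero_diff_module[OF assms]]
    by (subst res_piece_iff[OF assms], intro exI[of _ 0]) simp
qed

lemma res_piece_parts:
  assumes "zero_diff N" "v \<in> res_piece N i"
  shows "rh v \<in> res_piece N (i - 1)" "p0 v \<in> piece N i" "p1 v \<in> piece N (i - 2)"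
    "v = sg (rh v) + e0 (p0 v) + e1 (p1 v)"
proof -
  obtain u x y where "v = sg u + e0 x + e1 y" "u \<in> res_piece N (i - 1)" "x \<in> piece N i"
    "y \<in> piece N (i - 2)"
    using assms(2) unfolding res_piece_iff[OF assms(1), of v i] by blast
  then show "rh v \<in> res_piece N (i - 1)" "p0 v \<in> piece N i" "p1 v \<in> piece N (i - 2)"
    "v = sg (rh v) + e0 (p0 v) + e1 (p1 v)"
    by simp_all
qed

lemma res_piece_intros:
  assumes "zero_diff N"
  shows "v \<in> res_piece N i \<Longrightarrow> sg v \<in> res_piece N (i + 1)"
    and "x \<in> piece N i \<Longrightarrow> e0 x \<in> res_piece N i"
    and "x \<in> piece N i \<Longrightarrow> e1 x \<in> res_piece N (i + 2)"
proof -
  note z = piece_closed(1)[OF zero_diff_module[OF assms]] res_piece_0[OF assms]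
  show "sg v \<in> res_piece N (i + 1)" if "v \<in> res_piece N i"
    by (subst res_piece_iff[OF assms], rule exI[of _ v], rule exI[of _ 0], rule exI[of _ 0])
      (simp add: that z)
  show "e0 x \<in> res_piece N i" if "x \<in> piece N i"
    by (subst res_piece_iff[OF assms], rule exI[of _ 0], rule exI[of _ x], rule exI[of _ 0])
      (simp add: that z)
  show "e1 x \<in> res_piece N (i + 2)" if "x \<in> piece N i"
    by (subst res_piece_iff[OF assms], rule exI[of _ 0], rule exI[of _ 0], rule exI[of _ x])
      (simp add: that z)
qed

lemma res_piece_induct [consumes 2, case_names low step]:
  assumes N: "zero_diff N" and v: "v \<in> res_piece N i"
    and low: "\<And>i. i < low N \<Longrightarrow> Q i 0"
    and step: "\<And>i v x y. v \<in> res_piece N (i - 1) \<Longrightarrow> Q (i - 1) v \<Longrightarrow> x \<in> piece N i \<Longrightarrow>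
      y \<in> piece N (i - 2) \<Longrightarrow> sg v + e0 x + e1 y \<in> res_piece N i \<Longrightarrow> Q i (sg v + e0 x + e1 y)"
  shows "Q i v"
proof -
  have "\<forall>v\<in>res_piece N i. Q i v"
  proof (induction i rule: int_induct_from[where l = "low N"])
    case (1 i)
    then show ?case using low by (simp add: res_piece.simps)
  next
    case (2 i)
    show ?case
    proof
      fix v assume v: "v \<in> res_piece N i"
      then obtain u x y where u: "v = sg u + e0 x + e1 y" "u \<in> res_piece N (i - 1)" "x \<in> piece N i"
        "y \<in> piece N (i - 2)"
        unfolding res_piece_iff[OF N, of v i] by blast
      show "Q i v"
        unfolding u(1) by (rule step) (use u v 2 in auto)
    qed
  qed
  with v show ?thesis by blast
qed

lemma res_piece_subspace:
  assumes "zero_diff N"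
  shows "subspace (res_piece N i)"
proof (induction i rule: int_induct_from[where l = "low N"])
  case (1 i)
  then show ?case by (simp add: res_piece.simps subspace_single_0)
next
  case (2 i)
  note N = zero_diff_module[OF assms] and parts = res_piece_parts[OF assms]
  have in_res: "sg u + e0 x + e1 y \<in> res_piece N i"
    if "u \<in> res_piece N (i - 1)" "x \<in> piece N i" "y \<in> piece N (i - 2)" for u x y
    unfolding res_piece_iff[OF assms, of _ i] using that by blast
  show ?case
  proof (rule subspaceI)
    show "0 \<in> res_piece N i" by (rule res_piece_0[OF assms])
    fix v c assume v: "v \<in> res_piece N i"
    note pv = parts[OF v]
    have "sg (c *s rh v) + e0 (c *s p0 v) + e1 (c *s p1 v) \<in> res_piece N i"
      by (intro in_res subspace_scale[OF 2(2)] piece_closed(4)[OF N] pv)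
    moreover have "c *s v = sg (c *s rh v) + e0 (c *s p0 v) + e1 (c *s p1 v)"
      by (subst pv(4)) (simp only: scale_right_distrib split_scale)
    ultimately show "c *s v \<in> res_piece N i" by simp
    fix w assume w: "w \<in> res_piece N i"
    note pw = parts[OF w]
    have "sg (rh v + rh w) + e0 (p0 v + p0 w) + e1 (p1 v + p1 w) \<in> res_piece N i"
      by (intro in_res subspace_add[OF 2(2)] piece_closed(2)[OF N] pv pw)
    moreover have "v + w = sg (rh v + rh w) + e0 (p0 v + p0 w) + e1 (p1 v + p1 w)"
    proof -
      have "v + w = (sg (rh v) + e0 (p0 v) + e1 (p1 v)) + (sg (rh w) + e0 (p0 w) + e1 (p1 w))"
        using pv(4) pw(4) by simp
      then show ?thesis by (simp only: split_add ac_simps)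
    qed
    ultimately show "v + w \<in> res_piece N i" by simp
  qed
qed

text \<open>The map on the free module determined by its values \<open>s\<close> and \<open>t\<close> on the two families of
  generators, where \<open>T\<close> acts as \<open>A\<close> on the target.\<close>

function free_ext :: "'v dgm \<Rightarrow> (int \<Rightarrow> 'v \<Rightarrow> 'v) \<Rightarrow> (int \<Rightarrow> 'v \<Rightarrow> 'v) \<Rightarrow> (int \<Rightarrow> 'v \<Rightarrow> 'v)
    \<Rightarrow> int \<Rightarrow> 'v \<Rightarrow> 'v" where
  "free_ext N A s t i v = (if i < low N then 0 else
     A (i - 1) (free_ext N A s t (i - 1) (rh v)) + s i (p0 v) + t (i - 2) (p1 v))"
  by pat_completeness auto
termination by (relation "measure (\<lambda>(N, A, s, t, i, v). nat (i + 1 - low N))") auto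

declare free_ext.simps [simp del]

text \<open>The target is an arbitrary graded family \<open>Y\<close> with an operator
  \<open>A\<close> of degree 1, since the construction is used with three shifts: for the
  differential of the resolution (degree -1), for maps out of it (degree 0) and for homotopies
  (degree 1).\<close>

definition ext_data ::
  "'v dgm \<Rightarrow> (int \<Rightarrow> 'v set) \<Rightarrow> (int \<Rightarrow> 'v \<Rightarrow> 'v) \<Rightarrow> (int \<Rightarrow> 'v \<Rightarrow> 'v) \<Rightarrow> (int \<Rightarrow> 'v \<Rightarrow> 'v) \<Rightarrow> bool" where
  "ext_data N Y A s t \<longleftrightarrow> zero_diff N \<and> (\<forall>i. subspace (Y i) \<and> A i \<in> Y i \<rightarrow> Y (i + 1) \<and> lin_on (Y i) (A i) \<and>
     s i \<in> piece N i \<rightarrow> Y i \<and> lin_on (piece N i) (s i) \<and>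
     t i \<in> piece N i \<rightarrow> Y (i + 2) \<and> lin_on (piece N i) (t i))"

lemma ext_dataD:
  assumes "ext_data N Y A s t"
  shows "zero_diff N" "subspace (Y i)" "x \<in> Y i \<Longrightarrow> A i x \<in> Y (i + 1)" "lin_on (Y i) (A i)"
    "y \<in> piece N i \<Longrightarrow> s i y \<in> Y i" "lin_on (piece N i) (s i)"
    "y \<in> piece N i \<Longrightarrow> t i y \<in> Y (i + 2)" "lin_on (piece N i) (t i)"
    "A i 0 = 0" "s i 0 = 0" "t i 0 = 0"
proof -
  have *: "zero_diff N" "subspace (Y i)" "lin_on (Y i) (A i)"
    "lin_on (piece N i) (s i)" "lin_on (piece N i) (t i)" "subspace (piece N i)" for i
    using assms by (auto simp: ext_data_def piece_subspace zero_diff_module)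
  then show "A i 0 = 0" "s i 0 = 0" "t i 0 = 0"
    using lin_on_zero by blast+
qed (use assms in \<open>auto simp: ext_data_def Pi_iff\<close>)

text \<open>\<open>A\<close> is linear only on \<open>Y\<close>, so linearity in one degree uses the
  range statement one degree below; the two are proved together.\<close>

lemma ext_lin_in:
  assumes "ext_data N Y A s t"
  shows "lin_on (res_piece N i) (free_ext N A s t i) \<and> (\<forall>v\<in>res_piece N i. free_ext N A s t i v \<in> Y i)"
proof -
  note D = ext_dataD[OF assms]
  show ?thesis
  proof (induction i rule: int_induct_from[where l = "low N"])
    case (1 i)
    then have "free_ext N A s t i = (\<lambda>v. 0)" by (intro ext) (simp add: free_ext.simps)
    then show ?case using D(2) by (simp add: lin_on_const0 subspace_0)
  next
    case (2 i)
    note False = 2(1) and IH = 2(2)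
    note parts = res_piece_parts[OF D(1)]
    have A: "x \<in> Y (i - 1) \<Longrightarrow> A (i - 1) x \<in> Y i" for x using D(3)[of x "i - 1"] by simp
    have t: "x \<in> piece N (i - 2) \<Longrightarrow> t (i - 2) x \<in> Y i" for x using D(7)[of x "i - 2"] by simp
    have "lin_on (res_piece N i)
        (\<lambda>v. A (i - 1) (free_ext N A s t (i - 1) (rh v)) + s i (p0 v) + t (i - 2) (p1 v))"
    proof (intro lin_on_plus)
      have "lin_on (res_piece N i) (\<lambda>v. free_ext N A s t (i - 1) (rh v))"
        by (rule lin_on_comp[where S' = "res_piece N (i - 1)"])
          (use IH parts in \<open>auto simp: lin_on_def\<close>)
      then show "lin_on (res_piece N i) (\<lambda>v. A (i - 1) (free_ext N A s t (i - 1) (rh v)))"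
        by (rule lin_on_comp[where S' = "Y (i - 1)"]) (use IH parts(1) D(4) in auto)
      show "lin_on (res_piece N i) (\<lambda>v. s i (p0 v))"
        by (rule lin_on_comp[where S' = "piece N i"]) (use parts D in \<open>auto simp: lin_on_def\<close>)
      show "lin_on (res_piece N i) (\<lambda>v. t (i - 2) (p1 v))"
        by (rule lin_on_comp[where S' = "piece N (i - 2)"]) (use parts D in \<open>auto simp: lin_on_def\<close>)
    qed
    moreover have "A (i - 1) (free_ext N A s t (i - 1) (rh v)) + s i (p0 v) + t (i - 2) (p1 v) \<in> Y i"
      if "v \<in> res_piece N i" for v
      using IH parts[OF that] by (intro subspace_add[OF D(2)] A t D(5)) auto
    moreover have "free_ext N A s t i = (\<lambda>v. A (i - 1) (free_ext N A s t (i - 1) (rh v))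
        + s i (p0 v) + t (i - 2) (p1 v))"
      by (rule ext, subst free_ext.simps) (simp add: False)
    ultimately show ?case by simp
  qed
qed

lemma ext_in: "ext_data N Y A s t \<Longrightarrow> v \<in> res_piece N i \<Longrightarrow> free_ext N A s t i v \<in> Y i"
  using ext_lin_in by blast

lemma ext_lin: "ext_data N Y A s t \<Longrightarrow> lin_on (res_piece N i) (free_ext N A s t i)"
  using ext_lin_in by blast

lemma ext_zero: "ext_data N Y A s t \<Longrightarrow> free_ext N A s t i 0 = 0"
  using lin_on_zero[OF ext_lin res_piece_subspace] ext_dataD(1) by blast

lemma ext_eq:
  assumes "ext_data N Y A s t" "v \<in> res_piece N i"
  shows "free_ext N A s t i v = A (i - 1) (free_ext N A s t (i - 1) (rh v)) + s i (p0 v)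
      + t (i - 2) (p1 v)"
proof (cases "i < low N")
  case True
  then have "v = 0" using assms(2) by (simp add: res_piece.simps)
  then show ?thesis using ext_dataD(9-11)[OF assms(1)] ext_zero[OF assms(1)] by simp
qed (subst free_ext.simps, simp)

lemma ext_generators:
  assumes "ext_data N Y A s t"
  shows "v \<in> res_piece N i \<Longrightarrow> free_ext N A s t (i + 1) (sg v) = A i (free_ext N A s t i v)"
    and "x \<in> piece N i \<Longrightarrow> free_ext N A s t i (e0 x) = s i x"
    and "x \<in> piece N i \<Longrightarrow> free_ext N A s t (i + 2) (e1 x) = t i x"
  using ext_eq[OF assms res_piece_intros(1)[OF ext_dataD(1)[OF assms]]]
    ext_eq[OF assms res_piece_intros(2)[OF ext_dataD(1)[OF assms]]]
    ext_eq[OF assms res_piece_intros(3)[OF ext_dataD(1)[OF assms]]]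
    ext_dataD(9-11)[OF assms] ext_zero[OF assms] by simp_all

text \<open>Uniqueness on a free module: every element is reached from the generators by multiplying
  with T (which is \<open>sg\<close>) and adding. Identities on the resolution are checked on
  \<open>e0 x\<close> and \<open>e1 x\<close> through this lemma.\<close>

lemma res_maps_eq:
  assumes "zero_diff N" "\<And>i. lin_on (res_piece N i) (f i)" "\<And>i. lin_on (res_piece N i) (g i)"
    "\<And>i v. v \<in> res_piece N i \<Longrightarrow> f (i + 1) (sg v) = A i (f i v)"
    "\<And>i v. v \<in> res_piece N i \<Longrightarrow> g (i + 1) (sg v) = A i (g i v)"
    "\<And>i x. x \<in> piece N i \<Longrightarrow> f i (e0 x) = g i (e0 x)"
    "\<And>i x. x \<in> piece N i \<Longrightarrow> f (i + 2) (e1 x) = g (i + 2) (e1 x)"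
    and v: "v \<in> res_piece N i"
  shows "f i v = g i v"
  using assms(1) v
proof (induction rule: res_piece_induct)
  case (low i)
  show ?case using lin_on_zero[OF assms(2)] lin_on_zero[OF assms(3)]
      res_piece_subspace[OF assms(1)] by metis
next
  case (step i v x y)
  note S = res_piece_subspace[OF assms(1)] and I = res_piece_intros[OF assms(1)]
  have m: "sg v \<in> res_piece N i" "e0 x \<in> res_piece N i" "e1 y \<in> res_piece N i"
    using I(1)[OF step.hyps(1)] I(2)[OF step.hyps(2)] I(3)[OF step.hyps(3)] by auto
  have 1: "f i (sg v) = g i (sg v)" using assms(4,5)[OF step.hyps(1)] step.IH by simp
  have 2: "f i (e1 y) = g i (e1 y)" using assms(7)[OF step.hyps(3)] by simp
  show ?case
    using 1 2 assms(6)[OF step.hyps(2)] lin_on_add[OF assms(2)] lin_on_add[OF assms(3)]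
        m subspace_add[OF S]
    by simp
qed

section \<open>The resolution and the maps out of it\<close>

text \<open>The generators \<open>e1 y\<close> lie two degrees above \<open>y\<close>: one degree
  for T and one for the shift in the cone. Their differential records the relation that T times the
  generator of \<open>y\<close> equals the generator of T times \<open>y\<close>.\<close>

definition resolution :: "'v dgm \<Rightarrow> 'v dgm" where
  "resolution N = \<lparr> piece = res_piece N,
     diff = free_ext N (\<lambda>i. sg) (\<lambda>i x. 0) (\<lambda>i y. sg (e0 y) - e0 (act N i y)),
     act = \<lambda>i. sg \<rparr>"

lemma resolution_simps [simp]:
  "piece (resolution N) = res_piece N" "act (resolution N) = (\<lambda>i. sg)"
  by (simp_all add: resolution_def)

lemma resolution_diff_data:
  assumes "zero_diff N"
  shows "ext_data N (\<lambda>i. res_piece N (i - 1)) (\<lambda>i. sg) (\<lambda>i x. 0) (\<lambda>i y. sg (e0 y) - e0 (act N i y))"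
proof -
  note N = zero_diff_module[OF assms]
  note S = res_piece_subspace[OF assms] and I = res_piece_intros[OF assms]
  have "sg v \<in> res_piece N i" if "v \<in> res_piece N (i - 1)" for v i
    using I(1)[OF that] by simp
  moreover have "sg (e0 x) - e0 (act N i x) \<in> res_piece N (i + 2 - 1)" if "x \<in> piece N i" for x i
  proof -
    have e: "i + 2 - 1 = i + 1" by simp
    show ?thesis unfolding e
      by (intro subspace_diff[OF S] I(1)[OF I(2)[OF that]] I(2)[OF act_in[OF N that]])
  qed
  moreover have "lin_on (piece N i) (\<lambda>y. sg (e0 y) - e0 (act N i y))" for i
    by (rule lin_onI) (simp_all add: act_linear[OF N] algebra_simps)
  moreover have "lin_on S sg" for S
    by (rule lin_on_mono[OF split_lin(1)]) simp
  ultimately show ?thesis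
    using assms S by (auto simp: ext_data_def lin_on_const0 subspace_0)
qed

lemma resolution_diff:
  assumes "zero_diff N"
  shows "v \<in> res_piece N i \<Longrightarrow> diff (resolution N) (i + 1) (sg v) = sg (diff (resolution N) i v)"
    and "x \<in> piece N i \<Longrightarrow> diff (resolution N) i (e0 x) = 0"
    and "x \<in> piece N i \<Longrightarrow> diff (resolution N) (i + 2) (e1 x) = sg (e0 x) - e0 (act N i x)"
    and "lin_on (res_piece N i) (diff (resolution N) i)"
    and "v \<in> res_piece N i \<Longrightarrow> diff (resolution N) i v \<in> res_piece N (i - 1)"
  using ext_generators[OF resolution_diff_data[OF assms]] ext_lin[OF resolution_diff_data[OF assms]]
    ext_in[OF resolution_diff_data[OF assms]]
  by (simp_all add: resolution_def)

lemma resolution_module: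
  assumes "zero_diff N"
  shows "dg_module (resolution N)"
proof -
  note d = resolution_diff[OF assms] and N = zero_diff_module[OF assms]
  note S = res_piece_subspace[OF assms] and I = res_piece_intros[OF assms]
  let ?d = "diff (resolution N)"
  have z: "?d i 0 = 0" for i using lin_on_zero[OF d(4) S] .
  have "?d (i - 1) (?d i v) = 0" if "v \<in> res_piece N i" for i v
  proof (rule res_maps_eq[OF assms, of "\<lambda>i v. ?d (i - 1) (?d i v)" "\<lambda>i v. 0" "\<lambda>i. sg"])
    show "lin_on (res_piece N i) (\<lambda>v. ?d (i - 1) (?d i v))" for i
      by (rule lin_on_comp[OF d(4) _ d(4)]) (use d(5) in auto)
    show "?d (i + 1 - 1) (?d (i + 1) (sg v)) = sg (?d (i - 1) (?d i v))" if "v \<in> res_piece N i" for i v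
      using d(1)[OF that] d(1)[OF d(5)[OF that]] by simp
    show "?d (i + 2 - 1) (?d (i + 2) (e1 x)) = 0" if x: "x \<in> piece N i" for i x
    proof -
      have e: "i + 2 - 1 = i + 1" by simp
      have "?d (i + 1) (sg (e0 x) - e0 (act N i x)) = ?d (i + 1) (sg (e0 x)) - ?d (i + 1)
          (e0 (act N i x))"
        by (rule lin_on_diff[OF d(4) S I(1)[OF I(2)[OF x]] I(2)[OF act_in[OF N x]]])
      then show ?thesis
        unfolding e using d(1)[OF I(2)[OF x]] d(2)[OF x] d(2)[OF act_in[OF N x]] d(3)[OF x] by simp
    qed
  qed (use that d(2) z lin_on_const0 in auto)
  then show ?thesis
    using d I S unfolding dg_module_def
    by (auto simp: lin_on_def)
qed

text \<open>The data of a map of DG modules from the resolution of \<open>N\<close> to \<open>Y\<close>: a map \<open>s\<close> to the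
  cycles of \<open>Y\<close>, and a homotopy \<open>t\<close> which witnesses that \<open>s\<close> commutes with \<open>T\<close>.\<close>

definition htmap :: "'v dgm \<Rightarrow> 'v dgm \<Rightarrow> (int \<Rightarrow> 'v \<Rightarrow> 'v) \<Rightarrow> (int \<Rightarrow> 'v \<Rightarrow> 'v) \<Rightarrow> bool" where
  "htmap N Y s t \<longleftrightarrow> (\<forall>i. (\<forall>x\<in>piece N i. s i x \<in> cycles Y i) \<and> lin_on (piece N i) (s i) \<and>
     (\<forall>x\<in>piece N i. t i x \<in> piece Y (i + 2)) \<and> lin_on (piece N i) (t i) \<and>
     (\<forall>x\<in>piece N i. diff Y (i + 2) (t i x) = act Y i (s i x) - s (i + 1) (act N i x)))"

definition res_map :: "'v dgm \<Rightarrow> 'v dgm \<Rightarrow> (int \<Rightarrow> 'v \<Rightarrow> 'v) \<Rightarrow> (int \<Rightarrow> 'v \<Rightarrow> 'v) \<Rightarrow> int \<Rightarrow> 'v \<Rightarrow> 'v" where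
  "res_map N Y s t = free_ext N (act Y) s t"

lemma htmapD:
  assumes "htmap N Y s t"
  shows "x \<in> piece N i \<Longrightarrow> s i x \<in> cycles Y i" "x \<in> piece N i \<Longrightarrow> s i x \<in> piece Y i"
    "x \<in> piece N i \<Longrightarrow> diff Y i (s i x) = 0"
    "lin_on (piece N i) (s i)" "x \<in> piece N i \<Longrightarrow> t i x \<in> piece Y (i + 2)" "lin_on (piece N i) (t i)"
    "x \<in> piece N i \<Longrightarrow> diff Y (i + 2) (t i x) = act Y i (s i x) - s (i + 1) (act N i x)"
  using assms by (auto simp: htmap_def cycles_def)

lemma res_map_data:
  assumes "zero_diff N" "dg_module Y" "htmap N Y s t"
  shows "ext_data N (piece Y) (act Y) s t"
  unfolding ext_data_def Pi_iff
  using assms htmapD[OF assms(3)] dg_moduleD[OF assms(2)] by auto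

lemma res_map_generators:
  assumes "zero_diff N" "dg_module Y" "htmap N Y s t"
  shows "x \<in> piece N i \<Longrightarrow> res_map N Y s t i (e0 x) = s i x"
    and "x \<in> piece N i \<Longrightarrow> res_map N Y s t (i + 2) (e1 x) = t i x"
  using ext_generators[OF res_map_data[OF assms]] by (simp_all add: res_map_def)

text \<open>Both composites with the differentials are T-linear, so they are compared on generators.
  On \<open>e0 x\<close> the equation says that \<open>s x\<close> is a cycle, on
  \<open>e1 x\<close> it is the last clause of \<open>htmap\<close>.\<close>

lemma res_map_dg_map:
  assumes "zero_diff N" "dg_module Y" "htmap N Y s t"
  shows "dg_map (resolution N) Y (res_map N Y s t)"
proof -
  note D = res_map_data[OF assms] and ht = htmapD[OF assms(3)]
  note d = resolution_diff[OF assms(1)] and N = zero_diff_module[OF assms(1)]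
  note S = res_piece_subspace[OF assms(1)] and I = res_piece_intros[OF assms(1)]
  let ?f = "free_ext N (act Y) s t" and ?d = "diff (resolution N)"
  note f = ext_lin[OF D] ext_in[OF D] ext_generators[OF D]
  have "diff Y i (?f i v) = ?f (i - 1) (?d i v)" if "v \<in> res_piece N i" for i v
  proof (rule res_maps_eq[OF assms(1), of "\<lambda>i v. diff Y i (?f i v)" "\<lambda>i v. ?f (i - 1) (?d i v)"
        "\<lambda>i. act Y (i - 1)"])
    show "lin_on (res_piece N i) (\<lambda>v. diff Y i (?f i v))" for i
      by (rule lin_on_comp[OF f(1) _ diff_lin[OF assms(2)]]) (use f(2) in auto)
    show "lin_on (res_piece N i) (\<lambda>v. ?f (i - 1) (?d i v))" for i
      by (rule lin_on_comp[OF d(4) _ f(1)]) (use d(5) in auto)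
    show "diff Y (i + 1) (?f (i + 1) (sg v)) = act Y (i - 1) (diff Y i (?f i v))"
      if "v \<in> res_piece N i" for i v
      using f(3)[OF that] diff_act[OF assms(2) f(2)[OF that]] by simp
    show "?f (i + 1 - 1) (?d (i + 1) (sg v)) = act Y (i - 1) (?f (i - 1) (?d i v))"
      if "v \<in> res_piece N i" for i v
      using f(3)[OF d(5)[OF that]] d(1)[OF that] by simp
    show "diff Y i (?f i (e0 x)) = ?f (i - 1) (?d i (e0 x))" if "x \<in> piece N i" for i x
      using f(4)[OF that] d(2)[OF that] ht(3)[OF that] ext_zero[OF D] by simp
    show "diff Y (i + 2) (?f (i + 2) (e1 x)) = ?f (i + 2 - 1) (?d (i + 2) (e1 x))"
      if x: "x \<in> piece N i" for i x
    proof -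
      have e: "i + 2 - 1 = i + 1" by simp
      have "?f (i + 1) (sg (e0 x) - e0 (act N i x)) = ?f (i + 1) (sg (e0 x)) - ?f (i + 1)
          (e0 (act N i x))"
        by (rule lin_on_diff[OF f(1) S I(1)[OF I(2)[OF x]] I(2)[OF act_in[OF N x]]])
      then show ?thesis
        unfolding e
        using f(3)[OF I(2)[OF x]] f(4)[OF x] f(4)[OF act_in[OF N x]] f(5)[OF x] d(3)[OF x] ht(7)[OF x]
        by simp
    qed
  qed (fact that)
  then show ?thesis
    using f by (auto simp: dg_map_def res_map_def)
qed

lemma dg_map_htmap:
  assumes "zero_diff N" "dg_module Y" "dg_map (resolution N) Y f"
  shows "htmap N Y (\<lambda>i x. f i (e0 x)) (\<lambda>i x. f (i + 2) (e1 x))"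
proof -
  note d = resolution_diff[OF assms(1)] and N = zero_diff_module[OF assms(1)]
  note I = res_piece_intros[OF assms(1)] and f = dg_mapD[OF assms(3), simplified]
  note fl = map_linear[OF resolution_module[OF assms(1)] assms(3), simplified]
  show ?thesis
    unfolding htmap_def
  proof (intro allI conjI ballI)
    fix i
    show "lin_on (piece N i) (\<lambda>x. f i (e0 x))" "lin_on (piece N i) (\<lambda>x. f (i + 2) (e1 x))"
      by (rule lin_onI; simp add: I fl)+
    fix x assume x: "x \<in> piece N i"
    show "f i (e0 x) \<in> cycles Y i"
      using f(1)[OF I(2)[OF x]] f(3)[OF I(2)[OF x]] d(2)[OF x] fl(1) by (simp add: cycles_def)
    show "f (i + 2) (e1 x) \<in> piece Y (i + 2)" using f(1)[OF I(3)[OF x]] .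
    have e: "i + 2 - 1 = i + 1" by simp
    show "diff Y (i + 2) (f (i + 2) (e1 x)) = act Y i (f i (e0 x)) - f (i + 1) (e0 (act N i x))"
      using f(3)[OF I(3)[OF x], unfolded e] d(3)[OF x] fl(3)[OF I(1)[OF I(2)[OF x]]
          I(2)[OF act_in[OF N x]]]
        f(4)[OF I(2)[OF x]] by simp
  qed
qed

text \<open>A T-linear homotopy can be prescribed freely on generators, by \<open>p\<close> on
  \<open>e0\<close> and by \<open>q\<close> on \<open>e1\<close>. The terms with \<open>p\<close> in
  the equation for \<open>e1 x\<close> come from applying the homotopy to the differential of
  \<open>e1 x\<close>.\<close>

lemma homotopic_resolutionI:
  assumes "zero_diff N" "dg_module Y" "dg_map (resolution N) Y f" "dg_map (resolution N) Y g"
    and p: "\<And>i x. x \<in> piece N i \<Longrightarrow> p i x \<in> piece Y (i + 1)" "\<And>i. lin_on (piece N i) (p i)"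
    and q: "\<And>i x. x \<in> piece N i \<Longrightarrow> q i x \<in> piece Y (i + 3)" "\<And>i. lin_on (piece N i) (q i)"
    and e0: "\<And>i x. x \<in> piece N i \<Longrightarrow> f i (e0 x) - g i (e0 x) = diff Y (i + 1) (p i x)"
    and e1: "\<And>i x. x \<in> piece N i \<Longrightarrow> f (i + 2) (e1 x) - g (i + 2) (e1 x) =
      diff Y (i + 3) (q i x) + act Y (i + 1) (p i x) - p (i + 1) (act N i x)"
  shows "homotopic (resolution N) Y f g"
proof -
  note d = resolution_diff[OF assms(1)] and N = zero_diff_module[OF assms(1)]
  note S = res_piece_subspace[OF assms(1)] and I = res_piece_intros[OF assms(1)]
  have idx: "i + 2 + 1 = i + 3" "i + 2 - 1 = i + 1" "i + 1 + 1 = i + 2" for i :: int by simp_all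
  have "act Y (i + 1) x \<in> piece Y (i + 2)" if "x \<in> piece Y (i + 1)" for i x
    using act_in[OF assms(2) that] unfolding idx .
  then have D: "ext_data N (\<lambda>i. piece Y (i + 1)) (\<lambda>i. act Y (i + 1)) p q"
    unfolding ext_data_def Pi_iff idx
    using assms(1) p q piece_subspace[OF assms(2)] act_lin[OF assms(2)] by auto
  let ?h = "free_ext N (\<lambda>i. act Y (i + 1)) p q" and ?d = "diff (resolution N)"
  note h = ext_lin[OF D] ext_in[OF D] ext_generators[OF D]
  note f = dg_mapD[OF assms(3), simplified] and g = dg_mapD[OF assms(4), simplified]
  have h': "?h (i - 1) (?d i v) \<in> piece Y i" if "v \<in> res_piece N i" for i v
    using h(2)[OF d(5)[OF that]] by simp
  have "f i v - g i v = diff Y (i + 1) (?h i v) + ?h (i - 1) (?d i v)" if "v \<in> res_piece N i" for i v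
  proof (rule res_maps_eq[OF assms(1), of "\<lambda>i v. f i v - g i v"
        "\<lambda>i v. diff Y (i + 1) (?h i v) + ?h (i - 1) (?d i v)" "act Y"])
    show "lin_on (res_piece N i) (\<lambda>v. f i v - g i v)" for i
      by (intro lin_on_sub f g)
    have "lin_on (res_piece N i) (\<lambda>v. diff Y (i + 1) (?h i v))" for i
      by (rule lin_on_comp[OF h(1) _ diff_lin[OF assms(2)]]) (use h(2) in auto)
    moreover have "lin_on (res_piece N i) (\<lambda>v. ?h (i - 1) (?d i v))" for i
      by (rule lin_on_comp[OF d(4) _ h(1)]) (use d(5) in auto)
    ultimately show "lin_on (res_piece N i) (\<lambda>v. diff Y (i + 1) (?h i v) + ?h (i - 1) (?d i v))" for i
      by (rule lin_on_plus)
    show "f (i + 1) (sg v) - g (i + 1) (sg v) = act Y i (f i v - g i v)" if "v \<in> res_piece N i" for i v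
      using f(4)[OF that] g(4)[OF that] f(1)[OF that] g(1)[OF that]
          by (simp add: act_linear[OF assms(2)])
    show "diff Y (i + 1 + 1) (?h (i + 1) (sg v)) + ?h (i + 1 - 1) (?d (i + 1) (sg v)) =
        act Y i (diff Y (i + 1) (?h i v) + ?h (i - 1) (?d i v))" if v: "v \<in> res_piece N i" for i v
    proof -
      have "?h i (sg (?d i v)) = act Y i (?h (i - 1) (?d i v))"
        using h(3)[OF d(5)[OF v]] by simp
      moreover have "diff Y (i + 1 + 1) (act Y (i + 1) (?h i v)) = act Y i (diff Y (i + 1) (?h i v))"
        using diff_act[OF assms(2) h(2)[OF v]] by simp
      ultimately show ?thesis
        using h(3)[OF v] d(1)[OF v] h'[OF v] diff_in'[OF assms(2) h(2)[OF v]]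
        by (simp add: act_linear[OF assms(2)])
    qed
    show "f i (e0 x) - g i (e0 x) = diff Y (i + 1) (?h i (e0 x)) + ?h (i - 1) (?d i (e0 x))"
      if "x \<in> piece N i" for i x
      using e0[OF that] h(4)[OF that] d(2)[OF that] ext_zero[OF D] by simp
    show "f (i + 2) (e1 x) - g (i + 2) (e1 x) =
        diff Y (i + 2 + 1) (?h (i + 2) (e1 x)) + ?h (i + 2 - 1) (?d (i + 2) (e1 x))"
      if x: "x \<in> piece N i" for i x
    proof -
      have "?h (i + 1) (sg (e0 x) - e0 (act N i x)) = ?h (i + 1) (sg (e0 x)) - ?h (i + 1)
          (e0 (act N i x))"
        by (rule lin_on_diff[OF h(1) S I(1)[OF I(2)[OF x]] I(2)[OF act_in[OF N x]]])
      then show ?thesis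
        unfolding idx
        using e1[OF x] h(3)[OF I(2)[OF x]] h(4)[OF x] h(4)[OF act_in[OF N x]] h(5)[OF x] d(3)[OF x]
        by simp
    qed
  qed (fact that)
  then show ?thesis
    by (intro homotopicI[of "resolution N" ?h]) (use h in auto)
qed

lemma homotopic_resolutionE:
  assumes "zero_diff N" "dg_module Y" "homotopic (resolution N) Y f g"
  obtains p q where "\<And>i x. x \<in> piece N i \<Longrightarrow> p i x \<in> piece Y (i + 1)" "\<And>i. lin_on (piece N i) (p i)"
    "\<And>i x. x \<in> piece N i \<Longrightarrow> q i x \<in> piece Y (i + 3)" "\<And>i. lin_on (piece N i) (q i)"
    "\<And>i x. x \<in> piece N i \<Longrightarrow> f i (e0 x) - g i (e0 x) = diff Y (i + 1) (p i x)"
    "\<And>i x. x \<in> piece N i \<Longrightarrow> f (i + 2) (e1 x) - g (i + 2) (e1 x) =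
      diff Y (i + 3) (q i x) + act Y (i + 1) (p i x) - p (i + 1) (act N i x)"
proof -
  note d = resolution_diff[OF assms(1)] and N = zero_diff_module[OF assms(1)]
  note S = res_piece_subspace[OF assms(1)] and I = res_piece_intros[OF assms(1)]
  obtain h where h: "\<And>i x. x \<in> res_piece N i \<Longrightarrow> h i x \<in> piece Y (i + 1)"
      "\<And>i. lin_on (res_piece N i) (h i)"
    "\<And>i x. x \<in> res_piece N i \<Longrightarrow> act Y (i + 1) (h i x) = h (i + 1) (sg x)"
    "\<And>i x. x \<in> res_piece N i \<Longrightarrow> f i x - g i x = diff Y (i + 1) (h i x) + h (i - 1)
        (diff (resolution N) i x)"
    using homotopicE[OF assms(3)] unfolding resolution_simps by metis
  have idx: "i + 2 + 1 = i + 3" "i + 2 - 1 = i + 1" for i :: int by simp_all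
  have h0: "h i 0 = 0" for i using lin_on_zero[OF h(2) S] .
  show thesis
  proof (rule that[of "\<lambda>i x. h i (e0 x)" "\<lambda>i x. h (i + 2) (e1 x)"])
    show "lin_on (piece N i) (\<lambda>x. h i (e0 x))" "lin_on (piece N i) (\<lambda>x. h (i + 2) (e1 x))" for i
      by (rule lin_onI; simp add: I lin_on_add[OF h(2)] lin_on_scale[OF h(2)])+
    fix i x assume x: "x \<in> piece N i"
    show "h i (e0 x) \<in> piece Y (i + 1)" by (rule h(1)[OF I(2)[OF x]])
    show "h (i + 2) (e1 x) \<in> piece Y (i + 3)" using h(1)[OF I(3)[OF x], unfolded idx] .
    show "f i (e0 x) - g i (e0 x) = diff Y (i + 1) (h i (e0 x))"
      using h(4)[OF I(2)[OF x]] d(2)[OF x] h0 by simp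
    have "h (i + 1) (sg (e0 x) - e0 (act N i x)) = h (i + 1) (sg (e0 x)) - h (i + 1) (e0 (act N i x))"
      by (rule lin_on_diff[OF h(2) S I(1)[OF I(2)[OF x]] I(2)[OF act_in[OF N x]]])
    then show "f (i + 2) (e1 x) - g (i + 2) (e1 x) =
      diff Y (i + 3) (h (i + 2) (e1 x)) + act Y (i + 1) (h i (e0 x)) - h (i + 1) (e0 (act N i x))"
      using h(4)[OF I(3)[OF x], unfolded idx] h(3)[OF I(2)[OF x]] d(3)[OF x] by simp
  qed
qed

section \<open>Homology of the resolution\<close>

text \<open>Modulo boundaries T can be traded for the action on \<open>N\<close>, so an element
  reduces to some \<open>e0 x\<close> plus a combination \<open>e\<close> of multiples of the
  generators \<open>e1 y\<close>. The aim is injectivity of the differential on such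
  \<open>e\<close>. The induction on the degree requires the stronger form that \<open>e\<close>
  vanishes as soon as its differential is some \<open>e0 y\<close>, because removing a factor T
  leaves a term of this kind.\<close>

lemma resolution_decomp:
  assumes N: "zero_diff N" and v: "v \<in> res_piece N i"
  shows "\<exists>x\<in>piece N i. \<exists>w\<in>res_piece N (i + 1). \<exists>e\<in>res_piece N i.
    v = e0 x + diff (resolution N) (i + 1) w + e \<and>
    (\<forall>y\<in>piece N (i - 1). diff (resolution N) i e = e0 y \<longrightarrow> e = 0 \<and> y = 0)"
  using N v
proof (induction rule: res_piece_induct)
  case (low i)
  have "y = 0" if "0 = e0 y" for y using that by (metis split_simps(5) split_zero(4))
  then show ?case
    using piece_closed(1)[OF zero_diff_module[OF N]] res_piece_0[OF N]
      diff_linear(1)[OF resolution_module[OF N]]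
    by (intro bexI[of _ 0]) auto
next
  case (step i v x y)
  note M = zero_diff_module[OF N] and RM = resolution_module[OF N]
  note S = res_piece_subspace[OF N] and I = res_piece_intros[OF N] and d = resolution_diff[OF N]
  let ?d = "diff (resolution N)"
  have dl: "?d j (a + b) = ?d j a + ?d j b" if "a \<in> res_piece N j" "b \<in> res_piece N j" for j a b
    using diff_linear(2)[OF RM, of a j b] that by simp
  obtain x' w e where IH: "x' \<in> piece N (i - 1)" "w \<in> res_piece N i" "e \<in> res_piece N (i - 1)"
      "v = e0 x' + ?d i w + e" "\<And>y. y \<in> piece N (i - 2) \<Longrightarrow> ?d (i - 1) e = e0 y \<Longrightarrow> e = 0 \<and> y = 0"
    using step.IH by auto
  note Tx' = act_in'[OF M IH(1)]
  have "i - 1 + 2 = i + 1" by simp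
  then have e1x: "e1 x' \<in> res_piece N (i + 1)" and de1x: "?d (i + 1) (e1 x') = sg (e0 x')
      - e0 (act N (i - 1) x')"
    using I(3)[OF IH(1)] d(3)[OF IH(1)] by metis+
  have e1y: "e1 y \<in> res_piece N i" using I(3)[OF step.hyps(3)] by simp
  have sge: "sg e \<in> res_piece N i" using I(1)[OF IH(3)] by simp
  have Ty: "act N (i - 2) y \<in> piece N (i - 1)" using act_in[OF M step.hyps(3)] by simp
  have de1y: "?d i (e1 y) = sg (e0 y) - e0 (act N (i - 2) y)"
    using d(3)[OF step.hyps(3)] by simp
  have dsge: "?d i (sg e) = sg (?d (i - 1) e)"
    using d(1)[OF IH(3)] by simp
  show ?case
  proof (intro bexI conjI ballI impI)
    show "x + act N (i - 1) x' \<in> piece N i" by (rule piece_closed(2)[OF M step.hyps(2) Tx'])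
    show w: "sg w + e1 x' \<in> res_piece N (i + 1)"
      by (rule subspace_add[OF S I(1)[OF IH(2)] e1x])
    show e: "sg e + e1 y \<in> res_piece N i" by (rule subspace_add[OF S sge e1y])
    show "sg v + e0 x + e1 y =
        e0 (x + act N (i - 1) x') + ?d (i + 1) (sg w + e1 x') + (sg e + e1 y)"
      by (simp add: IH(4) dl[OF I(1)[OF IH(2)] e1x] de1x d(1)[OF IH(2)])
    fix z assume z: "z \<in> piece N (i - 1)" "?d i (sg e + e1 y) = e0 z"
    then have eq: "sg (?d (i - 1) e) + (sg (e0 y) - e0 (act N (i - 2) y)) = e0 z"
      using dl[OF sge e1y] by (simp add: dsge de1y)
    \<comment> \<open>Comparing the coefficients of T: the differential of \<open>e\<close> must be
      \<open>e0 (- y)\<close>, and the induction hypothesis applies one degree lower.\<close>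
    have "rh (sg (?d (i - 1) e) + (sg (e0 y) - e0 (act N (i - 2) y))) = rh (e0 z)"
      by (simp only: eq)
    then have "?d (i - 1) e = e0 (- y)" by (simp add: eq_neg_iff_add_eq_0)
    then have e: "e = 0" "- y = 0"
      using IH(5) piece_closed(5)[OF M step.hyps(3)] by blast+
    then have "e0 z = 0"
      using eq diff_linear(1)[OF RM] act_linear(1)[OF M] by simp
    then have "p0 (e0 z) = 0" by simp
    then show "z = 0" by simp
    show "sg e + e1 y = 0" using e by simp
  qed
qed

text \<open>For a cycle, the differential of the remainder \<open>e\<close> is 0, that is
  \<open>e0 0\<close>, so \<open>e\<close> vanishes.\<close>

lemma resolution_cycle:
  assumes N: "zero_diff N" and z: "z \<in> cycles (resolution N) i"
  shows "\<exists>x\<in>piece N i. z - e0 x \<in> boundaries (resolution N) i"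
proof -
  note M = zero_diff_module[OF N] and RM = resolution_module[OF N]
  note d = resolution_diff[OF N] and I = res_piece_intros[OF N]
  let ?d = "diff (resolution N)"
  have z': "z \<in> res_piece N i" "?d i z = 0" using z by (auto simp: cycles_def)
  obtain x w e where *: "x \<in> piece N i" "w \<in> res_piece N (i + 1)" "e \<in> res_piece N i"
      "z = e0 x + ?d (i + 1) w + e" "\<And>y. y \<in> piece N (i - 1) \<Longrightarrow> ?d i e = e0 y \<Longrightarrow> e = 0 \<and> y = 0"
    using resolution_decomp[OF N z'(1)] by blast
  have w: "?d (i + 1) w \<in> res_piece N i" using d(5)[OF *(2)] by simp
  have "?d i z = ?d i (e0 x) + ?d i (?d (i + 1) w) + ?d i e"
    using diff_linear(2)[OF RM, of _ i] subspace_add[OF res_piece_subspace[OF N]] I(2)[OF *(1)] w *(3)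
    by (simp add: *(4))
  moreover have "?d i (?d (i + 1) w) = 0"
    using diff_diff'[OF RM, of w i] *(2) by simp
  ultimately have "?d i e = e0 0" using z'(2) d(2)[OF *(1)] by simp
  then have "e = 0" using *(5) piece_closed(1)[OF M] by blast
  then have "z - e0 x = ?d (i + 1) w" using *(4) by simp
  then show ?thesis using *(1,2) by (intro bexI[of _ x] boundariesI[of w]) auto
qed

text \<open>The hypotheses say that \<open>s\<close> identifies \<open>N\<close> with the homology
  of \<open>Y\<close>. Every class of the resolution is represented by some \<open>e0 x\<close>, and
  \<open>res_map\<close> sends it to the class of \<open>s x\<close>, so injectivity and
  surjectivity are read off from \<open>s\<close>.\<close>

lemma res_map_quasi_iso:
  assumes N: "zero_diff N" and Y: "dg_module Y" and st: "htmap N Y s t"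
    and inj: "\<And>i x. x \<in> piece N i \<Longrightarrow> s i x \<in> boundaries Y i \<Longrightarrow> x = 0"
    and surj: "\<And>i z. z \<in> cycles Y i \<Longrightarrow> \<exists>x\<in>piece N i. z - s i x \<in> boundaries Y i"
  shows "quasi_iso (resolution N) Y (res_map N Y s t)"
  unfolding quasi_iso_def
proof (intro conjI allI ballI impI)
  let ?f = "res_map N Y s t"
  show f: "dg_map (resolution N) Y ?f" by (rule res_map_dg_map[OF N Y st])
  note RM = resolution_module[OF N] and I = res_piece_intros[OF N]
  note g = res_map_generators[OF N Y st] and d = resolution_diff[OF N]
  show "z \<in> boundaries (resolution N) i"
    if z: "z \<in> cycles (resolution N) i" "?f i z \<in> boundaries Y i" for i z
  proof -
    obtain x where x: "x \<in> piece N i" "z - e0 x \<in> boundaries (resolution N) i"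
      using resolution_cycle[OF N z(1)] by blast
    have "?f i (z - e0 x) = ?f i z - s i x"
      using map_linear(3)[OF RM f, of z i "e0 x"] z(1) I(2)[OF x(1)] g(1)[OF x(1)]
      by (simp add: cycles_def)
    moreover have "?f i (z - e0 x) \<in> boundaries Y i" by (rule map_boundaries[OF f x(2)])
    ultimately have "?f i z - (?f i z - s i x) \<in> boundaries Y i"
      using subspace_diff[OF boundaries_subspace[OF Y] z(2)] by metis
    then have "x = 0" using inj[OF x(1)] by (simp add: diff_diff_eq2)
    then show ?thesis using x(2) by simp
  qed
  fix i y assume "y \<in> cycles Y i"
  then obtain x where x: "x \<in> piece N i" "y - s i x \<in> boundaries Y i" using surj by blast
  then show "\<exists>x\<in>cycles (resolution N) i. y - ?f i x \<in> boundaries Y i"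
    using I(2)[OF x(1)] d(2)[OF x(1)] g(1)[OF x(1)] by (intro bexI[of _ "e0 x"]) (auto simp: cycles_def)
qed

section \<open>Lifting maps through quasi-isomorphisms\<close>

text \<open>Composition with a quasi-isomorphism is to be surjective and injective on homotopy
  classes of maps out of \<open>P\<close>; this is K-projectivity, in the form in which roofs use
  it.\<close>

definition hproj :: "'v dgm \<Rightarrow> bool" where
  "hproj P \<longleftrightarrow> dg_module P \<and>
     (\<forall>W X b f. dg_module W \<longrightarrow> dg_module X \<longrightarrow> quasi_iso W X b \<longrightarrow> dg_map P X f \<longrightarrow>
        (\<exists>g. dg_map P W g \<and> homotopic P X (gcomp b g) f)) \<and>
     (\<forall>W X b g g'. dg_module W \<longrightarrow> dg_module X \<longrightarrow> quasi_iso W X b \<longrightarrow> dg_map P W g \<longrightarrow> dg_map P W g' \<longrightarrow>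
        homotopic P X (gcomp b g) (gcomp b g') \<longrightarrow> homotopic P W g g')"

text \<open>Obstruction theory in two stages, as the resolution has two families of generators.
  Surjectivity of \<open>b\<close> on homology lifts the cycles \<open>s x\<close> to
  \<open>w x\<close>, up to the boundary of \<open>p x\<close>. Injectivity then yields elements
  with the boundary required for the image of \<open>e1 x\<close>, and surjectivity again corrects
  them so that they match \<open>t x\<close> up to the homotopy given by \<open>p\<close> and
  \<open>q\<close>.\<close>

lemma resolution_lift:
  assumes N: "zero_diff N" and W: "dg_module W" and X: "dg_module X" and b: "quasi_iso W X b"
    and f: "dg_map (resolution N) X f"
  shows "\<exists>g. dg_map (resolution N) W g \<and> homotopic (resolution N) X (gcomp b g) f"
proof -
  note M = zero_diff_module[OF N] and mb = qi_map[OF b]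
  note bl = map_linear[OF W mb] and b_in = map_in[OF mb] and bd = map_diff[OF mb]
      and ba = map_act[OF mb]
  define s where "s i x = f i (e0 x)" for i x
  define t where "t i x = f (i + 2) (e1 x)" for i x
  have "htmap N X s t" using dg_map_htmap[OF N X f] unfolding s_def[abs_def] t_def[abs_def] .
  note st = htmapD[OF this]
  have idx: "i + 2 - 1 = i + 1" "i + 2 + 1 = i + 3" "i + 1 - 1 = i" "i + 1 + 1 = i + 2"
      "i + 3 - 1 = i + 2" for i :: int by simp_all
  note sB = boundaries_subspace[OF X] and sZ = cycles_subspace[OF W]
  note sl = lin_on_add[OF st(4)] lin_on_scale[OF st(4)] and tl = lin_on_add[OF st(6)]
      lin_on_scale[OF st(6)]
  obtain w where w: "\<And>i. lin_on UNIV (w i)"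
      "\<And>i x. x \<in> piece N i \<Longrightarrow> w i x \<in> cycles W i \<and> b i (w i x) - s i x \<in> boundaries X i"
  proof (rule linear_choice_graded[of "piece N" "\<lambda>i x y. y \<in> cycles W i \<and>
      b i y - s i x \<in> boundaries X i"])
    show "\<exists>y. y \<in> cycles W i \<and> b i y - s i x \<in> boundaries X i" if x: "x \<in> piece N i" for i x
    proof -
      obtain y where "y \<in> cycles W i" "s i x - b i y \<in> boundaries X i"
        using qi_surj[OF b st(1)[OF x]] by blast
      then show ?thesis using subspace_neg[OF sB] by fastforce
    qed
    show "y + y' \<in> cycles W i \<and> b i (y + y') - s i (x + x') \<in> boundaries X i"
      if "x \<in> piece N i" "x' \<in> piece N i" "y \<in> cycles W i \<and> b i y - s i x \<in> boundaries X i"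
        "y' \<in> cycles W i \<and> b i y' - s i x' \<in> boundaries X i" for i x y x' y'
    proof -
      have "b i (y + y') - s i (x + x') = (b i y - s i x) + (b i y' - s i x')"
        using that by (simp add: sl bl cycles_def)
      then show ?thesis using that subspace_add[OF sB] subspace_add[OF sZ] by simp
    qed
    show "c *s y \<in> cycles W i \<and> b i (c *s y) - s i (c *s x) \<in> boundaries X i"
      if "x \<in> piece N i" "y \<in> cycles W i \<and> b i y - s i x \<in> boundaries X i" for i c x y
    proof -
      have "b i (c *s y) - s i (c *s x) = c *s (b i y - s i x)"
        using that by (simp add: sl bl cycles_def scale_right_diff_distrib)
      then show ?thesis using that subspace_scale[OF sB] subspace_scale[OF sZ] by simp
    qed
  qed (use piece_subspace[OF M] in auto)
  have wZ: "w i x \<in> cycles W i" "w i x \<in> piece W i" "diff W i (w i x) = 0"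
    and wB: "b i (w i x) - s i x \<in> boundaries X i" if "x \<in> piece N i" for i x
    using w(2)[OF that] by (auto simp: cycles_def)
  have wl: "w i (x + y) = w i x + w i y" "w i (c *s x) = c *s w i x" for i x y c
    using lin_on_add[OF w(1)] lin_on_scale[OF w(1)] by auto
  obtain p where p: "\<And>i. lin_on UNIV (p i)"
      "\<And>i x. x \<in> piece N i \<Longrightarrow> p i x \<in> piece X (i + 1) \<and> diff X (i + 1) (p i x) = b i (w i x) - s i x"
  proof (rule linear_choice_graded[of "piece N"
        "\<lambda>i x y. y \<in> piece X (i + 1) \<and> diff X (i + 1) y = b i (w i x) - s i x"])
    show "\<exists>y. y \<in> piece X (i + 1) \<and> diff X (i + 1) y = b i (w i x) - s i x" if "x \<in> piece N i" for i x
      using wB[OF that] by (metis boundariesE)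
  qed (use piece_subspace[OF M] in
      \<open>auto simp: piece_closed[OF X] diff_linear[OF X] wl sl bl wZ scale_right_diff_distrib\<close>)
  have pX: "p i x \<in> piece X (i + 1)" and dp: "diff X (i + 1) (p i x) = b i (w i x) - s i x"
    if "x \<in> piece N i" for i x
    using p(2)[OF that] by auto
  have pl: "p i (x + y) = p i x + p i y" "p i (c *s x) = c *s p i x" for i x y c
    using lin_on_add[OF p(1)] lin_on_scale[OF p(1)] by auto
  have Tp: "act X (i + 1) (p i x) \<in> piece X (i + 2)" "p (i + 1) (act N i x) \<in> piece X (i + 2)"
    if "x \<in> piece N i" for i x
    using act_in[OF X pX[OF that]] pX[OF act_in[OF M that]] unfolding idx by auto
  \<comment> \<open>The failure of \<open>p\<close> to commute with T. Because of it, the lift in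
    the second stage has to be compared with \<open>t x + c x\<close> instead of
    \<open>t x\<close>.\<close>
  define c where "c i x = act X (i + 1) (p i x) - p (i + 1) (act N i x)" for i x
  have cX: "c i x \<in> piece X (i + 2)" if "x \<in> piece N i" for i x
    using Tp[OF that] by (simp add: c_def piece_closed[OF X])
  have cl: "c i (x + y) = c i x + c i y" "c i (r *s x) = r *s c i x"
    if "x \<in> piece N i" "y \<in> piece N i" for i x y r
    using that by (simp_all add: c_def pl act_linear[OF M] act_linear[OF X] pX add_diff_add
        scale_right_diff_distrib)
  have dc: "diff X (i + 2) (c i x) = act X i (b i (w i x) - s i x) - (b (i + 1) (w (i + 1)
      (act N i x)) - s (i + 1) (act N i x))"
    if x: "x \<in> piece N i" for i x
  proof -
    have "diff X (i + 1 + 1) (act X (i + 1) (p i x)) = act X (i + 1 - 1) (diff X (i + 1) (p i x))"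
      by (rule diff_act[OF X pX[OF x]])
    moreover have "diff X (i + 1 + 1) (p (i + 1) (act N i x)) =
        b (i + 1) (w (i + 1) (act N i x)) - s (i + 1) (act N i x)"
      by (rule dp[OF act_in[OF M x]])
    ultimately show ?thesis
      using Tp[OF x] dp[OF x] unfolding idx by (simp add: c_def diff_linear[OF X])
  qed
  define R where "R i x y \<longleftrightarrow> y \<in> piece W (i + 2) \<and>
      diff W (i + 2) y = act W i (w i x) - w (i + 1) (act N i x) \<and>
      b (i + 2) y - t i x - c i x \<in> boundaries X (i + 2)" for i x y
  obtain w' where w': "\<And>i. lin_on UNIV (w' i)" "\<And>i x. x \<in> piece N i \<Longrightarrow> R i x (w' i x)"
  proof (rule linear_choice_graded[of "piece N" R])
    show "\<exists>y. R i x y" if x: "x \<in> piece N i" for i x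
    proof -
      note Tx = act_in[OF M x]
      let ?k = "act W i (w i x) - w (i + 1) (act N i x)"
      have kZ: "?k \<in> cycles W (i + 1)"
        by (rule subspace_diff[OF sZ act_cycles[OF W wZ(1)[OF x]] wZ(1)[OF Tx]])
      have "b (i + 1) ?k = act X i (b i (w i x)) - b (i + 1) (w (i + 1) (act N i x))"
        using bl(3)[OF act_in[OF W wZ(2)[OF x]] wZ(2)[OF Tx]] ba[OF wZ(2)[OF x]] by simp
      moreover have "act X i (b i (w i x) - s i x) = act X i (b i (w i x)) - act X i (s i x)"
        by (rule act_linear(3)[OF X b_in[OF wZ(2)[OF x]] st(2)[OF x]])
      ultimately have "b (i + 1) ?k = diff X (i + 2) (t i x + c i x)"
        using diff_linear(2)[OF X st(5)[OF x] cX[OF x]] dc[OF x] st(7)[OF x] by simp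
      then have "b (i + 1) ?k \<in> boundaries X (i + 1)"
        using piece_closed(2)[OF X st(5)[OF x] cX[OF x]] by (intro boundariesI[of "t i x + c i
            x"]) (simp_all only: idx)
      with qi_inj[OF b kZ] obtain y where y: "y \<in> piece W (i + 2)" "diff W (i + 2) y = ?k"
        by (metis boundariesE idx(4))
      \<comment> \<open>\<open>y\<close> has the right boundary, but its image misses
        \<open>t x + c x\<close> by the cycle \<open>?z\<close>. A cycle \<open>y'\<close> that maps
        to the class of \<open>?z\<close> is subtracted.\<close>
      let ?z = "b (i + 2) y - t i x - c i x"
      have "?z \<in> piece X (i + 2)" using y st(5)[OF x] cX[OF x] b_in by (simp add: piece_closed[OF X])
      moreover have "diff X (i + 2) ?z = 0"
      proof -
        have "diff X (i + 2) (b (i + 2) y) = b (i + 1) ?k" using bd[OF y(1)] unfolding idx y(2) .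
        then show ?thesis
          using \<open>b (i + 1) ?k = diff X (i + 2) (t i x + c i x)\<close> st(5)[OF x] cX[OF x] b_in[OF y(1)]
          by (simp add: diff_linear[OF X] piece_closed[OF X])
      qed
      ultimately obtain y' where y': "y' \<in> cycles W (i + 2)" "?z - b (i + 2) y' \<in> boundaries X (i + 2)"
        using qi_surj[OF b] cyclesI by blast
      have y'2: "y' \<in> piece W (i + 2)" "diff W (i + 2) y' = 0" using y'(1) by (auto simp: cycles_def)
      have "b (i + 2) (y - y') - t i x - c i x = ?z - b (i + 2) y'"
        using bl(3)[OF y(1) y'2(1)] by simp
      then have "b (i + 2) (y - y') - t i x - c i x \<in> boundaries X (i + 2)"
        using y'(2) by (simp only:)
      then have "R i x (y - y')"
        using y y'2 by (simp add: R_def piece_closed[OF W] diff_linear[OF W])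
      then show ?thesis ..
    qed
    show "R i (x + x') (y + y')"
      if "x \<in> piece N i" "x' \<in> piece N i" "R i x y" "R i x' y'" for i x y x' y'
    proof -
      have "b (i + 2) (y + y') - t i (x + x') - c i (x + x') =
        (b (i + 2) y - t i x - c i x) + (b (i + 2) y' - t i x' - c i x')"
        using that by (simp add: R_def bl tl cl)
      then have "b (i + 2) (y + y') - t i (x + x') - c i (x + x') \<in> boundaries X (i + 2)"
        using that subspace_add[OF sB] by (simp add: R_def)
      then show ?thesis
        using that by (simp add: R_def piece_closed[OF W] diff_linear[OF W] wl act_linear[OF M]
            act_linear[OF W] wZ)
    qed
    show "R i (r *s x) (r *s y)" if "x \<in> piece N i" "R i x y" for i r x y
    proof -
      have "b (i + 2) (r *s y) - t i (r *s x) - c i (r *s x) = r *s (b (i + 2) y - t i x - c i x)"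
        using that by (simp add: R_def bl tl cl scale_right_diff_distrib)
      then have "b (i + 2) (r *s y) - t i (r *s x) - c i (r *s x) \<in> boundaries X (i + 2)"
        using that subspace_scale[OF sB] by (simp add: R_def)
      then show ?thesis
        using that by (simp add: R_def piece_closed[OF W] diff_linear[OF W] wl act_linear[OF M]
            act_linear[OF W] wZ scale_right_diff_distrib)
    qed
  qed (use piece_subspace[OF M] in auto)
  have w'W: "w' i x \<in> piece W (i + 2)"
    and dw': "diff W (i + 2) (w' i x) = act W i (w i x) - w (i + 1) (act N i x)"
    and w'B: "b (i + 2) (w' i x) - t i x - c i x \<in> boundaries X (i + 2)" if "x \<in> piece N i" for i x
    using w'(2)[OF that] by (auto simp: R_def)
  have w'l: "w' i (x + y) = w' i x + w' i y" "w' i (r *s x) = r *s w' i x" for i x y r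
    using lin_on_add[OF w'(1)] lin_on_scale[OF w'(1)] by auto
  obtain q where q: "\<And>i. lin_on UNIV (q i)"
      "\<And>i x. x \<in> piece N i \<Longrightarrow> q i x \<in> piece X (i + 3) \<and>
          diff X (i + 3) (q i x) = b (i + 2) (w' i x) - t i x - c i x"
  proof (rule linear_choice_graded[of "piece N"
        "\<lambda>i x y. y \<in> piece X (i + 3) \<and> diff X (i + 3) y = b (i + 2) (w' i x) - t i x - c i x"])
    show "\<exists>y. y \<in> piece X (i + 3) \<and> diff X (i + 3) y = b (i + 2) (w' i x) - t i x - c i x"
      if "x \<in> piece N i" for i x
      using w'B[OF that] unfolding idx(2)[symmetric] by (metis boundariesE)
  qed (use piece_subspace[OF M] in
      \<open>auto simp: piece_closed[OF X] diff_linear[OF X] w'l tl cl bl w'W scale_right_diff_distrib\<close>)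
  have W_lin: "lin_on (piece N i) (u i)" if "\<And>i. lin_on UNIV (u i)" for i and u :: "int \<Rightarrow> 'v \<Rightarrow> 'v"
    by (rule lin_on_mono[OF that]) simp
  have ht: "htmap N W w w'"
    using wZ(1) w'W dw' W_lin[OF w(1)] W_lin[OF w'(1)] by (auto simp: htmap_def)
  note g = res_map_dg_map[OF N W ht] and gg = res_map_generators[OF N W ht]
  have "homotopic (resolution N) X (gcomp b (res_map N W w w')) f"
  proof (rule homotopic_resolutionI[OF N X dg_map_comp[OF g mb] f, of p q])
    fix i x assume x: "x \<in> piece N i"
    show "gcomp b (res_map N W w w') i (e0 x) - f i (e0 x) = diff X (i + 1) (p i x)"
      using gg(1)[OF x] dp[OF x] by (simp add: gcomp_def s_def)
    show "gcomp b (res_map N W w w') (i + 2) (e1 x) - f (i + 2) (e1 x) =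
        diff X (i + 3) (q i x) + act X (i + 1) (p i x) - p (i + 1) (act N i x)"
      using gg(2)[OF x] q(2)[OF x] by (simp add: gcomp_def t_def c_def)
  qed (use pX q(2) W_lin[OF p(1)] W_lin[OF q(1)] in auto)
  with g show ?thesis by blast
qed

text \<open>The argument of \<open>resolution_lift\<close> one degree higher: the unknowns are now
  the two components \<open>q\<close> and \<open>r\<close> of a null-homotopy of \<open>f\<close>,
  while \<open>p\<close> and \<open>p'\<close> are the components of the given one after composing
  with \<open>b\<close>.\<close>

lemma resolution_lift_unique:
  assumes N: "zero_diff N" and W: "dg_module W" and X: "dg_module X" and b: "quasi_iso W X b"
    and f: "dg_map (resolution N) W f" and "homotopic (resolution N) X (gcomp b f) (\<lambda>i x. 0)"
  shows "homotopic (resolution N) W f (\<lambda>i x. 0)"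
proof -
  note M = zero_diff_module[OF N] and mb = qi_map[OF b]
  note bl = map_linear[OF W mb] and b_in = map_in[OF mb] and bd = map_diff[OF mb]
      and ba = map_act[OF mb]
  have idx: "i + 2 - 1 = i + 1" "i + 2 + 1 = i + 3" "i + 1 - 1 = i" "i + 1 + 1 = i + 2"
      "i + 3 - 1 = i + 2" for i :: int by simp_all
  define s where "s i x = f i (e0 x)" for i x
  define t where "t i x = f (i + 2) (e1 x)" for i x
  have "htmap N W s t" using dg_map_htmap[OF N W f] unfolding s_def[abs_def] t_def[abs_def] .
  note st = htmapD[OF this]
  obtain p p' where p: "\<And>i x. x \<in> piece N i \<Longrightarrow> p i x \<in> piece X (i + 1)" "\<And>i. lin_on (piece N i) (p i)"
    "\<And>i x. x \<in> piece N i \<Longrightarrow> p' i x \<in> piece X (i + 3)" "\<And>i. lin_on (piece N i) (p' i)"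
    and ep0: "\<And>i x. x \<in> piece N i \<Longrightarrow> gcomp b f i (e0 x) - 0 = diff X (i + 1) (p i x)"
    and ep1: "\<And>i x. x \<in> piece N i \<Longrightarrow> gcomp b f (i + 2) (e1 x) - 0 =
      diff X (i + 3) (p' i x) + act X (i + 1) (p i x) - p (i + 1) (act N i x)"
    by (rule homotopic_resolutionE[OF N X assms(6)]) blast
  have ep0': "b i (s i x) = diff X (i + 1) (p i x)"
    and ep1': "b (i + 2) (t i x) = diff X (i + 3) (p' i x) + act X (i + 1) (p i x) - p (i + 1)
        (act N i x)"
    if "x \<in> piece N i" for i x
    using ep0[OF that] ep1[OF that] by (auto simp: gcomp_def s_def t_def)
  note sB = boundaries_subspace[OF X] and sBW = boundaries_subspace[OF W]
  note sl = lin_on_add[OF st(4)] lin_on_scale[OF st(4)] and tl = lin_on_add[OF st(6)]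
      lin_on_scale[OF st(6)]
  note pl = lin_on_add[OF p(2)] lin_on_scale[OF p(2)]
  \<comment> \<open>The last condition ties the choice to \<open>p\<close>; without it the remaining
    obstruction \<open>u\<close> could be a nonzero class.\<close>
  define R where "R i x y \<longleftrightarrow> y \<in> piece W (i + 1) \<and> diff W (i + 1) y = s i x \<and>
      b (i + 1) y - p i x \<in> boundaries X (i + 1)" for i x y
  obtain q where q: "\<And>i. lin_on UNIV (q i)" "\<And>i x. x \<in> piece N i \<Longrightarrow> R i x (q i x)"
  proof (rule linear_choice_graded[of "piece N" R])
    show "\<exists>y. R i x y" if x: "x \<in> piece N i" for i x
    proof -
      have "b i (s i x) \<in> boundaries X i" using ep0'[OF x] p(1)[OF x] by (auto intro: boundariesI)
      with qi_inj[OF b st(1)[OF x]] obtain y where y: "y \<in> piece W (i + 1)" "diff W (i + 1) y = s i x"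
        by (metis boundariesE)
      have "diff X (i + 1) (b (i + 1) y) = b i (s i x)" using bd[OF y(1)] y(2) unfolding idx by simp
      then have "b (i + 1) y - p i x \<in> cycles X (i + 1)"
        using b_in[OF y(1)] p(1)[OF x] ep0'[OF x] by (intro cyclesI)
            (auto simp: piece_closed[OF X] diff_linear[OF X])
      then obtain y' where y': "y' \<in> cycles W (i + 1)" "b (i + 1) y - p i x - b (i + 1)
          y' \<in> boundaries X (i + 1)"
        using qi_surj[OF b] by blast
      have y'2: "y' \<in> piece W (i + 1)" "diff W (i + 1) y' = 0" using y'(1) by (auto simp: cycles_def)
      have "b (i + 1) (y - y') - p i x = b (i + 1) y - p i x - b (i + 1) y'"
        using bl(3)[OF y(1) y'2(1)] by simp
      then have "b (i + 1) (y - y') - p i x \<in> boundaries X (i + 1)"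
        using y'(2) by (simp only:)
      then have "R i x (y - y')"
        using y y'2 by (simp add: R_def piece_closed[OF W] diff_linear[OF W])
      then show ?thesis ..
    qed
    show "R i (x + x') (y + y')"
      if "x \<in> piece N i" "x' \<in> piece N i" "R i x y" "R i x' y'" for i x y x' y'
    proof -
      have "b (i + 1) (y + y') - p i (x + x') = (b (i + 1) y - p i x) + (b (i + 1) y' - p i x')"
        using that by (simp add: R_def bl pl)
      then have "b (i + 1) (y + y') - p i (x + x') \<in> boundaries X (i + 1)"
        using that subspace_add[OF sB] by (simp add: R_def)
      then show ?thesis
        using that by (simp add: R_def piece_closed[OF W] diff_linear[OF W] sl)
    qed
    show "R i (r *s x) (r *s y)" if "x \<in> piece N i" "R i x y" for i r x y
    proof -
      have "b (i + 1) (r *s y) - p i (r *s x) = r *s (b (i + 1) y - p i x)"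
        using that by (simp add: R_def bl pl scale_right_diff_distrib)
      then have "b (i + 1) (r *s y) - p i (r *s x) \<in> boundaries X (i + 1)"
        using that subspace_scale[OF sB] by (simp add: R_def)
      then show ?thesis
        using that by (simp add: R_def piece_closed[OF W] diff_linear[OF W] sl)
    qed
  qed (use piece_subspace[OF M] in auto)
  have qW: "q i x \<in> piece W (i + 1)" and dq: "diff W (i + 1) (q i x) = s i x"
    and qB: "b (i + 1) (q i x) - p i x \<in> boundaries X (i + 1)" if "x \<in> piece N i" for i x
    using q(2)[OF that] by (auto simp: R_def)
  have ql: "q i (x + y) = q i x + q i y" "q i (r *s x) = r *s q i x" for i x y r
    using lin_on_add[OF q(1)] lin_on_scale[OF q(1)] by auto
  have Tq: "act W (i + 1) (q i x) \<in> piece W (i + 2)" "q (i + 1) (act N i x) \<in> piece W (i + 2)"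
    if "x \<in> piece N i" for i x
    using act_in[OF W qW[OF that]] qW[OF act_in[OF M that]] unfolding idx by auto
  \<comment> \<open>What is left to be bounded on \<open>e1 x\<close> once \<open>q\<close> has been
    chosen on \<open>e0 x\<close>. It is a cycle and its image under \<open>b\<close> is a boundary,
    hence it is a boundary itself.\<close>
  define u where "u i x = t i x - (act W (i + 1) (q i x) - q (i + 1) (act N i x))" for i x
  have uW: "u i x \<in> piece W (i + 2)" if "x \<in> piece N i" for i x
    using Tq[OF that] st(5)[OF that] by (simp add: u_def piece_closed[OF W])
  have ul: "u i (x + y) = u i x + u i y" "u i (r *s x) = r *s u i x"
    if "x \<in> piece N i" "y \<in> piece N i" for i x y r
    using that by (simp_all add: u_def ql tl act_linear[OF M] act_linear[OF W] qW add_diff_add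
        scale_right_diff_distrib)
  have uB: "u i x \<in> boundaries W (i + 2)" if x: "x \<in> piece N i" for i x
  proof (rule qi_inj[OF b])
    note Tx = act_in[OF M x]
    have "diff W (i + 1 + 1) (act W (i + 1) (q i x)) = act W (i + 1 - 1) (diff W (i + 1) (q i x))"
      by (rule diff_act[OF W qW[OF x]])
    moreover have "diff W (i + 1 + 1) (q (i + 1) (act N i x)) = s (i + 1) (act N i x)"
        by (rule dq[OF Tx])
    ultimately have "diff W (i + 2) (u i x) = 0"
      using Tq[OF x] dq[OF x] st(5,7)[OF x] unfolding idx by (simp add: u_def diff_linear[OF W]
          piece_closed[OF W])
    then show "u i x \<in> cycles W (i + 2)" using uW[OF x] by (rule cyclesI[rotated])
    obtain e where e: "e \<in> piece X (i + 2)" "b (i + 1) (q i x) - p i x = diff X (i + 2) e"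
      using qB[OF x] by (metis boundariesE idx(4))
    obtain e' where e': "e' \<in> piece X (i + 3)" "b (i + 2) (q (i + 1) (act N i x)) - p (i + 1)
        (act N i x) = diff X (i + 3) e'"
      using qB[OF Tx] unfolding idx by (metis boundariesE idx(2))
    have Te: "act X (i + 2) e \<in> piece X (i + 3)" "diff X (i + 3) (act X (i + 2) e) = act X (i + 1)
        (diff X (i + 2) e)"
      using act_in[OF X e(1)] diff_act[OF X e(1)] unfolding idx by auto
    have bTq: "b (i + 2) (act W (i + 1) (q i x)) = act X (i + 1) (b (i + 1) (q i x))"
      using ba[OF qW[OF x]] unfolding idx by simp
    have Te2: "act X (i + 1) (b (i + 1) (q i x)) - act X (i + 1) (p i x) = act X (i + 1)
        (diff X (i + 2) e)"
      using act_linear(3)[OF X b_in[OF qW[OF x]] p(1)[OF x]] e(2) by simp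
    have "b (i + 2) (u i x) = b (i + 2) (t i x) - (b (i + 2) (act W (i + 1) (q i x)) - b (i + 2)
        (q (i + 1) (act N i x)))"
      using Tq[OF x] st(5)[OF x] by (simp add: u_def bl piece_closed[OF W])
    also have "\<dots> = diff X (i + 3) (p' i x) - (act X (i + 1) (b (i + 1) (q i x)) - act X (i + 1) (p i x))
        + (b (i + 2) (q (i + 1) (act N i x)) - p (i + 1) (act N i x))"
      using ep1'[OF x] bTq by (simp add: algebra_simps)
    also have "\<dots> = diff X (i + 3) (p' i x) - diff X (i + 3) (act X (i + 2) e) + diff X (i + 3) e'"
      using Te2 Te(2) e'(2) by simp
    also have "\<dots> = diff X (i + 3) (p' i x - act X (i + 2) e + e')"
      using p(3)[OF x] Te(1) e'(1) by (simp add: diff_linear[OF X] piece_closed[OF X])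
    finally show "b (i + 2) (u i x) \<in> boundaries X (i + 2)"
      using p(3)[OF x] Te(1) e'(1)
      by (intro boundariesI[of "p' i x - act X (i + 2) e + e'"])
          (auto simp only: idx intro!: piece_closed[OF X])
  qed
  obtain r where r: "\<And>i. lin_on UNIV (r i)"
      "\<And>i x. x \<in> piece N i \<Longrightarrow> r i x \<in> piece W (i + 3) \<and> diff W (i + 3) (r i x) = u i x"
  proof (rule linear_choice_graded[of "piece N" "\<lambda>i x y. y \<in> piece W (i + 3) \<and> diff W (i + 3)
      y = u i x"])
    show "\<exists>y. y \<in> piece W (i + 3) \<and> diff W (i + 3) y = u i x" if "x \<in> piece N i" for i x
      using uB[OF that] unfolding idx(2)[symmetric] by (metis boundariesE)
  qed (use piece_subspace[OF M] in \<open>auto simp: piece_closed[OF W] diff_linear[OF W] ul\<close>)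
  have W_lin: "lin_on (piece N i) (u i)" if "\<And>i. lin_on UNIV (u i)" for i and u :: "int \<Rightarrow> 'v \<Rightarrow> 'v"
    by (rule lin_on_mono[OF that]) simp
  show ?thesis
  proof (rule homotopic_resolutionI[OF N W f dg_map_zero[OF W], of q r])
    fix i x assume x: "x \<in> piece N i"
    show "f i (e0 x) - 0 = diff W (i + 1) (q i x)"
      using dq[OF x] by (simp add: s_def)
    show "f (i + 2) (e1 x) - 0 = diff W (i + 3) (r i x) + act W (i + 1) (q i x) - q (i + 1) (act N i x)"
      using r(2)[OF x] by (simp add: u_def t_def)
  qed (use qW r(2) W_lin[OF q(1)] W_lin[OF r(1)] in auto)
qed

lemma resolution_hproj:
  assumes N: "zero_diff N"
  shows "hproj (resolution N)"
  unfolding hproj_def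
proof (intro conjI allI impI)
  show "dg_module (resolution N)" by (rule resolution_module[OF N])
  fix W X b assume W: "dg_module W" and X: "dg_module X" and b: "quasi_iso W X b"
  show "\<exists>g. dg_map (resolution N) W g \<and> homotopic (resolution N) X (gcomp b g) f"
    if "dg_map (resolution N) X f" for f
    by (rule resolution_lift[OF N W X b that])
  show "homotopic (resolution N) W g g'"
    if g: "dg_map (resolution N) W g" "dg_map (resolution N) W g'"
      and h: "homotopic (resolution N) X (gcomp b g) (gcomp b g')" for g g'
  proof -
    have "homotopic (resolution N) X (\<lambda>i x. gcomp b g i x - gcomp b g' i x) (\<lambda>i x. 0)"
      using h by (subst (asm) homotopic_diff0)
    moreover have "homotopic (resolution N) X (gcomp b (\<lambda>i x. g i x - g' i x))
        (\<lambda>i x. gcomp b g i x - gcomp b g' i x)"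
    proof (rule homotopic_eq[OF X])
      show "gcomp b (\<lambda>i x. g i x - g' i x) i x = gcomp b g i x - gcomp b g' i x"
      if "x \<in> piece (resolution N) i" for i x
      using map_linear(3)[OF W qi_map[OF b]] map_in[OF g(1) that] map_in[OF g(2) that]
      by (simp add: gcomp_def)
    qed
    ultimately have "homotopic (resolution N) X (gcomp b (\<lambda>i x. g i x - g' i x)) (\<lambda>i x. 0)"
      using homotopic_trans[OF X] by blast
    then show ?thesis
      using resolution_lift_unique[OF N W X b dg_map_sub[OF W g]] homotopic_diff0 by blast
  qed
qed

section \<open>Homology as a module with zero differential\<close>

lemma zero_diff_homology:
  assumes "zero_diff N"
  shows "cycles N i = piece N i" "boundaries N i = {0}"
  using zero_diff_diff[OF assms] piece_closed(1)[OF zero_diff_module[OF assms]]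
  by (auto simp: cycles_def boundaries_def image_iff intro!: bexI[of _ 0])

lemma zero_diff_Df_iff:
  assumes "zero_diff N"
  shows "N \<in> Df \<longleftrightarrow> finite {i. piece N i \<noteq> {0}} \<and> (\<forall>i. \<exists>F. finite F \<and> piece N i = span F)"
proof -
  have "(\<exists>F. finite F \<and> F \<subseteq> piece N i \<and> piece N i = span (F \<union> {0})) \<longleftrightarrow>
      (\<exists>F. finite F \<and> piece N i = span F)" for i
    using span_superset by (simp add: span_insert_0) blast
  then show ?thesis
    using zero_diff_module[OF assms]
    by (simp add: Df_def finite_homology_def zero_diff_homology[OF assms] span_insert_0)
qed

lemma DfD: "X \<in> Df \<Longrightarrow> dg_module X"
  by (simp add: Df_def)

text \<open>The homology is realised inside the cycles as the kernel of a projection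
  \<open>g\<close> onto the boundaries. T need not preserve this complement, so the action is
  followed by the projection along the boundaries; the discarded part
  \<open>g (i + 1) (act X i x)\<close> is a boundary, and \<open>t\<close> picks an element that
  bounds it.\<close>

lemma homology_model:
  assumes "X \<in> Df"
  obtains N s t where "zero_diff N" "N \<in> Df" "htmap N X s t"
    "\<And>i x. x \<in> piece N i \<Longrightarrow> s i x \<in> boundaries X i \<Longrightarrow> x = 0"
    "\<And>i z. z \<in> cycles X i \<Longrightarrow> \<exists>x\<in>piece N i. z - s i x \<in> boundaries X i"
proof -
  have X: "dg_module X" and fin: "finite {i. cycles X i \<noteq> boundaries X i}"
    and gen: "\<And>i. \<exists>F. finite F \<and> F \<subseteq> cycles X i \<and> cycles X i = span (F \<union> boundaries X i)"
    using assms by (auto simp: Df_def finite_homology_def)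
  note sB = boundaries_subspace[OF X] and sZ = cycles_subspace[OF X]
  note BZ = boundaries_cycles[OF X]
  obtain g where g: "\<And>i. lin_on UNIV (g i)" "\<And>i x. x \<in> boundaries X i \<Longrightarrow> g i x = x"
      "\<And>i x. g i x \<in> boundaries X i"
    using projection_exists[OF sB] by metis
  note gl = lin_on_add[OF g(1)] lin_on_scale[OF g(1)] lin_on_zero[OF g(1)]
  define N where "N = \<lparr> piece = \<lambda>i. {x \<in> cycles X i. g i x = 0}, diff = \<lambda>i x. 0,
     act = \<lambda>i x. act X i x - g (i + 1) (act X i x) \<rparr>"
  have N_simps: "piece N i = {x \<in> cycles X i. g i x = 0}" "diff N i x = 0"
    "act N i x = act X i x - g (i + 1) (act X i x)" for i x
    by (simp_all add: N_def)
  have proj: "x - g i x \<in> piece N i" if "x \<in> cycles X i" for i x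
    using that BZ[OF g(3)] subspace_diff[OF sZ] lin_on_diff[OF g(1)] g(2)[OF g(3)]
    by (simp add: N_simps)
  have sN: "subspace (piece N i)" for i
    by (rule subspaceI) (auto simp: N_simps gl subspace_0[OF sZ] subspace_add[OF sZ]
        subspace_scale[OF sZ])
  have actN: "act N i x \<in> piece N (i + 1)" if "x \<in> piece N i" for i x
    using proj[OF act_cycles[OF X]] that by (simp add: N_simps)
  have act_linN: "lin_on (piece N i) (act N i)" for i
    by (rule lin_onI) (auto simp: N_simps cycles_def act_linear[OF X]
        gl scale_right_diff_distrib add_diff_add)
  have M: "dg_module N"
    using sN actN act_linN by (auto simp: dg_module_def N_simps(2) lin_on_const0 subspace_0)
       (simp add: N_simps gl(3)[OF subspace_UNIV] act_linear[OF X] lin_on_def)+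
  have N0: "piece N i = {0}" if "cycles X i = boundaries X i" for i
    using that g(2) subspace_0[OF sZ, of i] gl(3)[OF subspace_UNIV] by (force simp: N_simps)
  have low: "\<exists>l. \<forall>i<l. piece N i = {0}"
  proof -
    obtain l where "\<And>i. i \<in> {i. cycles X i \<noteq> boundaries X i} \<Longrightarrow> l \<le> i"
      using bdd_below_finite[OF fin] unfolding bdd_below_def by blast
    then have "piece N i = {0}" if "i < l" for i using N0[of i] that by force
    then show ?thesis by blast
  qed
  have zN: "zero_diff N" using M low by (simp add: zero_diff_def N_simps)
  have "finite {i. piece N i \<noteq> {0}}"
    by (rule finite_subset[OF _ fin]) (use N0 in auto)
  moreover have "\<exists>F. finite F \<and> piece N i = span F" for i
  proof -
    obtain F where F: "finite F" "F \<subseteq> cycles X i" "cycles X i = span (F \<union> boundaries X i)"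
      using gen by blast
    let ?k = "\<lambda>x. x - g i x"
    have k: "?k x \<in> span (?k ` F)" if "x \<in> span (F \<union> boundaries X i)" for x
      using that
    proof (induction rule: span_induct_alt)
      case base
      then show ?case using gl(3)[OF subspace_UNIV] by (simp add: span_zero)
    next
      case (step c x y)
      have eq: "?k (c *s x + y) = c *s ?k x + ?k y"
        by (simp add: gl scale_right_diff_distrib add_diff_add)
      have "?k x \<in> span (?k ` F)"
        using step(1) g(2) by (auto intro: span_base simp: span_zero)
      then show ?case unfolding eq using step(2) by (intro span_add span_scale)
    qed
    have "piece N i \<subseteq> span (?k ` F)"
    proof
      fix x assume "x \<in> piece N i"
      then show "x \<in> span (?k ` F)" using k[of x] F(3) by (simp add: N_simps)
    qed
    moreover have "span (?k ` F) \<subseteq> piece N i"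
      by (rule span_minimal[OF _ sN]) (use proj F(2) in auto)
    ultimately show ?thesis using F(1) by (intro exI[of _ "?k ` F"]) auto
  qed
  ultimately have "N \<in> Df" using zero_diff_Df_iff[OF zN] by blast
  obtain t where t: "\<And>i. lin_on UNIV (t i)"
    "\<And>i x. x \<in> piece N i \<Longrightarrow> t i x \<in> piece X (i + 2) \<and> diff X (i + 2) (t i x) = g (i + 1) (act X i x)"
  proof (rule linear_choice_graded[of "piece N"
        "\<lambda>i x y. y \<in> piece X (i + 2) \<and> diff X (i + 2) y = g (i + 1) (act X i x)"])
    show "\<exists>y. y \<in> piece X (i + 2) \<and> diff X (i + 2) y = g (i + 1) (act X i x)" for i x
    proof -
      have "i + 1 + 1 = i + 2" by simp
      then show ?thesis using g(3)[of "i + 1" "act X i x"] by (metis boundariesE)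
    qed
  qed (use sN in \<open>auto simp: piece_closed[OF X] diff_linear[OF X] gl act_linear[OF X] N_simps(1)
      cycles_def\<close>)
  have "htmap N X (\<lambda>i x. x) t"
    unfolding htmap_def
    using t(2) lin_on_mono[OF t(1)] by (auto simp: lin_on_ident N_simps)
  then show thesis
  proof (rule that[OF zN \<open>N \<in> Df\<close>])
    show "x = 0" if "x \<in> piece N i" "x \<in> boundaries X i" for i x
      using that g(2) by (simp add: N_simps)
    show "\<exists>x\<in>piece N i. z - x \<in> boundaries X i" if "z \<in> cycles X i" for i z
      using proj[OF that] g(3) by (intro bexI[of _ "z - g i z"]) auto
  qed
qed

subsection \<open>Morphisms of the derived category as homotopy classes\<close>

definition resolves :: "'v dgm \<Rightarrow> 'v dgm \<Rightarrow> (int \<Rightarrow> 'v \<Rightarrow> 'v) \<Rightarrow> bool" where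
  "resolves X P q \<longleftrightarrow> dg_module X \<and> hproj P \<and> quasi_iso P X q"

lemma resolvesD:
  assumes "resolves X P q"
  shows "dg_module X" "dg_module P" "hproj P" "quasi_iso P X q" "dg_map P X q"
  using assms by (auto simp: resolves_def hproj_def qi_map)

lemma hproj_lift:
  assumes "hproj P" "dg_module W" "dg_module X" "quasi_iso W X b" "dg_map P X f"
  obtains g where "dg_map P W g" "homotopic P X (gcomp b g) f"
  using assms unfolding hproj_def by blast

lemma hproj_unique:
  assumes "hproj P" "dg_module W" "dg_module X" "quasi_iso W X b" "dg_map P W g" "dg_map P W g'"
    "homotopic P X (gcomp b g) (gcomp b g')"
  shows "homotopic P W g g'"
  using assms unfolding hproj_def by blast

lemma is_roofD:
  assumes "is_roof r"
  shows "dg_module (src r)" "dg_module (apex r)" "dg_module (tgt r)"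
    "quasi_iso (apex r) (src r) (bwd r)" "dg_map (apex r) (src r) (bwd r)" "dg_map (apex r)
        (tgt r) (fwd r)"
  using assms by (auto simp: is_roof_def qi_map)

text \<open>The backward leg of \<open>r\<close> is inverted on \<open>P\<close>: lifting
  \<open>q\<close> through it and following the forward leg gives a map \<open>f\<close> out of
  \<open>P\<close>, determined up to homotopy.\<close>

definition rep :: "'v roof \<Rightarrow> 'v dgm \<Rightarrow> (int \<Rightarrow> 'v \<Rightarrow> 'v) \<Rightarrow> (int \<Rightarrow> 'v \<Rightarrow> 'v) \<Rightarrow> bool" where
  "rep r P q f \<longleftrightarrow> (\<exists>u. dg_map P (apex r) u \<and> homotopic P (src r) (gcomp (bwd r) u) q \<and>
     homotopic P (tgt r) (gcomp (fwd r) u) f)"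

lemma rep_exists:
  assumes "is_roof r" "resolves (src r) P q"
  shows "\<exists>f. dg_map P (tgt r) f \<and> rep r P q f"
proof -
  note r = is_roofD[OF assms(1)] and p = resolvesD[OF assms(2)]
  obtain u where "dg_map P (apex r) u" "homotopic P (src r) (gcomp (bwd r) u) q"
    by (rule hproj_lift[OF p(3) r(2,1,4) p(5)])
  then show ?thesis
    unfolding rep_def using dg_map_comp[OF _ r(6)] homotopic_refl[OF r(3)]
    by (intro exI[of _ "gcomp (fwd r) u"] conjI exI[of _ u]) auto
qed

lemma rep_homotopic:
  assumes "is_roof r" "rep r P q f" "homotopic P (tgt r) f f'"
  shows "rep r P q f'"
  using assms homotopic_trans[OF is_roofD(3)[OF assms(1)]] unfolding rep_def by blast

lemma lift_unique:
  assumes r: "is_roof r" and p: "resolves (src r) P q"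
    and "dg_map P (apex r) u" "homotopic P (src r) (gcomp (bwd r) u) q"
    and "dg_map P (apex r) u'" "homotopic P (src r) (gcomp (bwd r) u') q"
  shows "homotopic P (tgt r) (gcomp (fwd r) u) (gcomp (fwd r) u')"
proof -
  note rd = is_roofD[OF r] and pd = resolvesD[OF p]
  have "homotopic P (src r) (gcomp (bwd r) u) (gcomp (bwd r) u')"
    using assms homotopic_sym[OF pd(2) rd(1)] homotopic_trans[OF rd(1)] by blast
  then have "homotopic P (apex r) u u'"
    by (rule hproj_unique[OF pd(3) rd(2,1,4) assms(3,5)])
  then show ?thesis
    by (rule homotopic_post_map[OF pd(2) rd(2) _ rd(6) assms(3,5)])
qed

lemma rep_unique:
  assumes r: "is_roof r" and p: "resolves (src r) P q" and "rep r P q f" "rep r P q f'"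
  shows "homotopic P (tgt r) f f'"
proof -
  note rd = is_roofD[OF r] and pd = resolvesD[OF p]
  obtain u u' where u: "dg_map P (apex r) u" "homotopic P (src r) (gcomp (bwd r) u) q"
      "homotopic P (tgt r) (gcomp (fwd r) u) f" "dg_map P (apex r) u'"
      "homotopic P (src r) (gcomp (bwd r) u') q" "homotopic P (tgt r) (gcomp (fwd r) u') f'"
    using assms(3,4) unfolding rep_def by blast
  have "homotopic P (tgt r) (gcomp (fwd r) u) (gcomp (fwd r) u')"
    by (rule lift_unique[OF r p u(1,2,4,5)])
  then show ?thesis
    using u homotopic_sym[OF pd(2) rd(3)] homotopic_trans[OF rd(3)] by blast
qed

text \<open>If \<open>W\<close> witnesses the equivalence, \<open>q\<close> lifts through
  \<open>W\<close>, and both forward legs give the same map on \<open>P\<close> up to homotopy.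
  Conversely \<open>P\<close> itself serves as \<open>W\<close>.\<close>

lemma roof_eq_iff:
  assumes p: "resolves X P q" and r: "is_roof r" "src r = X" and r': "is_roof r'" "src r' = X"
      "tgt r' = tgt r"
  shows "roof_eq r r' \<longleftrightarrow> (\<exists>f. dg_map P (tgt r) f \<and> rep r P q f \<and> rep r' P q f)"
proof
  note rd = is_roofD[OF r(1)] and rd' = is_roofD[OF r'(1)] and pd = resolvesD[OF p]
  assume "roof_eq r r'"
  then obtain W g g' where W: "dg_module W" "dg_map W (apex r) g" "dg_map W (apex r') g'"
      "quasi_iso W (src r) (gcomp (bwd r) g)"
      "homotopic W (src r) (gcomp (bwd r) g) (gcomp (bwd r') g')"
      "homotopic W (tgt r) (gcomp (fwd r) g) (gcomp (fwd r') g')"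
    unfolding roof_eq_def by blast
  obtain v where v: "dg_map P W v" "homotopic P X (gcomp (gcomp (bwd r) g) v) q"
    by (rule hproj_lift[OF pd(3) W(1) pd(1) _ pd(5)]) (use W(4) r(2) in auto)
  have "homotopic P X (gcomp (gcomp (bwd r') g') v) (gcomp (gcomp (bwd r) g) v)"
    using homotopic_sym[OF pd(2,1) homotopic_pre[OF W(5)[unfolded r(2)] v(1)]] .
  then have v': "homotopic P X (gcomp (gcomp (bwd r') g') v) q"
    using homotopic_trans[OF pd(1) _ v(2)] by blast
  have f: "homotopic P (tgt r) (gcomp (gcomp (fwd r') g') v) (gcomp (gcomp (fwd r) g) v)"
    using homotopic_sym[OF pd(2) rd(3) homotopic_pre[OF W(6) v(1)]] .
  show "\<exists>f. dg_map P (tgt r) f \<and> rep r P q f \<and> rep r' P q f"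
  proof (intro exI conjI)
    show "dg_map P (tgt r) (gcomp (gcomp (fwd r) g) v)"
      using dg_map_comp v(1) W(2) rd(6) by blast
    show "rep r P q (gcomp (gcomp (fwd r) g) v)"
      unfolding rep_def using v r(2) dg_map_comp[OF v(1) W(2)] homotopic_refl[OF rd(3)]
      by (intro exI[of _ "gcomp g v"]) (simp add: gcomp_assoc)
    show "rep r' P q (gcomp (gcomp (fwd r) g) v)"
      unfolding rep_def using v' f r' dg_map_comp[OF v(1) W(3)]
      by (intro exI[of _ "gcomp g' v"]) (simp add: gcomp_assoc)
  qed
next
  note rd = is_roofD[OF r(1)] and rd' = is_roofD[OF r'(1)] and pd = resolvesD[OF p]
  assume "\<exists>f. dg_map P (tgt r) f \<and> rep r P q f \<and> rep r' P q f"
  then obtain f u u' where u: "dg_map P (apex r) u" "homotopic P X (gcomp (bwd r) u) q"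
      "homotopic P (tgt r) (gcomp (fwd r) u) f" "dg_map P (apex r') u'"
      "homotopic P X (gcomp (bwd r') u') q" "homotopic P (tgt r) (gcomp (fwd r') u') f"
    using r r' unfolding rep_def by metis
  have "quasi_iso P X (gcomp (bwd r) u)"
    by (rule quasi_iso_homotopic[OF pd(2,1,4) _ homotopic_sym[OF pd(2,1) u(2)]])
      (use dg_map_comp[OF u(1) rd(5)] r in auto)
  moreover have "homotopic P X (gcomp (bwd r) u) (gcomp (bwd r') u')"
    using homotopic_trans[OF pd(1) u(2) homotopic_sym[OF pd(2,1) u(5)]] .
  moreover have "homotopic P (tgt r) (gcomp (fwd r) u) (gcomp (fwd r') u')"
    using homotopic_trans[OF rd(3) u(3) homotopic_sym[OF pd(2) rd(3) u(6)]] .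
  ultimately show "roof_eq r r'"
    unfolding roof_eq_def using r r' u(1,4) pd(2)
    by (intro conjI exI[of _ P] exI[of _ u] exI[of _ u']) simp_all
qed

section \<open>Operations on morphisms in terms of one resolution\<close>

definition mk ::
  "'v dgm \<Rightarrow> 'v dgm \<Rightarrow> (int \<Rightarrow> 'v \<Rightarrow> 'v) \<Rightarrow> 'v dgm \<Rightarrow> (int \<Rightarrow> 'v \<Rightarrow> 'v) \<Rightarrow> 'v roof set" where
  "mk X P q Y f = roof_class \<lparr> src = X, apex = P, tgt = Y, bwd = q, fwd = f \<rparr>"

lemma roof_mk:
  assumes "resolves X P q" "dg_module Y" "dg_map P Y f"
  shows "is_roof \<lparr> src = X, apex = P, tgt = Y, bwd = q, fwd = f \<rparr>"
    and "rep \<lparr> src = X, apex = P, tgt = Y, bwd = q, fwd = f \<rparr> P q f"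
  using assms resolvesD[OF assms(1)] dg_map_id[of P] homotopic_refl[of X P q] homotopic_refl[of Y P f]
  by (auto simp: is_roof_def rep_def intro!: exI[of _ "\<lambda>i x. x"])

lemma roof_class_mk:
  assumes p: "resolves X P q" and r: "is_roof r" "src r = X" and f: "rep r P q f" "dg_map P (tgt r) f"
  shows "roof_class r = {r'. is_roof r' \<and> src r' = X \<and> tgt r' = tgt r \<and> rep r' P q f}"
proof -
  note rd = is_roofD[OF r(1)] and pd = resolvesD[OF p]
  have p': "resolves (src r) P q" using p r by simp
  have "roof_eq r r' \<longleftrightarrow> rep r' P q f"
    if r': "is_roof r'" "src r' = X" "tgt r' = tgt r" for r'
  proof
    assume "roof_eq r r'"
    then obtain f' where f': "rep r P q f'" "rep r' P q f'"
      using roof_eq_iff[OF p r r'] by blast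
    then have "homotopic P (tgt r) f' f" using rep_unique[OF r(1) p' _ f(1)] by blast
    then show "rep r' P q f" using rep_homotopic[OF r'(1) f'(2)] r'(3) by simp
  qed (use roof_eq_iff[OF p r r'] f in blast)
  moreover have "is_roof r' \<and> src r' = X \<and> tgt r' = tgt r" if "roof_eq r r'" for r'
    using that r by (simp add: roof_eq_def)
  ultimately show ?thesis unfolding roof_class_def by blast
qed

lemma mk_eq:
  assumes "resolves X P q" "dg_module Y" "dg_map P Y f"
  shows "mk X P q Y f = {r. is_roof r \<and> src r = X \<and> tgt r = Y \<and> rep r P q f}"
  unfolding mk_def using roof_class_mk[OF assms(1) roof_mk(1)[OF assms] _ roof_mk(2)[OF assms]] assms(3)
  by simp

lemma roof_class_eq_mk:
  assumes "resolves (src r) P q" "is_roof r" "rep r P q f" "dg_map P (tgt r) f"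
  shows "roof_class r = mk (src r) P q (tgt r) f"
  using roof_class_mk[OF assms(1,2) _ assms(3,4)] mk_eq[OF assms(1) is_roofD(3)[OF assms(2)] assms(4)]
  by simp

lemma mk_eq_iff:
  assumes p: "resolves X P q" and Y: "dg_module Y" and f: "dg_map P Y f" and g: "dg_map P Y g"
  shows "mk X P q Y f = mk X P q Y g \<longleftrightarrow> homotopic P Y f g"
proof
  note pd = resolvesD[OF p]
  assume eq: "mk X P q Y f = mk X P q Y g"
  have "\<lparr> src = X, apex = P, tgt = Y, bwd = q, fwd = f \<rparr> \<in> mk X P q Y f"
    unfolding mk_eq[OF p Y f] using roof_mk[OF p Y f] by simp
  then have "rep \<lparr> src = X, apex = P, tgt = Y, bwd = q, fwd = f \<rparr> P q g"
    unfolding eq mk_eq[OF p Y g] by simp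
  then show "homotopic P Y f g"
    using rep_unique[OF roof_mk(1)[OF p Y f] _ roof_mk(2)[OF p Y f]] p by simp
next
  note pd = resolvesD[OF p]
  assume h: "homotopic P Y f g"
  have "rep r P q f \<longleftrightarrow> rep r P q g" if "is_roof r" "tgt r = Y" for r
    using rep_homotopic[OF that(1) _ h[folded that(2)]]
      rep_homotopic[OF that(1) _ homotopic_sym[OF pd(2) Y h, folded that(2)]] by (rule iffI)
  then show "mk X P q Y f = mk X P q Y g"
    unfolding mk_eq[OF p Y f] mk_eq[OF p Y g] by (intro Collect_cong conj_cong refl) simp
qed

lemma dHom_mk:
  assumes p: "resolves X P q" and Y: "dg_module Y"
  shows "dHom X Y = {mk X P q Y f |f. dg_map P Y f}"
proof (intro equalityI subsetI)
  fix a assume "a \<in> dHom X Y"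
  then obtain r where r: "a = roof_class r" "is_roof r" "src r = X" "tgt r = Y"
    by (auto simp: dHom_def)
  then obtain f where f: "dg_map P Y f" "rep r P q f" using rep_exists[of r P q] p by blast
  then have "a = mk X P q Y f"
    using roof_class_eq_mk[of r P q f] r p by simp
  with f show "a \<in> {mk X P q Y f |f. dg_map P Y f}" by blast
next
  fix a assume "a \<in> {mk X P q Y f |f. dg_map P Y f}"
  then obtain f where f: "a = mk X P q Y f" "dg_map P Y f" by blast
  then show "a \<in> dHom X Y"
    using roof_mk(1)[OF p Y f(2)] unfolding dHom_def mk_def
    by (intro CollectI exI[of _ "\<lparr> src = X, apex = P, tgt = Y, bwd = q, fwd = f \<rparr>"]) simp
qed

text \<open>\<open>dComp\<close> collects the results for all representatives and all ways to
  complete them by some \<open>W\<close>, so both inclusions are at stake. Any completion is pulled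
  back to \<open>P\<close> and compared with \<open>k\<close> through uniqueness of lifts along
  \<open>bwd r'\<close>; conversely \<open>k\<close> is itself a completion with apex
  \<open>P\<close>.\<close>

lemma comp_mk:
  assumes p: "resolves X P q" and p': "resolves Y P' q'" and Z: "dg_module Z"
    and f: "dg_map P Y f" and g: "dg_map P' Z g" and k: "dg_map P P' k"
    and qk: "homotopic P Y (gcomp q' k) f"
  shows "mk Y P' q' Z g \<cdot> mk X P q Y f = mk X P q Z (gcomp g k)"
proof (intro equalityI subsetI)
  note pd = resolvesD[OF p] and pd' = resolvesD[OF p']
  note gk = dg_map_comp[OF k g]
  fix s assume "s \<in> mk Y P' q' Z g \<cdot> mk X P q Y f"
  then obtain r r' W u h where r: "r \<in> mk X P q Y f" "r' \<in> mk Y P' q' Z g"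
    and W: "dg_module W" "quasi_iso W (apex r) u" "dg_map W (apex r') h"
      "homotopic W (tgt r) (gcomp (fwd r) u) (gcomp (bwd r') h)"
    and s: "roof_eq \<lparr> src = src r, apex = W, tgt = tgt r', bwd = gcomp (bwd r)
        u, fwd = gcomp (fwd r') h \<rparr> s"
    unfolding dComp_def by blast
  let ?t = "\<lparr> src = src r, apex = W, tgt = tgt r', bwd = gcomp (bwd r) u, fwd = gcomp (fwd r') h \<rparr>"
  have r1: "is_roof r" "src r = X" "tgt r = Y" "rep r P q f"
    and r1': "is_roof r'" "src r' = Y" "tgt r' = Z" "rep r' P' q' g"
    using r unfolding mk_eq[OF p pd'(1) f] mk_eq[OF p' Z g] by auto
  note rd = is_roofD[OF r1(1)] and rd' = is_roofD[OF r1'(1)]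
  note mu = qi_map[OF W(2)]
  have t: "is_roof ?t"
    using rd rd' W quasi_iso_comp[OF W(1) rd(2,1) W(2) rd(4)] dg_map_comp[OF W(3) rd'(6)]
    by (simp add: is_roof_def)
  obtain v where v: "dg_map P W v" "homotopic P X (gcomp (gcomp (bwd r) u) v) q"
    by (rule hproj_lift[OF pd(3) W(1) pd(1) _ pd(5)]) (use is_roofD(4)[OF t] r1 in auto)
  have uv: "dg_map P (apex r) (gcomp u v)" using dg_map_comp[OF v(1) mu] .
  have "rep r P q (gcomp (fwd r) (gcomp u v))"
    unfolding rep_def using uv v(2) r1(2) homotopic_refl[OF rd(3)]
    by (intro exI[of _ "gcomp u v"]) (simp add: gcomp_assoc)
  then have 1: "homotopic P Y (gcomp (fwd r) (gcomp u v)) f"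
    using rep_unique[OF r1(1) _ _ r1(4)] p r1(2,3) by simp
  obtain u' where u': "dg_map P' (apex r') u'" "homotopic P' Y (gcomp (bwd r') u') q'"
      "homotopic P' Z (gcomp (fwd r') u') g"
    using r1' unfolding rep_def by auto
  have hv: "dg_map P (apex r') (gcomp h v)" using dg_map_comp[OF v(1) W(3)] .
  have u'k: "dg_map P (apex r') (gcomp u' k)" using dg_map_comp[OF k u'(1)] .
  have 2: "homotopic P Y (gcomp (fwd r) (gcomp u v)) (gcomp (bwd r') (gcomp h v))"
    using homotopic_pre[OF W(4) v(1)] r1(3) by (simp add: gcomp_assoc)
  have 3: "homotopic P Y (gcomp (bwd r') (gcomp u' k)) (gcomp q' k)"
    using homotopic_pre[OF u'(2) k] by (simp add: gcomp_assoc)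
  note sym = homotopic_sym[OF pd(2) pd'(1)] and trans = homotopic_trans[OF pd'(1)]
  have "homotopic P Y (gcomp (bwd r') (gcomp h v)) (gcomp (bwd r') (gcomp u' k))"
    using trans[OF trans[OF sym[OF 2] 1] sym[OF trans[OF 3 qk]]] .
  then have "homotopic P (apex r') (gcomp h v) (gcomp u' k)"
    using hproj_unique[OF pd(3) rd'(2,1,4) hv u'k] r1'(2) by simp
  from homotopic_post_map[OF pd(2) rd'(2) this rd'(6) hv u'k]
  have "homotopic P Z (gcomp (fwd r') (gcomp h v)) (gcomp (fwd r') (gcomp u' k))"
    using r1'(3) by simp
  moreover have "homotopic P Z (gcomp (fwd r') (gcomp u' k)) (gcomp g k)"
    using homotopic_pre[OF u'(3) k] by (simp add: gcomp_assoc)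
  ultimately have "homotopic P Z (gcomp (gcomp (fwd r') h) v) (gcomp g k)"
    using homotopic_trans[OF Z] unfolding gcomp_assoc by blast
  then have rt: "rep ?t P q (gcomp g k)"
    unfolding rep_def using v r1(2) r1'(3) by auto
  have "roof_class ?t = mk X P q Z (gcomp g k)"
    using roof_class_eq_mk[OF _ t rt] p gk r1(2) r1'(3) by simp
  then show "s \<in> mk X P q Z (gcomp g k)" using s by (auto simp: roof_class_def)
next
  note pd = resolvesD[OF p] and pd' = resolvesD[OF p']
  fix s assume "s \<in> mk X P q Z (gcomp g k)"
  then have "roof_eq \<lparr> src = X, apex = P, tgt = Z, bwd = q, fwd = gcomp g k \<rparr> s"
    by (simp add: mk_def roof_class_def)
  moreover have "\<lparr> src = X, apex = P, tgt = Y, bwd = q, fwd = f \<rparr> \<in> mk X P q Y f"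
    using roof_mk[OF p pd'(1) f] unfolding mk_eq[OF p pd'(1) f] by simp
  moreover have "\<lparr> src = Y, apex = P', tgt = Z, bwd = q', fwd = g \<rparr> \<in> mk Y P' q' Z g"
    using roof_mk[OF p' Z g] unfolding mk_eq[OF p' Z g] by simp
  ultimately show "s \<in> mk Y P' q' Z g \<cdot> mk X P q Y f"
    unfolding dComp_def
    using pd(2) quasi_iso_id[OF pd(2)] k homotopic_sym[OF pd(2) pd'(1) qk]
    by (intro CollectI, intro bexI[of _ "\<lparr> src = X, apex = P, tgt = Y, bwd = q, fwd = f \<rparr>"]
        bexI[of _ "\<lparr> src = Y, apex = P', tgt = Z, bwd = q', fwd = g \<rparr>"]
        exI[of _ P] exI[of _ "\<lambda>i x. x"] exI[of _ k]) simp_all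
qed

text \<open>\<open>dAdd\<close> only admits roofs with the same backward leg, so one lift
  \<open>u\<close> of \<open>q\<close> computes both summands, and the results can be added.\<close>

lemma add_mk:
  assumes p: "resolves X P q" and Y: "dg_module Y" and f: "dg_map P Y f" and g: "dg_map P Y g"
  shows "mk X P q Y f \<boxplus> mk X P q Y g = mk X P q Y (\<lambda>i x. f i x + g i x)"
proof (intro equalityI subsetI)
  note pd = resolvesD[OF p]
  note fg = dg_map_add[OF Y f g]
  fix s assume "s \<in> mk X P q Y f \<boxplus> mk X P q Y g"
  then obtain r r' where r: "r \<in> mk X P q Y f" "r' \<in> mk X P q Y g"
      "src r = src r'" "apex r = apex r'" "tgt r = tgt r'" "bwd r = bwd r'"
    and s: "roof_eq (r\<lparr> fwd := \<lambda>i x. fwd r i x + fwd r' i x \<rparr>) s"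
    unfolding dAdd_def by blast
  let ?t = "r\<lparr> fwd := \<lambda>i x. fwd r i x + fwd r' i x \<rparr>"
  have r1: "is_roof r" "src r = X" "tgt r = Y" "rep r P q f"
    and r1': "is_roof r'" "src r' = X" "tgt r' = Y" "rep r' P q g"
    using r unfolding mk_eq[OF p Y f] mk_eq[OF p Y g] by auto
  note rd = is_roofD[OF r1(1)] and rd' = is_roofD[OF r1'(1)]
  have t: "is_roof ?t"
    using rd rd' r r1 r1' dg_map_add[OF Y, of "apex r" "fwd r" "fwd r'"] by (simp add: is_roof_def)
  obtain u where u: "dg_map P (apex r) u" "homotopic P X (gcomp (bwd r) u) q"
      "homotopic P Y (gcomp (fwd r) u) f"
    using r1 unfolding rep_def by auto
  have "rep r' P q (gcomp (fwd r') u)"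
    unfolding rep_def using u r r1' homotopic_refl[OF Y] by (intro exI[of _ u]) simp
  then have "homotopic P Y (gcomp (fwd r') u) g"
    using rep_unique[OF r1'(1) _ _ r1'(4)] p r1'(2,3) by simp
  from homotopic_add[OF Y u(3) this]
  have "homotopic P Y (gcomp (fwd ?t) u) (\<lambda>i x. f i x + g i x)" by (simp add: gcomp_def)
  then have rt: "rep ?t P q (\<lambda>i x. f i x + g i x)"
    unfolding rep_def using u r1 by auto
  have "roof_class ?t = mk X P q Y (\<lambda>i x. f i x + g i x)"
    using roof_class_eq_mk[OF _ t rt] p fg r1 by simp
  then show "s \<in> mk X P q Y (\<lambda>i x. f i x + g i x)" using s by (auto simp: roof_class_def)
next
  fix s assume "s \<in> mk X P q Y (\<lambda>i x. f i x + g i x)"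
  then have "roof_eq \<lparr> src = X, apex = P, tgt = Y, bwd = q, fwd = \<lambda>i x. f i x + g i x \<rparr> s"
    by (simp add: mk_def roof_class_def)
  moreover have "\<lparr> src = X, apex = P, tgt = Y, bwd = q, fwd = f \<rparr> \<in> mk X P q Y f"
    using roof_mk[OF p Y f] unfolding mk_eq[OF p Y f] by simp
  moreover have "\<lparr> src = X, apex = P, tgt = Y, bwd = q, fwd = g \<rparr> \<in> mk X P q Y g"
    using roof_mk[OF p Y g] unfolding mk_eq[OF p Y g] by simp
  ultimately show "s \<in> mk X P q Y f \<boxplus> mk X P q Y g"
    unfolding dAdd_def
    by (intro CollectI, intro bexI[of _ "\<lparr> src = X, apex = P, tgt = Y, bwd = q, fwd = f \<rparr>"]
        bexI[of _ "\<lparr> src = X, apex = P, tgt = Y, bwd = q, fwd = g \<rparr>"]) simp_all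
qed

lemma dmor_mk:
  assumes p: "resolves X P q" and Y: "dg_module Y" and f: "dg_map X Y f"
  shows "dmor X Y f = mk X P q Y (gcomp f q)"
proof -
  note pd = resolvesD[OF p]
  let ?r = "\<lparr> src = X, apex = X, tgt = Y, bwd = \<lambda>i x. x, fwd = f \<rparr>"
  have r: "is_roof ?r" using pd Y f by (simp add: is_roof_def quasi_iso_id)
  have "rep ?r P q (gcomp f q)"
    unfolding rep_def using pd homotopic_refl[OF Y] homotopic_refl[OF pd(1)]
    by (intro exI[of _ q]) simp
  then show ?thesis
    using roof_class_eq_mk[OF _ r] p dg_map_comp[OF pd(5) f] by (simp add: dmor_def)
qed

lemma resolution_exists: "X \<in> Df \<Longrightarrow> \<exists>P q. resolves X P q"
proof -
  assume X: "X \<in> Df"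
  obtain N s t where N: "zero_diff N" "N \<in> Df" "htmap N X s t"
    "\<And>i x. x \<in> piece N i \<Longrightarrow> s i x \<in> boundaries X i \<Longrightarrow> x = 0"
    "\<And>i z. z \<in> cycles X i \<Longrightarrow> \<exists>x\<in>piece N i. z - s i x \<in> boundaries X i"
    by (rule homology_model[OF X]) blast
  have "quasi_iso (resolution N) X (res_map N X s t)"
    by (rule res_map_quasi_iso[OF N(1) DfD[OF X] N(3)]) (use N(4,5) in blast)+
  then show ?thesis
    using resolution_hproj[OF N(1)] DfD[OF X] unfolding resolves_def by blast
qed

subsection \<open>The finite derived category is preadditive\<close>

definition "resP X = fst (SOME u. resolves X (fst u) (snd u))"
definition "resq X = snd (SOME u. resolves X (fst u) (snd u))"

lemma resolves_res: "X \<in> Df \<Longrightarrow> resolves X (resP X) (resq X)"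
  unfolding resP_def resq_def
  by (rule someI_ex[where P = "\<lambda>u. resolves X (fst u) (snd u)"]) (use resolution_exists in auto)

text \<open>With the target resolved as well, composition of morphisms becomes composition of maps
  (\<open>cls_comp\<close>), and the laws of a preadditive category are inherited from maps.\<close>

definition cls :: "'v dgm \<Rightarrow> 'v dgm \<Rightarrow> (int \<Rightarrow> 'v \<Rightarrow> 'v) \<Rightarrow> 'v roof set" where
  "cls X Y f = mk X (resP X) (resq X) Y (gcomp (resq Y) f)"

abbreviation resmap :: "'v dgm \<Rightarrow> 'v dgm \<Rightarrow> (int \<Rightarrow> 'v \<Rightarrow> 'v) \<Rightarrow> bool" where
  "resmap X Y f \<equiv> dg_map (resP X) (resP Y) f"

lemma resP_module: "X \<in> Df \<Longrightarrow> dg_module (resP X)"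
  using resolvesD(2)[OF resolves_res] .

lemma cls_map: "Y \<in> Df \<Longrightarrow> resmap X Y f \<Longrightarrow> dg_map (resP X) Y (gcomp (resq Y) f)"
  using dg_map_comp[OF _ resolvesD(5)[OF resolves_res]] .

lemma cls_eq_iff:
  assumes "X \<in> Df" "Y \<in> Df" "resmap X Y f" "resmap X Y g"
  shows "cls X Y f = cls X Y g \<longleftrightarrow> homotopic (resP X) (resP Y) f g"
proof -
  note pd = resolvesD[OF resolves_res[OF assms(1)]] and pd' = resolvesD[OF resolves_res[OF assms(2)]]
  have "cls X Y f = cls X Y g \<longleftrightarrow> homotopic (resP X) Y (gcomp (resq Y) f) (gcomp (resq Y) g)"
    unfolding cls_def
    using mk_eq_iff[OF resolves_res[OF assms(1)] DfD[OF assms(2)] cls_map cls_map] assms by blast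
  also have "\<dots> \<longleftrightarrow> homotopic (resP X) (resP Y) f g"
    using hproj_unique[OF pd(3) pd'(2,1,4) assms(3,4)]
      homotopic_post_map[OF pd(2) pd'(2) _ pd'(5) assms(3,4)] by blast
  finally show ?thesis .
qed

lemma cls_cong:
  assumes "X \<in> Df" "Y \<in> Df" "resmap X Y f" "resmap X Y g" "\<And>i x. x \<in> piece (resP X) i \<Longrightarrow> f i x = g i x"
  shows "cls X Y f = cls X Y g"
  using cls_eq_iff[OF assms(1-4)] homotopic_eq[OF resP_module[OF assms(2)]] assms(5) by blast

lemma dHom_cls:
  assumes "X \<in> Df" "Y \<in> Df"
  shows "dHom X Y = {cls X Y f |f. resmap X Y f}"
proof -
  note p = resolves_res[OF assms(1)] and pd = resolvesD[OF resolves_res[OF assms(1)]]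
    and pd' = resolvesD[OF resolves_res[OF assms(2)]]
  have "\<exists>g. mk X (resP X) (resq X) Y f = cls X Y g \<and> resmap X Y g" if f: "dg_map (resP X) Y f" for f
  proof -
    obtain g where g: "resmap X Y g" "homotopic (resP X) Y (gcomp (resq Y) g) f"
      by (rule hproj_lift[OF pd(3) pd'(2,1,4) f])
    then have "mk X (resP X) (resq X) Y (gcomp (resq Y) g) = mk X (resP X) (resq X) Y f"
      using mk_eq_iff[OF p pd'(1) cls_map[OF assms(2) g(1)] f] by blast
    then show ?thesis using g(1) by (auto simp: cls_def)
  qed
  then show ?thesis
    unfolding dHom_mk[OF p pd'(1)] using cls_map[OF assms(2)] unfolding cls_def by blast
qed

lemma dHomE:
  assumes "a \<in> dHom X Y" "X \<in> Df" "Y \<in> Df"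
  obtains f where "resmap X Y f" "a = cls X Y f"
  using assms dHom_cls by blast

lemma dHom_ex: "a \<in> dHom X Y \<Longrightarrow> X \<in> Df \<Longrightarrow> Y \<in> Df \<Longrightarrow> \<exists>f. resmap X Y f \<and> a = cls X Y f"
  using dHom_cls by blast

lemma cls_in: "X \<in> Df \<Longrightarrow> Y \<in> Df \<Longrightarrow> resmap X Y f \<Longrightarrow> cls X Y f \<in> dHom X Y"
  using dHom_cls by blast

lemma cls_comp:
  assumes "X \<in> Df" "Y \<in> Df" "Z \<in> Df" "resmap X Y f" "resmap Y Z g"
  shows "cls Y Z g \<cdot> cls X Y f = cls X Z (gcomp g f)"
  unfolding cls_def gcomp_assoc[symmetric]
  by (rule comp_mk[OF resolves_res[OF assms(1)] resolves_res[OF assms(2)] DfD[OF assms(3)]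
      cls_map[OF assms(2,4)] cls_map[OF assms(3,5)] assms(4) homotopic_refl[OF DfD[OF assms(2)]]])

lemma cls_add:
  assumes "X \<in> Df" "Y \<in> Df" "resmap X Y f" "resmap X Y g"
  shows "cls X Y f \<boxplus> cls X Y g = cls X Y (\<lambda>i x. f i x + g i x)"
proof -
  note p = resolves_res[OF assms(1)] and pd' = resolvesD[OF resolves_res[OF assms(2)]]
  note Y = DfD[OF assms(2)]
  have "mk X (resP X) (resq X) Y (\<lambda>i x. gcomp (resq Y) f i x + gcomp (resq Y) g i x) =
      mk X (resP X) (resq X) Y (gcomp (resq Y) (\<lambda>i x. f i x + g i x))"
    by (subst mk_eq_iff[OF p Y dg_map_add[OF Y cls_map cls_map] cls_map[OF assms(2)
        dg_map_add[OF pd'(2)]]])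
      (use assms in \<open>auto intro!: homotopic_eq[OF Y] simp: gcomp_def map_linear[OF pd'(2,5)] map_in\<close>)
  then show ?thesis
    unfolding cls_def using add_mk[OF p Y cls_map cls_map] assms by simp
qed

lemma cls_id: "X \<in> Df \<Longrightarrow> dId X = cls X X (\<lambda>i x. x)"
  using dmor_mk[OF resolves_res DfD dg_map_id] by (simp add: dId_def cls_def)

lemma cls_zero:
  assumes "X \<in> Df" "Y \<in> Df"
  shows "dZero X Y = cls X Y (\<lambda>i x. 0)"
proof -
  note p = resolves_res[OF assms(1)] and pd' = resolvesD[OF resolves_res[OF assms(2)]]
  have "gcomp (\<lambda>i x. 0) (resq X) = gcomp (resq Y) (\<lambda>i x. 0)"
    using map_linear(1)[OF pd'(2,5)] by (simp add: gcomp_def fun_eq_iff)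
  then show ?thesis
    unfolding dZero_def cls_def
    using dmor_mk[OF p pd'(1) dg_map_zero[OF pd'(1)]] by simp
qed

lemma dComp_in: "X \<in> Df \<Longrightarrow> Y \<in> Df \<Longrightarrow> Z \<in> Df \<Longrightarrow> a \<in> dHom X Y \<Longrightarrow> b \<in> dHom Y Z \<Longrightarrow> b \<cdot> a \<in> dHom X Z"
  by (elim dHomE) (auto simp: cls_comp intro!: cls_in dg_map_comp)

lemma dAdd_in: "X \<in> Df \<Longrightarrow> Y \<in> Df \<Longrightarrow> a \<in> dHom X Y \<Longrightarrow> b \<in> dHom X Y \<Longrightarrow> a \<boxplus> b \<in> dHom X Y"
  by (elim dHomE) (auto simp: cls_add intro!: cls_in dg_map_add resP_module)

lemma dId_in: "X \<in> Df \<Longrightarrow> dId X \<in> dHom X X"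
  by (simp add: cls_id cls_in dg_map_id)

lemma dZero_in: "X \<in> Df \<Longrightarrow> Y \<in> Df \<Longrightarrow> dZero X Y \<in> dHom X Y"
  by (simp add: cls_zero cls_in dg_map_zero resP_module)

lemma dComp_assoc:
  assumes "X \<in> Df" "Y \<in> Df" "Z \<in> Df" "W \<in> Df" "a \<in> dHom X Y" "b \<in> dHom Y Z" "c \<in> dHom Z W"
  shows "c \<cdot> b \<cdot> a = c \<cdot> (b \<cdot> a)"
proof -
  obtain f g h where f: "resmap X Y f" "a = cls X Y f" and g: "resmap Y Z g" "b = cls Y Z g"
    and h: "resmap Z W h" "c = cls Z W h"
    using dHom_ex[OF assms(5,1,2)] dHom_ex[OF assms(6,2,3)] dHom_ex[OF assms(7,3,4)] by blast
  show ?thesis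
    unfolding f g h cls_comp[OF assms(1-3) f(1) g(1)] cls_comp[OF assms(2-4) g(1) h(1)]
      cls_comp[OF assms(1,2,4) f(1) dg_map_comp[OF g(1) h(1)]]
      cls_comp[OF assms(1,3,4) dg_map_comp[OF f(1) g(1)] h(1)] gcomp_assoc ..
qed

lemma dComp_id:
  assumes "X \<in> Df" "Y \<in> Df" "a \<in> dHom X Y"
  shows "a \<cdot> dId X = a" "dId Y \<cdot> a = a"
  using dHom_ex[OF assms(3,1,2)] assms(1,2) by (auto simp: cls_id cls_comp dg_map_id)

lemma dComp_add_left:
  assumes "X \<in> Df" "Y \<in> Df" "Z \<in> Df" "a \<in> dHom X Y" "b \<in> dHom Y Z" "c \<in> dHom Y Z"
  shows "(b \<boxplus> c) \<cdot> a = b \<cdot> a \<boxplus> c \<cdot> a"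
proof -
  obtain f g h where "resmap X Y f" "a = cls X Y f" "resmap Y Z g" "b = cls Y Z g"
    "resmap Y Z h" "c = cls Y Z h"
    using dHom_ex[OF assms(4,1,2)] dHom_ex[OF assms(5,2,3)] dHom_ex[OF assms(6,2,3)] by blast
  then show ?thesis
    using assms(1-3) by (simp add: cls_comp cls_add dg_map_add resP_module dg_map_comp)
        (simp add: gcomp_def)
qed

text \<open>In contrast to \<open>dComp_add_left\<close>, additivity of \<open>h\<close> enters, and
  it holds on pieces only. The two sides come from functions that agree on the pieces and may differ
  elsewhere; \<open>cls_cong\<close> absorbs this.\<close>

lemma dComp_add_right:
  assumes "X \<in> Df" "Y \<in> Df" "Z \<in> Df" "a \<in> dHom X Y" "b \<in> dHom X Y" "c \<in> dHom Y Z"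
  shows "c \<cdot> (a \<boxplus> b) = c \<cdot> a \<boxplus> c \<cdot> b"
proof -
  obtain f g h where f: "resmap X Y f" "a = cls X Y f" "resmap X Y g" "b = cls X Y g"
    "resmap Y Z h" "c = cls Y Z h"
    using dHom_ex[OF assms(4,1,2)] dHom_ex[OF assms(5,1,2)] dHom_ex[OF assms(6,2,3)] by blast
  have "cls X Z (gcomp h (\<lambda>i x. f i x + g i x)) = cls X Z (\<lambda>i x. gcomp h f i x + gcomp h g i x)"
  proof (rule cls_cong[OF assms(1,3)])
    show "resmap X Z (gcomp h (\<lambda>i x. f i x + g i x))"
      by (rule dg_map_comp[OF dg_map_add[OF resP_module[OF assms(2)] f(1,3)] f(5)])
    show "resmap X Z (\<lambda>i x. gcomp h f i x + gcomp h g i x)"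
      by (rule dg_map_add[OF resP_module[OF assms(3)] dg_map_comp[OF f(1,5)] dg_map_comp[OF f(3,5)]])
    show "gcomp h (\<lambda>i x. f i x + g i x) i x = gcomp h f i x + gcomp h g i x"
      if "x \<in> piece (resP X) i" for i x
      using map_linear(2)[OF resP_module[OF assms(2)] f(5) map_in[OF f(1) that] map_in[OF f(3) that]]
      by (simp add: gcomp_def)
  qed
  then show ?thesis
    using assms(1-3) f by (simp add: cls_comp cls_add dg_map_add resP_module dg_map_comp)
qed

lemma dAdd_commute:
  assumes "X \<in> Df" "Y \<in> Df" "a \<in> dHom X Y" "b \<in> dHom X Y"
  shows "a \<boxplus> b = b \<boxplus> a"
proof -
  obtain f g where "resmap X Y f" "a = cls X Y f" "resmap X Y g" "b = cls X Y g"
    using dHom_ex[OF assms(3,1,2)] dHom_ex[OF assms(4,1,2)] by blast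
  then show ?thesis using assms(1,2) by (simp add: cls_add add.commute)
qed

lemma dAdd_zero:
  assumes "X \<in> Df" "Y \<in> Df" "a \<in> dHom X Y"
  shows "a \<boxplus> dZero X Y = a" "dZero X Y \<boxplus> a = a"
  using dHom_ex[OF assms(3,1,2)] assms(1,2)
  by (auto simp: cls_zero cls_add dg_map_zero resP_module)

lemma dComp_zero:
  assumes "X \<in> Df" "Y \<in> Df" "Z \<in> Df"
  shows "a \<in> dHom X Y \<Longrightarrow> dZero Y Z \<cdot> a = dZero X Z" "b \<in> dHom Y Z \<Longrightarrow> b \<cdot> dZero X Y = dZero X Z"
proof -
  show "dZero Y Z \<cdot> a = dZero X Z" if a: "a \<in> dHom X Y"
  proof -
    obtain f where "resmap X Y f" "a = cls X Y f" using dHom_ex[OF a assms(1,2)] by blast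
    moreover have "gcomp (\<lambda>i x. 0) f = (\<lambda>i x. 0)" by (simp add: gcomp_def)
    ultimately show ?thesis
      using assms by (simp add: cls_zero cls_comp dg_map_zero resP_module)
  qed
  show "b \<cdot> dZero X Y = dZero X Z" if b: "b \<in> dHom Y Z"
  proof -
    obtain f where f: "resmap Y Z f" "b = cls Y Z f" using dHom_ex[OF b assms(2,3)] by blast
    have "gcomp f (\<lambda>i x. 0) = (\<lambda>i x. 0)"
      using map_linear(1)[OF resP_module[OF assms(2)] f(1)] by (simp add: gcomp_def)
    then show ?thesis
      using assms f by (simp add: cls_zero cls_comp dg_map_zero resP_module)
  qed
qed

lemma dmor_in:
  assumes "X \<in> Df" "Y \<in> Df" "dg_map X Y f"
  shows "dmor X Y f \<in> dHom X Y"
  using dmor_mk[OF resolves_res[OF assms(1)] DfD[OF assms(2)] assms(3)]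
    dHom_mk[OF resolves_res[OF assms(1)] DfD[OF assms(2)]]
    dg_map_comp[OF resolvesD(5)[OF resolves_res[OF assms(1)]] assms(3)] by auto

lemma dmor_cong:
  assumes "X \<in> Df" "Y \<in> Df" "dg_map X Y f" "dg_map X Y g" "\<And>i x. x \<in> piece X i \<Longrightarrow> f i x = g i x"
  shows "dmor X Y f = dmor X Y g"
proof -
  note p = resolves_res[OF assms(1)] note pd = resolvesD[OF p] note Y = DfD[OF assms(2)]
  have "homotopic (resP X) Y (gcomp f (resq X)) (gcomp g (resq X))"
    by (rule homotopic_eq[OF Y]) (simp add: gcomp_def assms(5) map_in[OF pd(5)])
  then show ?thesis
    using dmor_mk[OF p Y] mk_eq_iff[OF p Y dg_map_comp[OF pd(5)] dg_map_comp[OF pd(5)]] assms(3,4)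
        by simp
qed

lemma dmor_comp:
  assumes "X \<in> Df" "Y \<in> Df" "Z \<in> Df" "dg_map X Y f" "dg_map Y Z g"
  shows "dmor Y Z g \<cdot> dmor X Y f = dmor X Z (gcomp g f)"
proof -
  note p = resolves_res[OF assms(1)] and p' = resolves_res[OF assms(2)]
  note pd = resolvesD[OF p] and pd' = resolvesD[OF p'] and Y = DfD[OF assms(2)] and Z = DfD[OF assms(3)]
  have fq: "dg_map (resP X) Y (gcomp f (resq X))" using dg_map_comp[OF pd(5) assms(4)] .
  have gq: "dg_map (resP Y) Z (gcomp g (resq Y))" using dg_map_comp[OF pd'(5) assms(5)] .
  obtain k where k: "dg_map (resP X) (resP Y) k" "homotopic (resP X) Y (gcomp (resq Y) k)
      (gcomp f (resq X))"
    by (rule hproj_lift[OF pd(3) pd'(2,1,4) fq])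
  have "homotopic (resP X) Z (gcomp g (gcomp (resq Y) k)) (gcomp g (gcomp f (resq X)))"
    by (rule homotopic_post_map[OF pd(2) Y k(2) assms(5) dg_map_comp[OF k(1) pd'(5)] fq])
  then have "mk X (resP X) (resq X) Z (gcomp (gcomp g (resq Y)) k) =
      mk X (resP X) (resq X) Z (gcomp (gcomp g f) (resq X))"
    using mk_eq_iff[OF p Z dg_map_comp[OF k(1) gq] dg_map_comp[OF pd(5) dg_map_comp[OF assms(4,5)]]]
    by (simp add: gcomp_assoc)
  then show ?thesis
    using comp_mk[OF p p' Z fq gq k] dmor_mk[OF p Y assms(4)] dmor_mk[OF p' Z assms(5)]
      dmor_mk[OF p Z dg_map_comp[OF assms(4,5)]] by simp
qed

lemma dmor_add:
  assumes "X \<in> Df" "Y \<in> Df" "dg_map X Y f" "dg_map X Y g"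
  shows "dmor X Y f \<boxplus> dmor X Y g = dmor X Y (\<lambda>i x. f i x + g i x)"
proof -
  note p = resolves_res[OF assms(1)] note pd = resolvesD[OF p] note Y = DfD[OF assms(2)]
  have "(\<lambda>i x. gcomp f (resq X) i x + gcomp g (resq X) i x) = gcomp (\<lambda>i x. f i x + g i x) (resq X)"
    by (simp add: gcomp_def)
  then show ?thesis
    using add_mk[OF p Y dg_map_comp[OF pd(5)] dg_map_comp[OF pd(5)]] assms
      dmor_mk[OF p Y] dg_map_add[OF Y assms(3,4)] by simp
qed

text \<open>\<open>W\<close> resolves both objects, so \<open>q'\<close> represents a morphism from
  \<open>X\<close> to \<open>Y\<close> and \<open>q\<close> one back; their composites are computed
  with the identity of \<open>W\<close> as the lift.\<close>

lemma zigzag_isomorphic: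
  assumes X: "X \<in> Df" and Y: "Y \<in> Df" and W: "hproj W" and q: "quasi_iso W X q" "quasi_iso W Y q'"
  shows "isomorphic X Y"
proof -
  have p: "resolves X W q" "resolves Y W q'"
    using assms DfD by (auto simp: resolves_def)
  note pd = resolvesD[OF p(1)] and pd' = resolvesD[OF p(2)]
  have "mk Y W q' X q \<cdot> mk X W q Y q' = mk X W q X q"
    using comp_mk[OF p(1,2) pd(1) pd'(5) pd(5) dg_map_id] homotopic_refl[OF pd'(1)] by simp
  moreover have "mk X W q Y q' \<cdot> mk Y W q' X q = mk Y W q' Y q'"
    using comp_mk[OF p(2,1) pd'(1) pd(5) pd'(5) dg_map_id] homotopic_refl[OF pd(1)] by simp
  moreover have "dId X = mk X W q X q" "dId Y = mk Y W q' Y q'"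
    using dmor_mk[OF p(1) pd(1) dg_map_id] dmor_mk[OF p(2) pd'(1) dg_map_id] by (simp_all add: dId_def)
  moreover have "mk X W q Y q' \<in> dHom X Y" "mk Y W q' X q \<in> dHom Y X"
    using dHom_mk[OF p(1) pd'(1)] dHom_mk[OF p(2) pd(1)] pd(5) pd'(5) by blast+
  ultimately show ?thesis
    unfolding isomorphic_def iso_mor_def by metis
qed

lemma zero_diff_resolves:
  assumes N: "zero_diff N"
  shows "htmap N N (\<lambda>i x. x) (\<lambda>i x. 0)"
    and "resolves N (resolution N) (res_map N N (\<lambda>i x. x) (\<lambda>i x. 0))"
proof -
  note M = zero_diff_module[OF N]
  show ht: "htmap N N (\<lambda>i x. x) (\<lambda>i x. 0)"
    unfolding htmap_def by (auto simp: zero_diff_homology[OF N]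
        lin_on_ident lin_on_const0 piece_closed[OF M] diff_linear[OF M])
  show "resolves N (resolution N) (res_map N N (\<lambda>i x. x) (\<lambda>i x. 0))"
    unfolding resolves_def
    by (intro conjI M resolution_hproj[OF N] res_map_quasi_iso[OF N M ht])
      (auto simp: zero_diff_homology[OF N])
qed

lemma formality:
  assumes X: "X \<in> Df"
  obtains N where "zero_diff N" "N \<in> Df" "isomorphic X N"
proof -
  obtain N s t where N: "zero_diff N" "N \<in> Df" "htmap N X s t"
    "\<And>i x. x \<in> piece N i \<Longrightarrow> s i x \<in> boundaries X i \<Longrightarrow> x = 0"
    "\<And>i z. z \<in> cycles X i \<Longrightarrow> \<exists>x\<in>piece N i. z - s i x \<in> boundaries X i"
    by (rule homology_model[OF X]) blast
  have "quasi_iso (resolution N) X (res_map N X s t)"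
    by (rule res_map_quasi_iso[OF N(1) DfD[OF X] N(3)]) (use N(4,5) in blast)+
  then have "isomorphic X N"
    by (rule zigzag_isomorphic[OF X N(2) resolution_hproj[OF N(1)] _
          resolvesD(4)[OF zero_diff_resolves(2)[OF N(1)]]])
  then show thesis using that N by blast
qed

text \<open>Domains and codomains as functions of the morphism, so that the simplifier can check that
  morphisms are composable.\<close>

definition dm :: "'v roof set \<Rightarrow> 'v dgm" where "dm a = src (SOME r. r \<in> a)"
definition cd :: "'v roof set \<Rightarrow> 'v dgm" where "cd a = tgt (SOME r. r \<in> a)"
definition arr :: "'v roof set \<Rightarrow> bool" where
  "arr a \<longleftrightarrow> dm a \<in> Df \<and> cd a \<in> Df \<and> a \<in> dHom (dm a) (cd a)"

lemma dHom_dm_cd: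
  assumes "a \<in> dHom X Y" "X \<in> Df" "Y \<in> Df"
  shows "arr a" "dm a = X" "cd a = Y"
proof -
  note p = resolves_res[OF assms(2)] and Y = DfD[OF assms(3)]
  obtain f where f: "dg_map (resP X) Y f" "a = mk X (resP X) (resq X) Y f"
    using assms(1) unfolding dHom_mk[OF p Y] by blast
  have "\<lparr> src = X, apex = resP X, tgt = Y, bwd = resq X, fwd = f \<rparr> \<in> a"
    unfolding f(2) mk_eq[OF p Y f(1)] using roof_mk[OF p Y f(1)] by simp
  then have "(SOME r. r \<in> a) \<in> a" by (rule someI)
  then have "(SOME r. r \<in> a) \<in> {r. is_roof r \<and> src r = X \<and> tgt r = Y \<and> rep r (resP X) (resq X) f}"
    unfolding mk_eq[OF p Y f(1), folded f(2), symmetric] .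
  then show "dm a = X" "cd a = Y"
    unfolding dm_def cd_def by blast+
  with assms show "arr a" by (simp add: arr_def)
qed

lemma arr_iff: "X \<in> Df \<Longrightarrow> Y \<in> Df \<Longrightarrow> a \<in> dHom X Y \<longleftrightarrow> arr a \<and> dm a = X \<and> cd a = Y"
  by (rule iffI, simp add: dHom_dm_cd) (elim conjE, simp add: arr_def)

lemma arrD [simp]: "arr a \<Longrightarrow> dm a \<in> Df" "arr a \<Longrightarrow> cd a \<in> Df"
    "arr a \<Longrightarrow> dm a = X \<Longrightarrow> cd a = Y \<Longrightarrow> a \<in> dHom X Y"
  by (auto simp: arr_def)

lemma comp_arr [simp]:
  assumes "arr a" "arr b" "cd a = dm b"
  shows "arr (b \<cdot> a)" "dm (b \<cdot> a) = dm a" "cd (b \<cdot> a) = cd b"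
proof -
  have "b \<cdot> a \<in> dHom (dm a) (cd b)"
    by (rule dComp_in[of "dm a" "cd a" "cd b"]) (use assms in simp_all)
  from dHom_dm_cd[OF this arrD(1)[OF assms(1)] arrD(2)[OF assms(2)]]
  show "arr (b \<cdot> a)" "dm (b \<cdot> a) = dm a" "cd (b \<cdot> a) = cd b" .
qed

lemma comp_assoc [simp]:
  "arr a \<Longrightarrow> arr b \<Longrightarrow> arr c \<Longrightarrow> cd a = dm b \<Longrightarrow> cd b = dm c \<Longrightarrow> c \<cdot> b \<cdot> a = c \<cdot> (b \<cdot> a)"
  by (rule dComp_assoc[of "dm a" "cd a" "cd b" "cd c"]) simp_all

lemma id_arr [simp]: "X \<in> Df \<Longrightarrow> arr (dId X)" "X \<in> Df \<Longrightarrow> dm (dId X) = X" "X \<in> Df \<Longrightarrow> cd (dId X) = X"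
  using dHom_dm_cd[OF dId_in] by auto

lemma zero_arr [simp]:
  "X \<in> Df \<Longrightarrow> Y \<in> Df \<Longrightarrow> arr (dZero X Y)" "X \<in> Df \<Longrightarrow> Y \<in> Df \<Longrightarrow> dm (dZero X Y) = X"
  "X \<in> Df \<Longrightarrow> Y \<in> Df \<Longrightarrow> cd (dZero X Y) = Y"
  using dHom_dm_cd[OF dZero_in] by auto

lemma add_arr [simp]:
  assumes "arr a" "arr b" "dm a = dm b" "cd a = cd b"
  shows "arr (a \<boxplus> b)" "dm (a \<boxplus> b) = dm b" "cd (a \<boxplus> b) = cd b"
proof -
  have "a \<boxplus> b \<in> dHom (dm b) (cd b)"
    by (rule dAdd_in) (use assms in simp_all)
  from dHom_dm_cd[OF this arrD(1)[OF assms(2)] arrD(2)[OF assms(2)]]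
  show "arr (a \<boxplus> b)" "dm (a \<boxplus> b) = dm b" "cd (a \<boxplus> b) = cd b" .
qed

lemma comp_id [simp]: "arr a \<Longrightarrow> X = dm a \<Longrightarrow> a \<cdot> dId X = a" "arr a \<Longrightarrow> X = cd a \<Longrightarrow> dId X \<cdot> a = a"
  using dComp_id[of "dm a" "cd a" a] by simp_all

lemma comp_zero [simp]:
  "arr a \<Longrightarrow> Z \<in> Df \<Longrightarrow> cd a = Y \<Longrightarrow> dZero Y Z \<cdot> a = dZero (dm a) Z"
  "arr b \<Longrightarrow> X \<in> Df \<Longrightarrow> dm b = Y \<Longrightarrow> b \<cdot> dZero X Y = dZero X (cd b)"
  using dComp_zero(1)[of "dm a" "cd a" Z a] dComp_zero(2)[of X "dm b" "cd b" b] by auto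

lemma add_zero [simp]:
  "arr a \<Longrightarrow> dm a = X \<Longrightarrow> cd a = Y \<Longrightarrow> a \<boxplus> dZero X Y = a"
  "arr a \<Longrightarrow> dm a = X \<Longrightarrow> cd a = Y \<Longrightarrow> dZero X Y \<boxplus> a = a"
  using dAdd_zero[of "dm a" "cd a" a] by auto

lemma comp_add_right:
  assumes "arr a" "arr b" "arr c" "dm a = dm b" "cd a = cd b" "cd b = dm c"
  shows "c \<cdot> (a \<boxplus> b) = c \<cdot> a \<boxplus> c \<cdot> b"
  using dComp_add_right[of "dm b" "cd b" "cd c" a b c] assms by simp

lemma comp_add_left:
  assumes "arr a" "arr b" "arr c" "dm b = dm c" "cd b = cd c" "cd a = dm b"
  shows "(b \<boxplus> c) \<cdot> a = b \<cdot> a \<boxplus> c \<cdot> a"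
  using dComp_add_left[of "dm a" "cd a" "cd c" a b c] assms by simp

text \<open>Simplification brings composites to right-nested form, in which an equation for
  \<open>p \<cdot> i\<close> no longer matches. This is its form for use inside a longer
  composite.\<close>

lemma comp_reduce:
  assumes "p \<cdot> i = e" "arr p" "arr i" "cd i = dm p" "arr x" "cd x = dm i"
  shows "p \<cdot> (i \<cdot> x) = e \<cdot> x"
  using comp_assoc[of x i p] assms by simp

lemma zero_objectD:
  assumes "zero_object Z"
  shows "Z \<in> Df" "arr a \<Longrightarrow> cd a = Z \<Longrightarrow> a = dZero (dm a) Z" "arr b \<Longrightarrow> dm b = Z \<Longrightarrow> b = dZero Z (cd b)"
proof -
  have Z: "Z \<in> Df" "dId Z = dZero Z Z" using assms by (simp_all add: zero_object_def)
  show "Z \<in> Df" by fact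
  show "a = dZero (dm a) Z" if a: "arr a" "cd a = Z"
  proof -
    have "a = dId Z \<cdot> a" using a by simp
    also have "\<dots> = dZero (dm a) Z" unfolding Z(2) using a Z(1) by simp
    finally show ?thesis .
  qed
  show "b = dZero Z (cd b)" if b: "arr b" "dm b = Z"
  proof -
    have "b = b \<cdot> dId Z" using b by simp
    also have "\<dots> = dZero Z (cd b)" unfolding Z(2) using b Z(1) by simp
    finally show ?thesis .
  qed
qed

lemma isomorphicE:
  assumes "isomorphic X Y" "X \<in> Df" "Y \<in> Df"
  obtains f g where "arr f" "dm f = X" "cd f = Y" "arr g" "dm g = Y" "cd g = X"
    "g \<cdot> f = dId X" "f \<cdot> g = dId Y"
  using assms unfolding isomorphic_def iso_mor_def by (auto simp: arr_iff)

lemma isomorphicI: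
  assumes "arr f" "dm f = X" "cd f = Y" "arr g" "dm g = Y" "cd g = X" "g \<cdot> f = dId X" "f \<cdot> g = dId Y"
  shows "isomorphic X Y"
proof -
  have "X \<in> Df" "Y \<in> Df" using arrD(1)[OF assms(1)] arrD(2)[OF assms(1)] assms by simp_all
  then show ?thesis unfolding isomorphic_def iso_mor_def using assms arr_iff by blast
qed

lemma isomorphic_refl: "X \<in> Df \<Longrightarrow> isomorphic X X"
  by (rule isomorphicI[of "dId X" _ _ "dId X"]) simp_all

lemma isomorphic_sym:
  assumes "isomorphic X Y" "X \<in> Df" "Y \<in> Df"
  shows "isomorphic Y X"
proof -
  obtain f g where "arr f" "dm f = X" "cd f = Y" "arr g" "dm g = Y" "cd g = X"
    "g \<cdot> f = dId X" "f \<cdot> g = dId Y" by (rule isomorphicE[OF assms])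
  then show ?thesis by (intro isomorphicI[of g _ _ f])
qed

lemma isomorphic_trans:
  assumes "isomorphic X Y" "isomorphic Y Z" "X \<in> Df" "Y \<in> Df" "Z \<in> Df"
  shows "isomorphic X Z"
proof -
  obtain f g where f: "arr f" "dm f = X" "cd f = Y" "arr g" "dm g = Y" "cd g = X"
    "g \<cdot> f = dId X" "f \<cdot> g = dId Y" by (rule isomorphicE[OF assms(1,3,4)])
  obtain h k where h: "arr h" "dm h = Y" "cd h = Z" "arr k" "dm k = Z" "cd k = Y"
    "k \<cdot> h = dId Y" "h \<cdot> k = dId Z" by (rule isomorphicE[OF assms(2,4,5)])
  show ?thesis
    by (rule isomorphicI[of "h \<cdot> f" _ _ "g \<cdot> k"])
      (use f h comp_reduce[OF f(8)] comp_reduce[OF h(7)] in simp_all)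
qed

section \<open>Biproducts\<close>

definition biprod where
  "biprod S A B i1 i2 q1 q2 \<longleftrightarrow> S \<in> Df \<and> A \<in> Df \<and> B \<in> Df \<and>
     arr i1 \<and> dm i1 = A \<and> cd i1 = S \<and> arr i2 \<and> dm i2 = B \<and> cd i2 = S \<and>
     arr q1 \<and> dm q1 = S \<and> cd q1 = A \<and> arr q2 \<and> dm q2 = S \<and> cd q2 = B \<and>
     q1 \<cdot> i1 = dId A \<and> q2 \<cdot> i2 = dId B \<and> q1 \<cdot> i2 = dZero B A \<and> q2 \<cdot> i1 = dZero A B \<and>
     i1 \<cdot> q1 \<boxplus> i2 \<cdot> q2 = dId S"

lemma direct_sum_iff:
  assumes "S \<in> Df" "A \<in> Df" "B \<in> Df"
  shows "direct_sum S A B \<longleftrightarrow> (\<exists>i1 i2 q1 q2. biprod S A B i1 i2 q1 q2)"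
  unfolding direct_sum_def biprod_def using assms by (auto simp: arr_iff Bex_def)

lemma biprodD:
  assumes "biprod S A B i1 i2 q1 q2"
  shows "S \<in> Df" "A \<in> Df" "B \<in> Df" "arr i1" "dm i1 = A" "cd i1 = S" "arr i2" "dm i2 = B" "cd i2 = S"
    "arr q1" "dm q1 = S" "cd q1 = A" "arr q2" "dm q2 = S" "cd q2 = B"
    "q1 \<cdot> i1 = dId A" "q2 \<cdot> i2 = dId B" "q1 \<cdot> i2 = dZero B A" "q2 \<cdot> i1 = dZero A B"
    "i1 \<cdot> q1 \<boxplus> i2 \<cdot> q2 = dId S"
  using assms by (simp_all add: biprod_def)

lemma biprod_expand:
  assumes "biprod S A B i1 i2 q1 q2"
  shows "arr x \<Longrightarrow> cd x = S \<Longrightarrow> x = i1 \<cdot> (q1 \<cdot> x) \<boxplus> i2 \<cdot> (q2 \<cdot> x)"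
    and "arr y \<Longrightarrow> dm y = S \<Longrightarrow> y = y \<cdot> i1 \<cdot> q1 \<boxplus> y \<cdot> i2 \<cdot> q2"
proof -
  note b = biprodD[OF assms]
  show "x = i1 \<cdot> (q1 \<cdot> x) \<boxplus> i2 \<cdot> (q2 \<cdot> x)" if x: "arr x" "cd x = S"
  proof -
    have "x = (i1 \<cdot> q1 \<boxplus> i2 \<cdot> q2) \<cdot> x" using b x by simp
    also have "\<dots> = i1 \<cdot> (q1 \<cdot> x) \<boxplus> i2 \<cdot> (q2 \<cdot> x)"
      by (subst comp_add_left) (use b(1-15) x in simp_all)
    finally show ?thesis .
  qed
  show "y = y \<cdot> i1 \<cdot> q1 \<boxplus> y \<cdot> i2 \<cdot> q2" if y: "arr y" "dm y = S"
  proof -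
    have "y = y \<cdot> (i1 \<cdot> q1 \<boxplus> i2 \<cdot> q2)" using b y by simp
    also have "\<dots> = y \<cdot> i1 \<cdot> q1 \<boxplus> y \<cdot> i2 \<cdot> q2"
      by (subst comp_add_right) (use b(1-15) y in simp_all)
    finally show ?thesis .
  qed
qed

lemma direct_sum_iso_sum:
  assumes "direct_sum S A B" "isomorphic S S'" "S \<in> Df" "S' \<in> Df" "A \<in> Df" "B \<in> Df"
  shows "direct_sum S' A B"
proof -
  obtain i1 i2 q1 q2 where bp: "biprod S A B i1 i2 q1 q2" using assms direct_sum_iff by blast
  note b = biprodD[OF bp]
  obtain f g where f: "arr f" "dm f = S" "cd f = S'" "arr g" "dm g = S'" "cd g = S"
    "g \<cdot> f = dId S" "f \<cdot> g = dId S'" by (rule isomorphicE[OF assms(2-4)])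
  note r = comp_reduce[OF f(7)]
  have "f \<cdot> (i1 \<cdot> (q1 \<cdot> g)) \<boxplus> f \<cdot> (i2 \<cdot> (q2 \<cdot> g)) = f \<cdot> (i1 \<cdot> (q1 \<cdot> g) \<boxplus> i2 \<cdot> (q2 \<cdot> g))"
    by (subst comp_add_right) (use b(1-15) f(1-6) in simp_all)
  also have "\<dots> = dId S'"
    using biprod_expand(1)[OF bp f(4,6)] f(8) by simp
  finally have "biprod S' A B (f \<cdot> i1) (f \<cdot> i2) (q1 \<cdot> g) (q2 \<cdot> g)"
    unfolding biprod_def using b(1-19) f assms(4) by (simp add: r)
  then show ?thesis using direct_sum_iff assms by blast
qed

lemma direct_sum_iso_left:
  assumes "direct_sum S A B" "isomorphic A A'" "S \<in> Df" "A \<in> Df" "B \<in> Df" "A' \<in> Df"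
  shows "direct_sum S A' B"
proof -
  obtain i1 i2 q1 q2 where bp: "biprod S A B i1 i2 q1 q2" using assms direct_sum_iff by blast
  note b = biprodD[OF bp]
  obtain f g where f: "arr f" "dm f = A" "cd f = A'" "arr g" "dm g = A'" "cd g = A"
    "g \<cdot> f = dId A" "f \<cdot> g = dId A'" by (rule isomorphicE[OF assms(2,4,6)])
  have "biprod S A' B (i1 \<cdot> g) i2 (f \<cdot> q1) q2"
    unfolding biprod_def using b f assms(6)
    by (simp add: comp_reduce[OF f(7)] comp_reduce[OF b(16)] comp_reduce[OF b(19)])
  then show ?thesis using direct_sum_iff assms by blast
qed

lemma direct_sum_commute:
  assumes "direct_sum S A B" "S \<in> Df" "A \<in> Df" "B \<in> Df"
  shows "direct_sum S B A"
proof -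
  obtain i1 i2 q1 q2 where bp: "biprod S A B i1 i2 q1 q2" using assms direct_sum_iff by blast
  note b = biprodD[OF bp]
  have "i2 \<cdot> q2 \<boxplus> i1 \<cdot> q1 = i1 \<cdot> q1 \<boxplus> i2 \<cdot> q2"
    by (rule dAdd_commute[of S S]) (use b(1-15) in \<open>simp_all add: arr_iff\<close>)
  then have "biprod S B A i2 i1 q2 q1" using b by (simp add: biprod_def)
  then show ?thesis using direct_sum_iff assms by blast
qed

lemma direct_sum_zero:
  assumes "zero_object Z" "isomorphic S A" "S \<in> Df" "A \<in> Df"
  shows "direct_sum S A Z"
proof -
  obtain f g where f: "arr f" "dm f = S" "cd f = A" "arr g" "dm g = A" "cd g = S"
    "g \<cdot> f = dId S" "f \<cdot> g = dId A" by (rule isomorphicE[OF assms(2-4)])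
  have Z: "Z \<in> Df" "dId Z = dZero Z Z" using assms(1) by (simp_all add: zero_object_def)
  have "biprod S A Z g (dZero Z S) f (dZero S Z)"
    unfolding biprod_def using f Z assms by simp
  then show ?thesis using direct_sum_iff assms Z by blast
qed

lemma direct_sum_zero_iso:
  assumes "direct_sum S A B" "zero_object B" "S \<in> Df" "A \<in> Df"
  shows "isomorphic S A"
proof -
  have B: "B \<in> Df" using zero_objectD(1)[OF assms(2)] .
  obtain i1 i2 q1 q2 where bp: "biprod S A B i1 i2 q1 q2" using assms B direct_sum_iff by blast
  note b = biprodD[OF bp]
  have "q2 = dZero S B" using zero_objectD(2)[OF assms(2), of q2] b by simp
  then have "i1 \<cdot> q1 = dId S" using b by simp
  then show ?thesis by (intro isomorphicI[of q1 _ _ i1]) (use b in simp_all)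
qed

lemma zero_object_iso:
  assumes "zero_object X" "isomorphic X Y" "Y \<in> Df"
  shows "zero_object Y"
proof -
  have X: "X \<in> Df" using assms zero_objectD by blast
  obtain f g where f: "arr f" "dm f = X" "cd f = Y" "arr g" "dm g = Y" "cd g = X"
    "g \<cdot> f = dId X" "f \<cdot> g = dId Y" by (rule isomorphicE[OF assms(2) X assms(3)])
  have "f = dZero X Y" using zero_objectD(3)[OF assms(1), of f] f by simp
  moreover have "dZero X Y \<cdot> g = dZero Y Y" using f(4-6) X assms(3) by simp
  ultimately have "dId Y = dZero Y Y" using f(8) by simp
  then show ?thesis using assms(3) by (simp add: zero_object_def)
qed

subsection \<open>Morphisms between modules with zero differential\<close>

definition rmor ::
  "'v dgm \<Rightarrow> 'v dgm \<Rightarrow> (int \<Rightarrow> 'v \<Rightarrow> 'v) \<Rightarrow> (int \<Rightarrow> 'v \<Rightarrow> 'v) \<Rightarrow> 'v roof set" where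
  "rmor N N' s t = mk N (resolution N) (res_map N N (\<lambda>i x. x) (\<lambda>i x. 0)) N' (res_map N N' s t)"

lemma homotopic_generators:
  assumes "zero_diff N" "dg_module Y" "dg_map (resolution N) Y f" "dg_map (resolution N) Y g"
    "\<And>i x. x \<in> piece N i \<Longrightarrow> f i (e0 x) = g i (e0 x)"
    "\<And>i x. x \<in> piece N i \<Longrightarrow> f (i + 2) (e1 x) = g (i + 2) (e1 x)"
  shows "homotopic (resolution N) Y f g"
  by (rule homotopic_resolutionI[OF assms(1-4), of "\<lambda>i x. 0" "\<lambda>i x. 0"])
    (use assms in \<open>auto simp: piece_closed lin_on_const0 diff_linear act_linear\<close>)

lemma dHom_rmor:
  assumes N: "zero_diff N" and Y: "zero_diff Y"
  shows "dHom N Y = {rmor N Y s t |s t. htmap N Y s t}"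
proof -
  note p = zero_diff_resolves(2)[OF N] and M = zero_diff_module[OF Y]
  have "\<exists>s t. mk N (resolution N) (res_map N N (\<lambda>i x. x) (\<lambda>i x. 0)) Y f = rmor N Y s t \<and> htmap N Y s t"
    if f: "dg_map (resolution N) Y f" for f
  proof -
    have ht: "htmap N Y (\<lambda>i x. f i (e0 x)) (\<lambda>i x. f (i + 2) (e1 x))"
      by (rule dg_map_htmap[OF N M f])
    have "homotopic (resolution N) Y f (res_map N Y (\<lambda>i x. f i (e0 x)) (\<lambda>i x. f (i + 2) (e1 x)))"
      by (rule homotopic_generators[OF N M f res_map_dg_map[OF N M ht]])
        (simp_all add: res_map_generators[OF N M ht])
    then show ?thesis
      using mk_eq_iff[OF p M f res_map_dg_map[OF N M ht]] ht unfolding rmor_def by blast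
  qed
  then show ?thesis
    unfolding dHom_mk[OF p M] using res_map_dg_map[OF N M] unfolding rmor_def by blast
qed

lemma htmap_commute:
  assumes "htmap N Y s t" "zero_diff Y" "x \<in> piece N i"
  shows "act Y i (s i x) = s (i + 1) (act N i x)"
  using htmapD(7)[OF assms(1,3)] htmapD(5)[OF assms(1,3)] zero_diff_diff[OF assms(2)] by simp

lemma htmapI:
  assumes "zero_diff Y" "\<And>i x. x \<in> piece N i \<Longrightarrow> s i x \<in> piece Y i" "\<And>i. lin_on (piece N i) (s i)"
    "\<And>i x. x \<in> piece N i \<Longrightarrow> t i x \<in> piece Y (i + 2)" "\<And>i. lin_on (piece N i) (t i)"
    "\<And>i x. x \<in> piece N i \<Longrightarrow> act Y i (s i x) = s (i + 1) (act N i x)"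
  shows "htmap N Y s t"
  unfolding htmap_def using assms by (simp add: zero_diff_homology zero_diff_diff)

text \<open>Homotopies on the resolution lose all terms with a differential of \<open>Y\<close>: the
  equation on \<open>e0\<close> makes \<open>s\<close> rigid, and on \<open>e1\<close> only the
  commutator of T with the component \<open>p\<close> is left.\<close>

lemma rmor_eq_iff:
  assumes N: "zero_diff N" and Y: "zero_diff Y" and ht: "htmap N Y s t" and ht': "htmap N Y s' t'"
  shows "rmor N Y s t = rmor N Y s' t' \<longleftrightarrow>
    (\<forall>i. \<forall>x\<in>piece N i. s i x = s' i x) \<and>
    (\<exists>p. \<forall>i. lin_on (piece N i) (p i) \<and> (\<forall>x\<in>piece N i. p i x \<in> piece Y (i + 1) \<and>
       t i x - t' i x = act Y (i + 1) (p i x) - p (i + 1) (act N i x)))"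
    (is "?l \<longleftrightarrow> ?r")
proof -
  note M = zero_diff_module[OF Y] and NM = zero_diff_module[OF N]
  note g = res_map_generators[OF N M ht] and g' = res_map_generators[OF N M ht']
  note m = res_map_dg_map[OF N M ht] and m' = res_map_dg_map[OF N M ht']
  have "?l \<longleftrightarrow> homotopic (resolution N) Y (res_map N Y s t) (res_map N Y s' t')"
    unfolding rmor_def by (rule mk_eq_iff[OF zero_diff_resolves(2)[OF N] M m m'])
  also have "\<dots> \<longleftrightarrow> ?r"
  proof
    assume h: "homotopic (resolution N) Y (res_map N Y s t) (res_map N Y s' t')"
    show ?r
    proof (rule homotopic_resolutionE[OF N M h])
      fix p q
      assume p: "\<And>i x. x \<in> piece N i \<Longrightarrow> p i x \<in> piece Y (i + 1)" "\<And>i. lin_on (piece N i) (p i)"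
        and q: "\<And>i x. x \<in> piece N i \<Longrightarrow> q i x \<in> piece Y (i + 3)"
        and 0: "\<And>i x. x \<in> piece N i \<Longrightarrow> res_map N Y s t i (e0 x) - res_map N Y s' t' i (e0 x)
            = diff Y (i + 1) (p i x)"
        and 1: "\<And>i x. x \<in> piece N i \<Longrightarrow> res_map N Y s t (i + 2) (e1 x) - res_map N Y s' t' (i + 2)
            (e1 x) =
          diff Y (i + 3) (q i x) + act Y (i + 1) (p i x) - p (i + 1) (act N i x)"
      have "s i x = s' i x" if "x \<in> piece N i" for i x
        using 0[OF that] g(1)[OF that] g'(1)[OF that] zero_diff_diff[OF Y p(1)[OF that]] by simp
      moreover have "t i x - t' i x = act Y (i + 1) (p i x) - p (i + 1) (act N i x)"
          if "x \<in> piece N i" for i x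
        using 1[OF that] g(2)[OF that] g'(2)[OF that] zero_diff_diff[OF Y q[OF that]] by simp
      ultimately show ?r using p by blast
    qed
  next
    assume ?r
    then obtain p where p: "\<And>i. lin_on (piece N i) (p i)" "\<And>i x. x \<in> piece N i \<Longrightarrow>
        p i x \<in> piece Y (i + 1)"
      "\<And>i x. x \<in> piece N i \<Longrightarrow> t i x - t' i x = act Y (i + 1) (p i x) - p (i + 1) (act N i x)"
      and s: "\<And>i x. x \<in> piece N i \<Longrightarrow> s i x = s' i x" by blast
    show "homotopic (resolution N) Y (res_map N Y s t) (res_map N Y s' t')"
      by (rule homotopic_resolutionI[OF N M m m', of p "\<lambda>i x. 0"])
        (use p s in \<open>auto simp: g g' piece_closed[OF M] lin_on_const0 diff_linear[OF M]
            zero_diff_diff[OF Y]\<close>)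
  qed
  finally show ?thesis .
qed

lemma htmap_comp:
  assumes N: "zero_diff N" and Y: "zero_diff Y" and Z: "zero_diff Z"
    and ht: "htmap N Y s t" and ht': "htmap Y Z s' t'"
  shows "htmap N Z (\<lambda>i x. s' i (s i x)) (\<lambda>i x. s' (i + 2) (t i x) + t' i (s i x))"
proof (rule htmapI[OF Z])
  note h = htmapD[OF ht] and h' = htmapD[OF ht'] and M = zero_diff_module[OF Z]
  show "s' i (s i x) \<in> piece Z i" "s' (i + 2) (t i x) + t' i (s i x) \<in> piece Z (i + 2)"
    if "x \<in> piece N i" for i x
    using h(2,5)[OF that] h'(2,5) by (auto simp: piece_closed[OF M])
  show "lin_on (piece N i) (\<lambda>x. s' i (s i x))" for i
    by (rule lin_on_comp[OF h(4) _ h'(4)]) (use h in auto)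
  have "lin_on (piece N i) (\<lambda>x. s' (i + 2) (t i x))" for i
    by (rule lin_on_comp[OF h(6) _ h'(4)]) (use h in auto)
  moreover have "lin_on (piece N i) (\<lambda>x. t' i (s i x))" for i
    by (rule lin_on_comp[OF h(4) _ h'(6)]) (use h in auto)
  ultimately show "lin_on (piece N i) (\<lambda>x. s' (i + 2) (t i x) + t' i (s i x))" for i
    by (rule lin_on_plus)
  show "act Z i (s' i (s i x)) = s' (i + 1) (s (i + 1) (act N i x))" if "x \<in> piece N i" for i x
    using htmap_commute[OF ht Y that] htmap_commute[OF ht' Z h(2)[OF that]] by simp
qed

lemma rmor_comp:
  assumes N: "zero_diff N" and Y: "zero_diff Y" and Z: "zero_diff Z"
    and ht: "htmap N Y s t" and ht': "htmap Y Z s' t'"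
  shows "rmor Y Z s' t' \<cdot> rmor N Y s t =
    rmor N Z (\<lambda>i x. s' i (s i x)) (\<lambda>i x. s' (i + 2) (t i x) + t' i (s i x))"
proof -
  note NM = zero_diff_module[OF N] and YM = zero_diff_module[OF Y] and ZM = zero_diff_module[OF Z]
  note h = htmapD[OF ht] and h' = htmapD[OF ht']
  note I = res_piece_intros[OF Y] and d = resolution_diff[OF Y] and S = res_piece_subspace[OF Y]
  note RM = resolution_module[OF Y]
  note idY = zero_diff_resolves(1)[OF Y]
  note htc = htmap_comp[OF N Y Z ht ht']
  \<comment> \<open>The lift of the pair \<open>(s, t)\<close> to a map of resolutions. It sends
    \<open>e1 x\<close> to \<open>e1 (s x)\<close> corrected by \<open>e0 (t x)\<close>; the
    correction produces the term \<open>s' t\<close> of the composite, while \<open>e1 (s x)\<close>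
    produces \<open>t' s\<close>.\<close>
  let ?k0 = "\<lambda>i x. e0 (s i x)" and ?k1 = "\<lambda>i x. e1 (s i x) + e0 (t i x)"
  have k: "htmap N (resolution Y) ?k0 ?k1"
    unfolding htmap_def
  proof (intro allI conjI ballI)
    fix i
    show "lin_on (piece N i) (?k0 i)"
      by (rule lin_onI) (simp_all add: lin_on_add[OF h(4)] lin_on_scale[OF h(4)])
    show "lin_on (piece N i) (?k1 i)"
      by (rule lin_onI)
        (simp_all add: lin_on_add[OF h(4)] lin_on_scale[OF h(4)] lin_on_add[OF h(6)]
            lin_on_scale[OF h(6)]
          scale_right_distrib ac_simps)
    fix x assume x: "x \<in> piece N i"
    show "?k0 i x \<in> cycles (resolution Y) i"
      using I(2)[OF h(2)[OF x]] d(2)[OF h(2)[OF x]] by (simp add: cycles_def)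
    show "?k1 i x \<in> piece (resolution Y) (i + 2)"
      using I(3)[OF h(2)[OF x]] I(2)[OF h(5)[OF x]] subspace_add[OF S] by simp
    have "diff (resolution Y) (i + 2) (?k1 i x) =
      diff (resolution Y) (i + 2) (e1 (s i x)) + diff (resolution Y) (i + 2) (e0 (t i x))"
      by (rule diff_linear(2)[OF RM]) (simp_all add: I(3)[OF h(2)[OF x]] I(2)[OF h(5)[OF x]])
    then show "diff (resolution Y) (i + 2) (?k1 i x) = act (resolution Y) i (?k0 i x)
        - ?k0 (i + 1) (act N i x)"
      using d(3)[OF h(2)[OF x]] d(2)[OF h(5)[OF x]] htmap_commute[OF ht Y x] by simp
  qed
  note mk' = res_map_dg_map[OF N RM k] and gk = res_map_generators[OF N RM k]
  have ext: "f (i + 2) (e1 (s i x) + e0 (t i x)) = f (i + 2) (e1 (s i x)) + f (i + 2) (e0 (t i x))"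
    if "dg_map (resolution Y) W f" "x \<in> piece N i" for f W i x
    by (rule map_linear(2)[OF RM that(1)]) (simp_all add: I(3)[OF h(2)[OF that(2)]]
        I(2)[OF h(5)[OF that(2)]])
  note mY = res_map_dg_map[OF Y YM idY] and mZ = res_map_dg_map[OF Y ZM ht']
  have 1: "homotopic (resolution N) Y (gcomp (res_map Y Y (\<lambda>i x. x) (\<lambda>i x. 0))
      (res_map N (resolution Y) ?k0 ?k1))
      (res_map N Y s t)"
    by (rule homotopic_generators[OF N YM dg_map_comp[OF mk' mY] res_map_dg_map[OF N YM ht]])
      (simp_all add: gcomp_def gk res_map_generators[OF N YM ht] res_map_generators[OF Y YM idY]
          h ext[OF mY])
  have 2: "homotopic (resolution N) Z (gcomp (res_map Y Z s' t') (res_map N (resolution Y) ?k0 ?k1))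
      (res_map N Z (\<lambda>i x. s' i (s i x)) (\<lambda>i x. s' (i + 2) (t i x) + t' i (s i x)))"
    by (rule homotopic_generators[OF N ZM dg_map_comp[OF mk' mZ] res_map_dg_map[OF N ZM htc]];
        simp add: gcomp_def gk res_map_generators[OF N ZM htc] res_map_generators[OF Y ZM ht']
            h ext[OF mZ];
        simp add: add.commute)
  show ?thesis
    unfolding rmor_def
    using comp_mk[OF zero_diff_resolves(2)[OF N] zero_diff_resolves(2)[OF Y]
        ZM res_map_dg_map[OF N YM ht] mZ mk' 1]
      mk_eq_iff[OF zero_diff_resolves(2)[OF N] ZM dg_map_comp[OF mk' mZ] res_map_dg_map[OF N ZM htc]] 2
    by simp
qed

lemma dg_map_htmap0:
  "zero_diff Y \<Longrightarrow> dg_map N Y f \<Longrightarrow> htmap N Y f (\<lambda>i x. 0)"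
  by (rule htmapI) (auto simp: map_in map_lin map_act lin_on_const0 piece_closed zero_diff_module)

lemma dmor_rmor:
  assumes N: "zero_diff N" and Y: "zero_diff Y" and f: "dg_map N Y f"
  shows "dmor N Y f = rmor N Y f (\<lambda>i x. 0)"
proof -
  note NM = zero_diff_module[OF N] and M = zero_diff_module[OF Y]
  note ht = dg_map_htmap0[OF Y f] and idN = zero_diff_resolves(1)[OF N]
  note m = dg_map_comp[OF res_map_dg_map[OF N NM idN] f]
  have "homotopic (resolution N) Y (gcomp f (res_map N N (\<lambda>i x. x) (\<lambda>i x. 0)))
      (res_map N Y f (\<lambda>i x. 0))"
    by (rule homotopic_generators[OF N M m res_map_dg_map[OF N M ht]])
      (simp_all add: gcomp_def res_map_generators[OF N M ht] res_map_generators[OF N NM idN]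
          map_linear(1)[OF NM f])
  then show ?thesis
    unfolding rmor_def
    using dmor_mk[OF zero_diff_resolves(2)[OF N] M f]
      mk_eq_iff[OF zero_diff_resolves(2)[OF N] M m res_map_dg_map[OF N M ht]] by simp
qed

lemma dId_rmor: "zero_diff N \<Longrightarrow> dId N = rmor N N (\<lambda>i x. x) (\<lambda>i x. 0)"
  by (simp add: dId_def dmor_rmor dg_map_id)

lemma dZero_rmor: "zero_diff N \<Longrightarrow> zero_diff Y \<Longrightarrow> dZero N Y = rmor N Y (\<lambda>i x. 0) (\<lambda>i x. 0)"
  by (simp add: dZero_def dmor_rmor dg_map_zero zero_diff_module)

lemma rmor_in: "zero_diff N \<Longrightarrow> zero_diff Y \<Longrightarrow> htmap N Y s t \<Longrightarrow> rmor N Y s t \<in> dHom N Y"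
  using dHom_rmor by blast

lemma zero_diff_zero_object:
  assumes "zero_diff N" "N \<in> Df"
  shows "zero_object N \<longleftrightarrow> (\<forall>i. piece N i = {0})"
proof
  assume "zero_object N"
  then have "rmor N N (\<lambda>i x. x) (\<lambda>i x. 0) = rmor N N (\<lambda>i x. 0) (\<lambda>i x. 0)"
    using dId_rmor[OF assms(1)] dZero_rmor[OF assms(1,1)] by (simp add: zero_object_def)
  then have "\<forall>i. \<forall>x\<in>piece N i. x = 0"
    using rmor_eq_iff[OF assms(1,1) zero_diff_resolves(1)[OF assms(1)]
        dg_map_htmap0[OF assms(1) dg_map_zero[OF zero_diff_module[OF assms(1)]]]] by simp
  then show "\<forall>i. piece N i = {0}" using piece_closed(1)[OF zero_diff_module[OF assms(1)]] by blast
next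
  assume "\<forall>i. piece N i = {0}"
  then have "dmor N N (\<lambda>i x. x) = dmor N N (\<lambda>i x. 0)"
    by (intro dmor_cong[OF assms(2,2) dg_map_id dg_map_zero[OF zero_diff_module[OF assms(1)]]]) simp
  then show "zero_object N" using assms(2) by (simp add: zero_object_def dId_def dZero_def)
qed

subsection \<open>Interval modules\<close>

definition unitv :: 'v where "unitv = (SOME v. v \<noteq> 0)"

lemma unitv_nonzero [simp]: "unitv \<noteq> 0"
proof -
  have "\<exists>v::'v. v \<noteq> 0" using infinite_dim[of "{}"] by auto
  then show ?thesis unfolding unitv_def by (rule someI_ex)
qed

definition coord :: "'v \<Rightarrow> 'k" where "coord x = (THE c. x = c *s unitv)"

lemma coord_scale [simp]: "coord (c *s unitv) = c"
  unfolding coord_def by (rule the_equality) (auto simp: scale_cancel_right)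

lemma line_iff: "x \<in> span {unitv} \<longleftrightarrow> x = coord x *s unitv"
proof
  assume "x \<in> span {unitv}"
  then obtain c where "x = c *s unitv" by (auto simp: span_singleton)
  then show "x = coord x *s unitv" by simp
qed (metis span_scale span_base singletonI)

lemma coord_linear:
  "x \<in> span {unitv} \<Longrightarrow> y \<in> span {unitv} \<Longrightarrow> coord (x + y) = coord x + coord y"
  "x \<in> span {unitv} \<Longrightarrow> coord (c *s x) = c * coord x"
proof -
  assume x: "x \<in> span {unitv}"
  then have x': "x = coord x *s unitv" by (simp only: line_iff)
  have "c *s x = (c * coord x) *s unitv" by (subst x') simp
  then show "coord (c *s x) = c * coord x" by simp
  assume "y \<in> span {unitv}"
  then have y': "y = coord y *s unitv" by (simp only: line_iff)
  have "x + y = (coord x + coord y) *s unitv" by (subst x', subst y') (simp add: scale_left_distrib)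
  then show "coord (x + y) = coord x + coord y" by simp
qed

text \<open>For \<open>b < a\<close> all pieces are zero, so the definition also provides a zero
  object (\<open>zero_object_exists\<close>).\<close>

definition E :: "int \<Rightarrow> int \<Rightarrow> 'v dgm" where
  "E a b = \<lparr> piece = \<lambda>i. if a \<le> i \<and> i \<le> b then span {unitv} else {0}, diff = \<lambda>i x. 0,
     act = \<lambda>i x. if a \<le> i \<and> i < b then x else 0 \<rparr>"

lemma E_simps:
  "piece (E a b) i = (if a \<le> i \<and> i \<le> b then span {unitv} else {0})" "diff (E a b) i x = 0"
  "act (E a b) i x = (if a \<le> i \<and> i < b then x else 0)"
  by (simp_all add: E_def)

lemma E_zero_diff: "zero_diff (E a b)"
proof -
  have "dg_module (E a b)"
    unfolding dg_module_def by (auto simp: E_simps lin_on_def subspace_span subspace_single_0 span_zero)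
  then show ?thesis
    unfolding zero_diff_def by (auto simp: E_simps intro!: exI[of _ a])
qed

lemma E_Df: "E a b \<in> Df"
proof -
  have "finite {i. piece (E a b) i \<noteq> {0}}"
    by (rule finite_subset[of _ "{a..b}"]) (auto simp: E_simps)
  moreover have "\<exists>F. finite F \<and> piece (E a b) i = span F" for i
    by (rule exI[of _ "if a \<le> i \<and> i \<le> b then {unitv} else {}"]) (simp add: E_simps)
  ultimately show ?thesis using zero_diff_Df_iff[OF E_zero_diff] by blast
qed

lemma E_unitv: "a \<le> i \<Longrightarrow> i \<le> b \<Longrightarrow> unitv \<in> piece (E a b) i"
  by (simp add: E_simps span_base)

lemma E_nonzero: "a \<le> b \<Longrightarrow> \<not> zero_object (E a b)"
  using zero_diff_zero_object[OF E_zero_diff E_Df, of a b] E_unitv[of a a b] unitv_nonzero by fastforce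

section \<open>Normal form of morphisms between interval modules\<close>

text \<open>Only the cut-off above is built in: for a \<open>fwd_pair\<close> every degree of the
  source is at least \<open>c\<close>. The companion \<open>tM\<close> is concentrated in the top
  degree \<open>b\<close> of the source, the position into which \<open>hom_E_normal_form\<close>
  moves every map of degree 2.\<close>

definition sM :: "int \<Rightarrow> 'k \<Rightarrow> int \<Rightarrow> 'v \<Rightarrow> 'v" where "sM d \<alpha> i x = (if i \<le> d then \<alpha> *s x else 0)"
definition tM :: "int \<Rightarrow> 'k \<Rightarrow> int \<Rightarrow> 'v \<Rightarrow> 'v" where "tM b \<tau> i x = (if i = b then \<tau> *s x else 0)"

text \<open>\<open>E a d\<close> is then a nonzero quotient of \<open>E a b\<close> and a submodule
  of \<open>E c d\<close>; the map is the composite.\<close>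

definition fwd_pair :: "int \<Rightarrow> int \<Rightarrow> int \<Rightarrow> int \<Rightarrow> bool" where
  "fwd_pair a b c d \<longleftrightarrow> c \<le> a \<and> a \<le> d \<and> d \<le> b"
text \<open>The source moved up by 2 overlaps the target, starts at or below its bottom and ends at
  or below its top. If either comparison fails, there is an end over which a homotopy pushes the map
  out.\<close>

definition ext_pair :: "int \<Rightarrow> int \<Rightarrow> int \<Rightarrow> int \<Rightarrow> bool" where
  "ext_pair a b c d \<longleftrightarrow> a + 2 \<le> c \<and> c \<le> b + 2 \<and> b + 2 \<le> d"

definition hmor :: "int \<Rightarrow> int \<Rightarrow> int \<Rightarrow> int \<Rightarrow> 'k \<Rightarrow> 'k \<Rightarrow> 'v roof set" where
  "hmor a b c d \<alpha> \<tau> = rmor (E a b) (E c d) (sM d \<alpha>) (tM b \<tau>)"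

definition hok :: "int \<Rightarrow> int \<Rightarrow> int \<Rightarrow> int \<Rightarrow> 'k \<Rightarrow> 'k \<Rightarrow> bool" where
  "hok a b c d \<alpha> \<tau> \<longleftrightarrow> (\<alpha> \<noteq> 0 \<longrightarrow> fwd_pair a b c d) \<and> (\<tau> \<noteq> 0 \<longrightarrow> ext_pair a b c d)"

lemma hok_htmap:
  assumes "hok a b c d \<alpha> \<tau>"
  shows "htmap (E a b) (E c d) (sM d \<alpha>) (tM b \<tau>)"
proof (rule htmapI[OF E_zero_diff])
  show "lin_on (piece (E a b) i) (sM d \<alpha> i)" "lin_on (piece (E a b) i) (tM b \<tau> i)" for i
    by (auto simp: sM_def tM_def lin_on_def scale_right_distrib)
  fix i x assume x: "x \<in> piece (E a b) i"
  show "sM d \<alpha> i x \<in> piece (E c d) i"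
    using x assms by (cases "\<alpha> = 0")
      (auto simp: E_simps sM_def hok_def fwd_pair_def span_zero span_scale split: if_splits)
  show "tM b \<tau> i x \<in> piece (E c d) (i + 2)"
    using x assms by (cases "\<tau> = 0")
      (auto simp: E_simps tM_def hok_def ext_pair_def span_zero span_scale split: if_splits)
  show "act (E c d) i (sM d \<alpha> i x) = sM d \<alpha> (i + 1) (act (E a b) i x)"
    using x assms by (cases "\<alpha> = 0")
      (auto simp: E_simps sM_def hok_def fwd_pair_def split: if_splits)
qed

lemma rmor_cong:
  assumes "zero_diff N" "zero_diff Y" "htmap N Y s t" "htmap N Y s' t'"
    "\<And>i x. x \<in> piece N i \<Longrightarrow> s i x = s' i x" "\<And>i x. x \<in> piece N i \<Longrightarrow> t i x = t' i x"
  shows "rmor N Y s t = rmor N Y s' t'"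
  unfolding rmor_eq_iff[OF assms(1-4)]
  using assms(5,6) zero_diff_module[OF assms(2)]
  by (auto intro!: exI[of _ "\<lambda>i x. 0"] simp: lin_on_const0 piece_closed act_linear)

lemma hmor_arr [simp]:
  assumes "hok a b c d \<alpha> \<tau>"
  shows "arr (hmor a b c d \<alpha> \<tau>)" "dm (hmor a b c d \<alpha> \<tau>) = E a b" "cd (hmor a b c d \<alpha> \<tau>) = E c d"
  unfolding hmor_def
  using dHom_dm_cd[OF rmor_in[OF E_zero_diff E_zero_diff hok_htmap[OF assms]] E_Df E_Df] by auto

text \<open>A T-linear map is determined by the image of the bottom vector, which vanishes if the
  target starts above \<open>a\<close> or ends below \<open>a\<close>. Since T kills the top of the
  source, this image also vanishes if the target continues beyond \<open>b\<close>.\<close>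

lemma hom_E_degree0:
  assumes ht: "htmap (E a b) (E c d) s t" and ab: "a \<le> b" and x: "x \<in> piece (E a b) i"
  shows "s i x = sM d (if fwd_pair a b c d then coord (s a unitv) else 0) i x"
proof (cases "a \<le> i \<and> i \<le> b")
  case False
  then have "x = 0" using x by (simp add: E_simps split: if_splits)
  then show ?thesis using lin_on_zero[OF htmapD(4)[OF ht]] piece_subspace[OF zero_diff_module[OF
      E_zero_diff]]
    by (simp add: sM_def)
next
  case True
  define f where "f j = s j unitv" for j
  have fin: "f j \<in> piece (E c d) j" if "a \<le> j" "j \<le> b" for j
    unfolding f_def using htmapD(2)[OF ht E_unitv[OF that]] .
  have step: "act (E c d) j (f j) = (if j < b then f (j + 1) else 0)" if "a \<le> j" "j \<le> b" for j
    using htmap_commute[OF ht E_zero_diff E_unitv[OF that]] that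
      lin_on_zero[OF htmapD(4)[OF ht] piece_subspace[OF zero_diff_module[OF E_zero_diff]]]
    by (auto simp: f_def E_simps)
  have f_eq: "j \<le> b \<longrightarrow> f j = (if c \<le> a \<and> j \<le> d then f a else 0)" if "a \<le> j" for j
    using that
  proof (induction j rule: int_ge_induct)
    case base
    then show ?case using fin[of a] by (auto simp: E_simps split: if_splits)
  next
    case (step j)
    show ?case
    proof
      assume j: "j + 1 \<le> b"
      then have "f (j + 1) = act (E c d) j (f j)"
        using \<open>a \<le> j\<close> \<open>\<And>j. a \<le> j \<Longrightarrow> j \<le> b \<Longrightarrow> act (E c d) j (f j) = (if j < b then f (j + 1)
            else 0)\<close>[of j] by simp
      then show "f (j + 1) = (if c \<le> a \<and> j + 1 \<le> d then f a else 0)"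
        using step j by (auto simp: E_simps)
    qed
  qed
  have f0: "f a = 0" if "c \<le> a" "\<not> fwd_pair a b c d"
  proof (cases "a \<le> d")
    case True
    with that have "b < d" by (auto simp: fwd_pair_def)
    then show ?thesis using step[of b] f_eq[of b] ab that by (auto simp: E_simps)
  next
    case False
    then show ?thesis using fin[of a] ab by (simp add: E_simps)
  qed
  have fi: "f i = sM d (if fwd_pair a b c d then coord (f a) else 0) i unitv"
  proof (cases "fwd_pair a b c d")
    case t: True
    have "f a \<in> span {unitv}" using fin[of a] t ab by (simp add: E_simps fwd_pair_def)
    then have "f a = coord (f a) *s unitv" by (simp only: line_iff)
    then show ?thesis using t f_eq[of i] True by (auto simp: sM_def fwd_pair_def)
  next
    case t: False
    then show ?thesis using f_eq[of i] True f0 by (auto simp: sM_def)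
  qed
  have "x \<in> span {unitv}" using x True by (simp add: E_simps)
  then have x': "x = coord x *s unitv" by (simp only: line_iff)
  have "s i x = coord x *s f i"
    by (subst x') (simp add: lin_on_scale[OF htmapD(4)[OF ht] E_unitv] True f_def)
  also have "\<dots> = sM d (if fwd_pair a b c d then coord (f a) else 0) i x"
    by (subst (2) x') (simp add: fi sM_def mult.commute)
  finally show ?thesis by (simp add: f_def)
qed

lemma sum_int_last: "a \<le> i \<Longrightarrow> (\<Sum>j=a..i. f j) = (\<Sum>j=a..i - 1. f j) + (f i :: 'k)" for i a :: int
proof -
  assume "a \<le> i"
  then have "{a..i} = insert i {a..i - 1}" by auto
  then show ?thesis by (simp add: add.commute)
qed

lemma sum_int_first: "i \<le> b \<Longrightarrow> (\<Sum>j=i..b. f j) = f i + (\<Sum>j=i + 1..b. f j :: 'k)" for i b :: int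
proof -
  assume "i \<le> b"
  then have "{i..b} = insert i {i + 1..b}" by auto
  then show ?thesis by simp
qed

text \<open>In degree two only the sum of the components of \<open>t\<close> survives modulo homotopy, and it can be
  moved to the top degree. It survives at all only for an \<open>ext_pair\<close>.\<close>

lemma hom_E_normal_form:
  assumes f: "f \<in> dHom (E a b) (E c d)" and ab: "a \<le> b"
  obtains \<alpha> \<tau> where "hok a b c d \<alpha> \<tau>" "f = hmor a b c d \<alpha> \<tau>"
proof -
  obtain s t where f_eq: "f = rmor (E a b) (E c d) s t" and ht: "htmap (E a b) (E c d) s t"
    using f unfolding dHom_rmor[OF E_zero_diff E_zero_diff] by blast
  define \<alpha> where "\<alpha> = (if fwd_pair a b c d then coord (s a unitv) else 0)"
  define u where "u j = coord (t j unitv)" for j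
  have t_unitv: "t j unitv \<in> piece (E c d) (j + 2)" if "a \<le> j" "j \<le> b" for j
    by (rule htmapD(5)[OF ht E_unitv[OF that]])
  have u0: "t j unitv = 0" "u j = 0" if "a \<le> j" "j \<le> b" "\<not> (c \<le> j + 2 \<and> j + 2 \<le> d)" for j
    using t_unitv[of j] that coord_scale[of 0] by (auto simp: E_simps u_def)
  have t_eq: "t j x = u j *s x" if "x \<in> piece (E a b) j" for j x
  proof (cases "a \<le> j \<and> j \<le> b")
    case True
    then have "x \<in> span {unitv}" using that by (simp add: E_simps)
    then have x': "x = coord x *s unitv" by (simp only: line_iff)
    have "t j unitv \<in> span {unitv}" using t_unitv[of j] True by (auto simp: E_simps span_zero
        split: if_splits)
    then have "t j unitv = u j *s unitv" unfolding u_def by (simp only: line_iff)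
    then have "t j (coord x *s unitv) = u j *s (coord x *s unitv)"
      by (simp add: lin_on_scale[OF htmapD(6)[OF ht] E_unitv] True mult.commute)
    then show ?thesis using x' by simp
  next
    case False
    then have "x = 0" using that by (auto simp: E_simps)
    then show ?thesis
      using lin_on_zero[OF htmapD(6)[OF ht] piece_subspace[OF zero_diff_module[OF E_zero_diff]]] by simp
  qed
  have key: "f = hmor a b c d \<alpha> \<tau>"
    if ok: "hok a b c d \<alpha> \<tau>"
      and pi0: "\<And>i. \<not> (c \<le> i + 1 \<and> i + 1 \<le> d) \<Longrightarrow> \<pi> i = 0"
      and pi: "\<And>i. a \<le> i \<Longrightarrow> i \<le> b \<Longrightarrow> c \<le> i + 2 \<Longrightarrow> i + 2 \<le> d \<Longrightarrow>
        u i - (if i = b then \<tau> else 0) = (if c \<le> i + 1 then \<pi> i else 0) - (if i < b then \<pi> (i + 1)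
            else 0)"
    for \<tau> \<pi>
    unfolding f_eq hmor_def
  proof (subst rmor_eq_iff[OF E_zero_diff E_zero_diff ht hok_htmap[OF ok]], intro conjI allI ballI
      exI[of _ "\<lambda>i x. \<pi> i *s x"])
    show "s i x = sM d \<alpha> i x" if "x \<in> piece (E a b) i" for i x
      using hom_E_degree0[OF ht ab that] by (simp add: \<alpha>_def)
    show "lin_on (piece (E a b) i) (\<lambda>x. \<pi> i *s x)" for i
      by (rule lin_on_scaled[OF lin_on_ident])
    fix i x assume x: "x \<in> piece (E a b) i"
    show "\<pi> i *s x \<in> piece (E c d) (i + 1)"
      using x pi0[of i] by (auto simp: E_simps span_scale span_zero split: if_splits)
    show "t i x - tM b \<tau> i x = act (E c d) (i + 1) (\<pi> i *s x) - \<pi> (i + 1) *s act (E a b) i x"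
    proof (cases "a \<le> i \<and> i \<le> b")
      case False
      then have "x = 0" using x by (auto simp: E_simps)
      then show ?thesis using t_eq[OF x] by (simp add: tM_def E_simps)
    next
      case True
      show ?thesis
      proof (cases "c \<le> i + 2 \<and> i + 2 \<le> d")
        case in_range: True
        have "t i x - tM b \<tau> i x = (u i - (if i = b then \<tau> else 0)) *s x"
          using t_eq[OF x] by (simp add: tM_def scale_left_diff_distrib)
        then show ?thesis
          unfolding pi[OF conjunct1[OF True] conjunct2[OF True] conjunct1[OF in_range]
              conjunct2[OF in_range]]
          using True in_range by (simp add: E_simps scale_left_diff_distrib)
      next
        case out: False
        have "t i x = 0" using t_eq[OF x] u0(2)[of i] True out by simp
        moreover have "tM b \<tau> i x = 0"
          using ok out by (auto simp: tM_def hok_def ext_pair_def)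
        moreover have "act (E c d) (i + 1) (\<pi> i *s x) = 0" using out by (auto simp: E_simps)
        moreover have "\<pi> (i + 1) = 0" using pi0[of "i + 1"] out by auto
        ultimately show ?thesis by simp
      qed
    qed
  qed
  \<comment> \<open>Partial sums from the bottom: this homotopy clears the components of
    \<open>t\<close> degree by degree and carries their sum upwards to \<open>b\<close>.\<close>
  define \<pi> where "\<pi> i = (if c \<le> i + 1 \<and> i + 1 \<le> d then - (\<Sum>j=a..i - 1. u j) else 0)" for i
  have pi_step: "u i = (if c \<le> i + 1 then \<pi> i else 0) - \<pi> (i + 1)"
    if i: "a \<le> i" "i \<le> b" "c \<le> i + 2" "i + 2 \<le> d" for i
  proof (cases "c \<le> i + 1")
    case True
    then show ?thesis using i sum_int_last[OF i(1), of u] by (simp add: \<pi>_def)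
  next
    case False
    have "(\<Sum>j=a..i - 1. u j) = 0"
      by (rule sum.neutral) (use False i u0(2) in auto)
    then show ?thesis using i False sum_int_last[OF i(1), of u] by (simp add: \<pi>_def)
  qed
  have pi_zero: "\<pi> i = 0" if "\<not> (c \<le> i + 1 \<and> i + 1 \<le> d)" for i
    using that unfolding \<pi>_def by (rule if_not_P)
  show thesis
  proof (cases "c \<le> b + 2 \<and> b + 2 \<le> d")
    \<comment> \<open>The top degree \<open>b\<close> has no counterpart in the target, so nothing
      can remain there and the homotopy removes all components.\<close>
    case False
    have ok: "hok a b c d \<alpha> 0" by (simp add: hok_def \<alpha>_def)
    have "f = hmor a b c d \<alpha> 0"
      by (rule key[OF ok pi_zero]) (use pi_step False in \<open>auto split: if_splits\<close>)
    with ok show thesis by (rule that)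
  next
    case True
    show thesis
    proof (cases "a + 2 \<le> c")
      case t: True
      define \<tau> where "\<tau> = u b - (if c \<le> b + 1 then \<pi> b else 0)"
      have ok: "hok a b c d \<alpha> \<tau>" using t True by (simp add: hok_def \<alpha>_def ext_pair_def)
      have "f = hmor a b c d \<alpha> \<tau>"
        by (rule key[OF ok pi_zero]) (use pi_step in \<open>auto simp: \<tau>_def\<close>)
      with ok show thesis by (rule that)
    next
      case t: False
      have ok: "hok a b c d \<alpha> 0" by (simp add: hok_def \<alpha>_def)
      \<comment> \<open>Sums from the top push the components downwards. The target starts at or
        below degree \<open>a + 1\<close>, so the homotopy still has room in degree
        \<open>a\<close>, and the source has nothing below \<open>a\<close> to receive the total: it
        disappears.\<close>
      define \<sigma> where "\<sigma> i = (if c \<le> i + 1 \<and> i + 1 \<le> d then (\<Sum>j=i..b. u j) else 0)" for i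
      have "f = hmor a b c d \<alpha> 0"
      proof (rule key[OF ok, of \<sigma>])
        fix i assume i: "a \<le> i" "i \<le> b" "c \<le> i + 2" "i + 2 \<le> d"
        then show "u i - (if i = b then 0 else 0) =
            (if c \<le> i + 1 then \<sigma> i else 0) - (if i < b then \<sigma> (i + 1) else 0)"
          using t sum_int_first[OF i(2), of u] by (auto simp: \<sigma>_def)
      qed (auto simp: \<sigma>_def)
      with ok show thesis by (rule that)
    qed
  qed
qed

lemma hmor_zero: "hmor a b c d 0 0 = dZero (E a b) (E c d)"
proof -
  have "sM d 0 = (\<lambda>i x. 0)" "tM b 0 = (\<lambda>i x. 0)" by (simp_all add: sM_def tM_def fun_eq_iff)
  then show ?thesis by (simp add: hmor_def dZero_rmor[OF E_zero_diff E_zero_diff])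
qed

lemma hmor_id: "a \<le> b \<Longrightarrow> hmor a b a b 1 0 = dId (E a b)"
  unfolding hmor_def dId_rmor[OF E_zero_diff]
  by (rule rmor_cong[OF E_zero_diff E_zero_diff hok_htmap zero_diff_resolves(1)[OF E_zero_diff]])
    (auto simp: hok_def fwd_pair_def sM_def tM_def E_simps split: if_splits)

lemma hmor_eq_degree0:
  assumes "hok a b c d \<alpha> \<tau>" "hok a b c d \<alpha>' \<tau>'" "hmor a b c d \<alpha> \<tau> = hmor a b c d \<alpha>' \<tau>'" "a \<le> b"
  shows "\<alpha> = \<alpha>'"
proof -
  have "sM d \<alpha> a unitv = sM d \<alpha>' a unitv"
    using assms(3) rmor_eq_iff[OF E_zero_diff E_zero_diff hok_htmap[OF assms(1)] hok_htmap[OF assms(2)]]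
      E_unitv[of a a b] assms(4) unfolding hmor_def by blast
  then show ?thesis using assms(1,2) by (cases "a \<le> d") (auto simp: sM_def hok_def fwd_pair_def)
qed

text \<open>A homotopy could change the component in degree \<open>b\<close> in two ways: through T
  on the target, starting from degree \<open>b + 1\<close>, which lies below the target, or through
  T on the source, which kills the top degree. Neither is available.\<close>

lemma hmor_ext_nonzero:
  assumes "a \<le> b" "b + 2 \<le> d" "hmor a b (b + 2) d 0 \<tau> = dZero (E a b) (E (b + 2) d)"
  shows "\<tau> = 0"
proof -
  have ok: "hok a b (b + 2) d 0 \<tau>" "hok a b (b + 2) d 0 0"
    using assms by (auto simp: hok_def ext_pair_def)
  have "hmor a b (b + 2) d 0 \<tau> = hmor a b (b + 2) d 0 0" using assms(3) hmor_zero by simp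
  then obtain p where p: "\<forall>i. lin_on (piece (E a b) i) (p i) \<and> (\<forall>x\<in>piece (E a b)
      i. p i x \<in> piece (E (b + 2) d) (i + 1) \<and>
       tM b \<tau> i x - tM b 0 i x = act (E (b + 2) d) (i + 1) (p i x) - p (i + 1) (act (E a b) i x))"
    unfolding hmor_def rmor_eq_iff[OF E_zero_diff E_zero_diff hok_htmap[OF ok(1)]
        hok_htmap[OF ok(2)]] by blast
  have "p (b + 1) 0 = 0"
    using p lin_on_zero[OF _ piece_subspace[OF zero_diff_module[OF E_zero_diff]]] by blast
  moreover have "tM b \<tau> b unitv - tM b 0 b unitv =
      act (E (b + 2) d) (b + 1) (p b unitv) - p (b + 1) (act (E a b) b unitv)"
    using p E_unitv[of a b b] assms(1) by blast
  ultimately have "\<tau> *s unitv = 0" by (simp add: tM_def E_simps)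
  then show ?thesis by simp
qed

text \<open>The coefficients of the composite are supplied from outside, because the cut-offs decide
  which products survive. All maps multiply by scalars, so testing on \<open>unitv\<close> is
  enough.\<close>

lemma hmor_comp:
  assumes "hok a b c d \<alpha> \<tau>" "hok c d e f \<alpha>' \<tau>'" "hok a b e f \<alpha>'' \<tau>''"
    and "\<And>i. a \<le> i \<Longrightarrow> i \<le> b \<Longrightarrow> sM f \<alpha>' i (sM d \<alpha> i unitv) = sM f \<alpha>'' i unitv"
    and "\<And>i. a \<le> i \<Longrightarrow> i \<le> b \<Longrightarrow>
      sM f \<alpha>' (i + 2) (tM b \<tau> i unitv) + tM d \<tau>' i (sM d \<alpha> i unitv) = tM b \<tau>'' i unitv"
  shows "hmor c d e f \<alpha>' \<tau>' \<cdot> hmor a b c d \<alpha> \<tau> = hmor a b e f \<alpha>'' \<tau>''"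
  unfolding hmor_def
  unfolding rmor_comp[OF E_zero_diff E_zero_diff E_zero_diff hok_htmap[OF assms(1)]
      hok_htmap[OF assms(2)]]
proof (rule rmor_cong[OF E_zero_diff E_zero_diff htmap_comp[OF E_zero_diff E_zero_diff E_zero_diff
        hok_htmap[OF assms(1)] hok_htmap[OF assms(2)]] hok_htmap[OF assms(3)]])
  fix i x assume x: "x \<in> piece (E a b) i"
  have s: "sM f' r j (c *s y) = c *s sM f' r j y" "sM f' r j 0 = 0" for f' r j c y
    by (simp_all add: sM_def mult.commute)
  have t: "tM f' r j (c *s y) = c *s tM f' r j y" "tM f' r j 0 = 0" for f' r j c y
    by (simp_all add: tM_def mult.commute)
  have "sM f \<alpha>' i (sM d \<alpha> i x) = sM f \<alpha>'' i x \<and>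
    sM f \<alpha>' (i + 2) (tM b \<tau> i x) + tM d \<tau>' i (sM d \<alpha> i x) = tM b \<tau>'' i x"
  proof (cases "a \<le> i \<and> i \<le> b")
    case True
    then have "x \<in> span {unitv}" using x by (simp add: E_simps)
    then obtain r where r: "x = r *s unitv" using line_iff by blast
    show ?thesis
      unfolding r s t scale_right_distrib[symmetric] using assms(4,5)[of i] True by simp
  next
    case False
    then have "x = 0" using x by (auto simp: E_simps)
    then show ?thesis by (simp add: s t)
  qed
  then show "sM f \<alpha>' i (sM d \<alpha> i x) = sM f \<alpha>'' i x"
    "sM f \<alpha>' (i + 2) (tM b \<tau> i x) + tM d \<tau>' i (sM d \<alpha> i x) = tM b \<tau>'' i x"
    by auto
qed

subsection \<open>Direct sums and decompositions into interval modules\<close>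

lemma dmor_direct_sum:
  assumes D: "S \<in> Df" "A \<in> Df" "B \<in> Df"
    and j1: "dg_map A S j1" and j2: "dg_map B S j2" and r1: "dg_map S A r1" and r2: "dg_map S B r2"
    and "\<And>i x. x \<in> piece A i \<Longrightarrow> r1 i (j1 i x) = x" "\<And>i x. x \<in> piece B i \<Longrightarrow> r2 i (j2 i x) = x"
    and "\<And>i x. x \<in> piece B i \<Longrightarrow> r1 i (j2 i x) = 0" "\<And>i x. x \<in> piece A i \<Longrightarrow> r2 i (j1 i x) = 0"
    and "\<And>i x. x \<in> piece S i \<Longrightarrow> j1 i (r1 i x) + j2 i (r2 i x) = x"
  shows "direct_sum S A B"
  unfolding direct_sum_def
proof (intro bexI conjI)
  note M = DfD[OF D(1)] DfD[OF D(2)] DfD[OF D(3)]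
  show "dmor S A r1 \<cdot> dmor A S j1 = dId A"
    unfolding dmor_comp[OF D(2,1,2) j1 r1] dId_def
    by (rule dmor_cong[OF D(2,2) dg_map_comp[OF j1 r1] dg_map_id]) (simp add: gcomp_def assms)
  show "dmor S B r2 \<cdot> dmor B S j2 = dId B"
    unfolding dmor_comp[OF D(3,1,3) j2 r2] dId_def
    by (rule dmor_cong[OF D(3,3) dg_map_comp[OF j2 r2] dg_map_id]) (simp add: gcomp_def assms)
  show "dmor S A r1 \<cdot> dmor B S j2 = dZero B A"
    unfolding dmor_comp[OF D(3,1,2) j2 r1] dZero_def
    by (rule dmor_cong[OF D(3,2) dg_map_comp[OF j2 r1] dg_map_zero[OF M(2)]])
        (simp add: gcomp_def assms)
  show "dmor S B r2 \<cdot> dmor A S j1 = dZero A B"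
    unfolding dmor_comp[OF D(2,1,3) j1 r2] dZero_def
    by (rule dmor_cong[OF D(2,3) dg_map_comp[OF j1 r2] dg_map_zero[OF M(3)]])
        (simp add: gcomp_def assms)
  note c = dg_map_comp[OF r1 j1] dg_map_comp[OF r2 j2]
  show "dmor A S j1 \<cdot> dmor S A r1 \<boxplus> dmor B S j2 \<cdot> dmor S B r2 = dId S"
    unfolding dmor_comp[OF D(1,2,1) r1 j1] dmor_comp[OF D(1,3,1) r2 j2] dmor_add[OF D(1,1) c] dId_def
    by (rule dmor_cong[OF D(1,1) dg_map_add[OF M(1) c] dg_map_id]) (simp add: gcomp_def assms)
qed (simp_all add: dmor_in D j1 j2 r1 r2)

text \<open>Pieces of \<open>A\<close> and \<open>B\<close> may overlap in the ambient space, so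
  \<open>e0\<close> and \<open>e1\<close> first move them to independent copies. The differential is
  put to 0, the case of homology models; sums of arbitrary objects are reached through
  \<open>formality\<close>.\<close>

definition dsum :: "'v dgm \<Rightarrow> 'v dgm \<Rightarrow> 'v dgm" where
  "dsum A B = \<lparr> piece = \<lambda>i. {v. p0 v \<in> piece A i \<and> p1 v \<in> piece B i \<and> v = e0 (p0 v) + e1 (p1 v)},
     diff = \<lambda>i v. 0, act = \<lambda>i v. e0 (act A i (p0 v)) + e1 (act B i (p1 v)) \<rparr>"

lemma span_lin_image:
  assumes "lin_on UNIV f" "x \<in> span G"
  shows "f x \<in> span (f ` G)"
  using assms(2)
proof (induction rule: span_induct_alt)
  case base
  then show ?case using lin_on_zero[OF assms(1)] by (simp add: span_zero)
next
  case (step c x y)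
  then show ?case
    using assms(1) by (simp add: lin_on_add lin_on_scale span_add span_scale span_base)
qed

lemma dsum_direct_sum:
  assumes A: "zero_diff A" "A \<in> Df" and B: "zero_diff B" "B \<in> Df"
  shows "dsum A B \<in> Df" "direct_sum (dsum A B) A B"
proof -
  note MA = zero_diff_module[OF A(1)] and MB = zero_diff_module[OF B(1)]
  let ?S = "dsum A B"
  have S: "v \<in> piece ?S i \<longleftrightarrow> p0 v \<in> piece A i \<and> p1 v \<in> piece B i \<and> v = e0 (p0 v) + e1 (p1 v)"
    "diff ?S i v = 0" "act ?S i v = e0 (act A i (p0 v)) + e1 (act B i (p1 v))" for i v
    by (simp_all add: dsum_def)
  have sub: "subspace (piece ?S i)" for i
  proof (rule subspaceI)
    show "0 \<in> piece ?S i" by (simp add: S piece_closed[OF MA] piece_closed[OF MB])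
    fix v w c assume v: "v \<in> piece ?S i"
    then have ev: "v = e0 (p0 v) + e1 (p1 v)" unfolding S by blast
    have "c *s v = e0 (c *s p0 v) + e1 (c *s p1 v)"
      by (subst ev) (simp only: scale_right_distrib split_scale)
    moreover have "e0 (c *s p0 v) + e1 (c *s p1 v) \<in> piece ?S i"
      using v unfolding S by (simp add: piece_closed(4)[OF MA] piece_closed(4)[OF MB] del: split_scale)
    ultimately show "c *s v \<in> piece ?S i" by simp
    assume w: "w \<in> piece ?S i"
    have "v + w = e0 (p0 v) + e1 (p1 v) + (e0 (p0 w) + e1 (p1 w))" using v w unfolding S by metis
    then show "v + w \<in> piece ?S i"
      using v w unfolding S by (simp add: piece_closed[OF MA] piece_closed[OF MB] ac_simps)
  qed
  have MS: "dg_module ?S"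
    unfolding dg_module_def
    using sub by (auto simp: S piece_closed[OF MA] piece_closed[OF MB] act_in[OF MA] act_in[OF MB]
        subspace_0 lin_on_const0 act_linear[OF MA] act_linear[OF MB]
            scale_right_distrib intro!: lin_onI)
  have S0: "piece ?S i = {0}" if "piece A i = {0}" "piece B i = {0}" for i
    using that sub[of i] by (auto simp: S subspace_0) 
  obtain la lb where l: "\<And>i. i < la \<Longrightarrow> piece A i = {0}" "\<And>i. i < lb \<Longrightarrow> piece B i = {0}"
    using A(1) B(1) unfolding zero_diff_def by blast
  have "\<forall>i<min la lb. piece ?S i = {0}" using S0 l by simp
  then have zS: "zero_diff ?S" unfolding zero_diff_def using MS S(2) by blast
  have "finite {i. piece ?S i \<noteq> {0}}"
    by (rule finite_subset[of _ "{i. piece A i \<noteq> {0}} \<union> {i. piece B i \<noteq> {0}}"])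
      (use S0 A B zero_diff_Df_iff in auto)
  moreover have "\<exists>F. finite F \<and> piece ?S i = span F" for i
  proof -
    obtain FA FB where F: "finite FA" "piece A i = span FA" "finite FB" "piece B i = span FB"
      using zero_diff_Df_iff[OF A(1)] zero_diff_Df_iff[OF B(1)] A(2) B(2) by blast
    have "piece ?S i \<subseteq> span (e0 ` FA \<union> e1 ` FB)"
    proof
      fix v assume v: "v \<in> piece ?S i"
      have "e0 (p0 v) \<in> span (e0 ` FA)" "e1 (p1 v) \<in> span (e1 ` FB)"
        using span_lin_image[OF split_lin(3), of "p0 v" FA] span_lin_image[OF split_lin(5), of "p1
            v" FB] v F
        by (simp_all add: S)
      then have "e0 (p0 v) + e1 (p1 v) \<in> span (e0 ` FA \<union> e1 ` FB)"
        by (intro span_add) (use span_mono in blast)+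
      then show "v \<in> span (e0 ` FA \<union> e1 ` FB)" using v by (simp add: S)
    qed
    moreover have "span (e0 ` FA \<union> e1 ` FB) \<subseteq> piece ?S i"
      by (rule span_minimal[OF _ sub])
        (use F in \<open>auto simp: S span_base span_zero\<close>)
    ultimately show ?thesis using F by (intro exI[of _ "e0 ` FA \<union> e1 ` FB"]) auto
  qed
  ultimately show SD: "?S \<in> Df" using zero_diff_Df_iff[OF zS] by blast
  show "direct_sum ?S A B"
  proof (rule dmor_direct_sum[OF SD A(2) B(2), of "\<lambda>i. e0" "\<lambda>i. e1" "\<lambda>i. p0" "\<lambda>i. p1"])
    have l: "lin_on U g" if "lin_on UNIV g" for U g
      by (rule lin_on_mono[OF that]) simp
    show "dg_map A ?S (\<lambda>i. e0)" "dg_map B ?S (\<lambda>i. e1)" "dg_map ?S A (\<lambda>i. p0)" "dg_map ?S B (\<lambda>i. p1)"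
      unfolding dg_map_def
      by (auto simp: S l split_lin piece_closed[OF MA] piece_closed[OF MB] act_linear[OF MA]
          act_linear[OF MB] zero_diff_diff[OF A(1)] zero_diff_diff[OF B(1)])
  qed (auto simp: S)
qed

lemma zero_object_exists: "\<exists>Z. zero_object Z"
proof -
  have "\<forall>i. piece (E 1 0) i = {0}" by (auto simp: E_simps)
  then show ?thesis using zero_diff_zero_object[OF E_zero_diff E_Df] by blast
qed

lemma direct_sum_exists:
  assumes "X \<in> Df" "Y \<in> Df"
  shows "\<exists>S\<in>Df. direct_sum S X Y"
proof -
  obtain N where N: "zero_diff N" "N \<in> Df" "isomorphic X N" by (rule formality[OF assms(1)])
  obtain M where M: "zero_diff M" "M \<in> Df" "isomorphic Y M" by (rule formality[OF assms(2)])
  note S = dsum_direct_sum[OF N(1,2) M(1,2)]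
  have 1: "direct_sum (dsum N M) X M"
    by (rule direct_sum_iso_left[OF S(2) isomorphic_sym[OF N(3) assms(1) N(2)] S(1) N(2) M(2) assms(1)])
  have 2: "direct_sum (dsum N M) M X" by (rule direct_sum_commute[OF 1 S(1) assms(1) M(2)])
  have 3: "direct_sum (dsum N M) Y X"
    by (rule direct_sum_iso_left[OF 2 isomorphic_sym[OF M(3) assms(2) M(2)] S(1) M(2) assms(1,2)])
  show ?thesis using direct_sum_commute[OF 3 S(1) assms(2,1)] S(1) by blast
qed

primrec act_pow :: "'v dgm \<Rightarrow> int \<Rightarrow> nat \<Rightarrow> 'v \<Rightarrow> 'v" where
  "act_pow N i 0 x = x"
| "act_pow N i (Suc n) x = act N (i + int n) (act_pow N i n x)"

lemma act_pow_in: "dg_module N \<Longrightarrow> x \<in> piece N i \<Longrightarrow> act_pow N i n x \<in> piece N (i + int n)"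
proof (induction n)
  case (Suc n)
  then show ?case using act_in[of N "act_pow N i n x" "i + int n"] by (simp add: ac_simps)
qed simp

lemma act_pow_linear:
  assumes "dg_module N" "x \<in> piece N i"
  shows "y \<in> piece N i \<Longrightarrow> act_pow N i n (x + y) = act_pow N i n x + act_pow N i n y"
    and "act_pow N i n (c *s x) = c *s act_pow N i n x"
  by (induction n) (use assms in \<open>simp_all add: act_linear act_pow_in\<close>)

lemma act_pow_add: "act_pow N (i + int n) m (act_pow N i n x) = act_pow N i (n + m) x"
  by (induction m) (simp_all add: add.assoc)

lemma act_pow_Suc: "act_pow N i (Suc n) x = act_pow N (i + 1) n (act N i x)"
  using act_pow_add[of N i 1 n x] by simp

definition total_dim :: "'v dgm \<Rightarrow> nat" where
  "total_dim N = (\<Sum>i | piece N i \<noteq> {0}. dim (piece N i))"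

lemma dim_mono_span:
  assumes "finite F" "W = span F" "V \<subseteq> W" "subspace V"
  shows "dim V \<le> dim W" "V \<noteq> W \<Longrightarrow> dim V < dim W" "\<exists>G. finite G \<and> V = span G"
proof -
  obtain B where B: "B \<subseteq> V" "independent B" "V \<subseteq> span B" "card B = dim V" using basis_exists by blast
  obtain C where C: "C \<subseteq> W" "independent C" "W \<subseteq> span C" "card C = dim W" using basis_exists by blast
  have finC: "finite C" using independent_span_bound[OF assms(1) C(2)] C(1) assms(2) by blast
  have bound: "finite G \<and> card G \<le> dim W" if "independent G" "G \<subseteq> W" for G
    using independent_span_bound[OF finC that(1)] that(2) C(3,4) by auto
  show "dim V \<le> dim W" using bound[OF B(2)] B(1,4) assms(3) by auto
  have V: "V = span B" using B(1,3) assms(4) by (simp add: subset_antisym span_minimal)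
  then show "\<exists>G. finite G \<and> V = span G" using bound[OF B(2)] B(1) assms(3) by blast
  assume "V \<noteq> W"
  then obtain x where x: "x \<in> W" "x \<notin> V" using assms(3) by blast
  have "independent (insert x B)" using B(2) x(2) V by (simp add: independent_insert)
  then have "card (insert x B) \<le> dim W" using bound x(1) B(1) assms(3) by blast
  moreover have "x \<notin> B" using x(2) B(1) by blast
  ultimately show "dim V < dim W" using bound[OF B(2)] B(1,4) assms(3) by auto
qed

text \<open>A homogeneous element \<open>y\<close> with \<open>T^l y \<noteq> 0\<close> for the largest possible \<open>l\<close> generates a direct
  summand: compose powers of \<open>T\<close> with a functional which does not vanish at \<open>T^l y\<close>.\<close>

lemma split_off_interval:
  assumes N: "zero_diff N" "N \<in> Df" and nz: "piece N k \<noteq> {0}"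
  obtains a b Q where "a \<le> b" "zero_diff Q" "Q \<in> Df" "direct_sum N (E a b) Q"
      "total_dim Q < total_dim N"
proof -
  note M = zero_diff_module[OF N(1)]
  have fin: "finite {i. piece N i \<noteq> {0}}" and gen: "\<And>i. \<exists>F. finite F \<and> piece N i = span F"
    using zero_diff_Df_iff[OF N(1)] N(2) by auto
  \<comment> \<open>The lengths of nonvanishing strings under T. They are bounded because both ends
    of a string lie in the finitely many nonzero degrees.\<close>
  define L where "L = {n. \<exists>i. \<exists>x\<in>piece N i. act_pow N i n x \<noteq> 0}"
  have "L \<subseteq> (\<lambda>(i, j). nat (j - i)) ` ({i. piece N i \<noteq> {0}} \<times> {i. piece N i \<noteq> {0}})"
  proof
    fix n assume "n \<in> L"
    then obtain i x where x: "x \<in> piece N i" "act_pow N i n x \<noteq> 0" by (auto simp: L_def)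
    have "x \<noteq> 0" using act_pow_linear(2)[OF M x(1), of n 0] x(2) by auto
    then have "piece N i \<noteq> {0}" "piece N (i + int n) \<noteq> {0}"
      using x act_pow_in[OF M x(1), of n] by auto
    then show "n \<in> (\<lambda>(i, j). nat (j - i)) ` ({i. piece N i \<noteq> {0}} \<times> {i. piece N i \<noteq> {0}})"
      by (intro image_eqI[of _ _ "(i, i + int n)"]) auto
  qed
  then have finL: "finite L" using fin finite_subset by blast
  obtain x0 where "x0 \<in> piece N k" "x0 \<noteq> 0" using nz piece_closed(1)[OF M] by blast
  then have "0 \<in> L" by (auto simp: L_def)
  define l where "l = Max L"
  have "l \<in> L" unfolding l_def using finL \<open>0 \<in> L\<close> by (intro Max_in) auto
  then obtain a y where y: "y \<in> piece N a" "act_pow N a l y \<noteq> 0" by (auto simp: L_def)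
  have lmax: "act_pow N i (Suc l) x = 0" if "x \<in> piece N i" for i x
  proof (rule ccontr)
    assume "act_pow N i (Suc l) x \<noteq> 0"
    then have "Suc l \<in> L" using that unfolding L_def by blast
    then show False using Max_ge[OF finL] unfolding l_def by fastforce
  qed
  define b where "b = a + int l"
  obtain g where g: "lin_on UNIV g" "g (act_pow N a l y) = unitv" "\<And>x. g x \<in> span {unitv}"
    using functional_exists[OF y(2), of unitv] by blast
  \<comment> \<open>Elements are first carried up to degree \<open>b\<close> by T and then evaluated
    by \<open>g\<close>, which makes the map T-linear inside the interval.\<close>
  define \<rho> where "\<rho> i x = (if a \<le> i \<and> i \<le> b then g (act_pow N i (nat (b - i)) x) else 0)" for i x
  define j where "j i x = (if a \<le> i \<and> i \<le> b then coord x *s act_pow N a (nat (i - a)) y else 0)" for i x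
  have j_mem: "act_pow N a (nat (i - a)) y \<in> piece N i" if "a \<le> i" for i
    using act_pow_in[OF M y(1), of "nat (i - a)"] that by simp
  have rho: "dg_map N (E a b) \<rho>"
    unfolding dg_map_def
  proof (intro allI conjI ballI)
    fix i
    show "\<rho> i \<in> piece N i \<rightarrow> piece (E a b) i" by (auto simp: \<rho>_def E_simps g(3))
    show "lin_on (piece N i) (\<rho> i)"
      by (rule lin_onI) (auto simp: \<rho>_def act_pow_linear[OF M] lin_on_add[OF g(1)]
          lin_on_scale[OF g(1)])
    fix x assume x: "x \<in> piece N i"
    show "diff (E a b) i (\<rho> i x) = \<rho> (i - 1) (diff N i x)"
      using zero_diff_diff[OF N(1) x] act_pow_linear(2)[OF M piece_closed(1)[OF M], of "i - 1" _ 0]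
        lin_on_zero[OF g(1) subspace_UNIV] by (simp add: E_simps \<rho>_def)
    show "act (E a b) i (\<rho> i x) = \<rho> (i + 1) (act N i x)"
    proof -
      consider "a \<le> i \<and> i < b" | "i + 1 = a" | "\<not> (a \<le> i + 1 \<and> i + 1 \<le> b)" by linarith
      then show ?thesis
      proof cases
        case 1
        then have "nat (b - i) = Suc (nat (b - (i + 1)))" by arith
        then show ?thesis using 1 by (simp only: \<rho>_def E_simps act_pow_Suc) simp
      next
        case 2
        \<comment> \<open>Maximality of \<open>l\<close> enters here: \<open>\<rho>\<close> is 0
          just below the interval, so it must vanish on everything that T brings into degree
          \<open>a\<close>.\<close>
        have "act_pow N (i + 1) l (act N i x) = 0"
          using lmax[OF x] unfolding act_pow_Suc .
        moreover have "nat (b - (i + 1)) = l" using 2 by (simp add: b_def)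
        ultimately show ?thesis
          using 2 lin_on_zero[OF g(1) subspace_UNIV] by (simp add: \<rho>_def E_simps)
      next
        case 3
        then show ?thesis by (auto simp: \<rho>_def E_simps)
      qed
    qed
  qed
  have j: "dg_map (E a b) N j"
    unfolding dg_map_def
  proof (intro allI conjI ballI)
    fix i
    show "j i \<in> piece (E a b) i \<rightarrow> piece N i"
      by (auto simp: j_def piece_closed[OF M] j_mem)
    show "lin_on (piece (E a b) i) (j i)"
      by (rule lin_onI) (auto simp: j_def E_simps coord_linear scale_left_distrib split: if_splits)
    fix x assume x: "x \<in> piece (E a b) i"
    have c0: "coord 0 = 0" using coord_scale[of 0] by simp
    show "diff N i (j i x) = j (i - 1) (diff (E a b) i x)"
      using zero_diff_diff[OF N(1)] j_mem by (auto simp: E_simps j_def c0 piece_closed[OF M]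
          diff_linear[OF M])
    show "act N i (j i x) = j (i + 1) (act (E a b) i x)"
    proof -
      consider "a \<le> i \<and> i < b" | "i = b" | "\<not> (a \<le> i \<and> i \<le> b)" by linarith
      then show ?thesis
      proof cases
        case 1
        then have "nat (i + 1 - a) = Suc (nat (i - a))" by arith
        then show ?thesis using 1 by (simp add: j_def E_simps act_linear[OF M] j_mem)
      next
        case 2
        have "act N b (act_pow N a l y) = 0" using lmax[OF y(1)] by (simp add: b_def)
        then show ?thesis
          using 2 act_linear(4)[OF M j_mem[of b]] by (simp add: j_def E_simps b_def c0 act_linear[OF M])
      next
        case 3
        then show ?thesis by (auto simp: j_def E_simps c0 act_linear[OF M])
      qed
    qed
  qed
  have rj: "\<rho> i (j i x) = x" if x: "x \<in> piece (E a b) i" for i x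
  proof (cases "a \<le> i \<and> i \<le> b")
    case True
    then have "x \<in> span {unitv}" using x by (simp add: E_simps)
    then have x': "coord x *s unitv = x" using line_iff by metis
    have i: "a + int (nat (i - a)) = i" "nat (i - a) + nat (b - i) = l" using True by (auto simp: b_def)
    have "act_pow N i (nat (b - i)) (act_pow N a (nat (i - a)) y) = act_pow N a l y"
      using act_pow_add[of N a "nat (i - a)" "nat (b - i)" y] unfolding i .
    then show ?thesis
      using True x' g(2) by (simp add: \<rho>_def j_def act_pow_linear[OF M j_mem] lin_on_scale[OF g(1)])
  next
    case False
    then show ?thesis using x by (auto simp: E_simps \<rho>_def)
  qed
  \<comment> \<open>The kernel of the retraction \<open>\<rho>\<close>, a complement of the image of
    \<open>j\<close> because \<open>\<rho>\<close> splits \<open>j\<close>.\<close>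
  define Q where "Q = N\<lparr> piece := \<lambda>i. {x \<in> piece N i. \<rho> i x = 0} \<rparr>"
  have Q: "piece Q i = {x \<in> piece N i. \<rho> i x = 0}" "diff Q = diff N" "act Q = act N" for i
    by (simp_all add: Q_def)
  note rl = map_linear[OF M rho]
  have QN: "piece Q i \<subseteq> piece N i" for i by (auto simp: Q)
  have MQ: "dg_module Q"
  proof -
    have sub: "subspace (piece Q i)" for i
      by (rule subspaceI) (auto simp: Q(1) piece_closed[OF M] rl)
    have actQ: "act N i x \<in> piece Q (i + 1)" if "x \<in> piece Q i" for i x
      using that map_act[OF rho, of x i] act_in[OF M, of x i] by (auto simp: Q(1) E_simps)
    have diffQ: "diff N i x \<in> piece Q (i - 1)" if "x \<in> piece Q i" for i x
      using that zero_diff_diff[OF N(1), of x i] by (simp add: Q(1) piece_closed[OF M] rl)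
    show ?thesis
      unfolding dg_module_def Q(2,3)
    proof (intro allI conjI ballI funcsetI)
      fix i x assume x: "x \<in> piece Q i"
      then have xN: "x \<in> piece N i" using QN by blast
      show "diff N i x \<in> piece Q (i - 1)" "act N i x \<in> piece Q (i + 1)"
        by (rule diffQ[OF x] actQ[OF x])+
      show "diff N (i - 1) (diff N i x) = 0" "diff N (i + 1) (act N i x) = act N (i - 1) (diff N i x)"
        by (rule diff_diff[OF M xN] diff_act[OF M xN])+
    qed (rule sub lin_on_mono[OF diff_lin[OF M] QN] lin_on_mono[OF act_lin[OF M] QN])+
  qed
  have sQ: "subspace (piece Q i)" for i by (rule piece_subspace[OF MQ])
  have Q0: "piece Q i = {0}" if "piece N i = {0}" for i
    using QN[of i] subspace_0[OF sQ[of i]] that by auto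
  have zQ: "zero_diff Q"
    using MQ N(1) Q0 QN unfolding zero_diff_def Q(2) by blast
  have dims: "dim (piece Q i) \<le> dim (piece N i)" "piece Q i \<noteq> piece N i \<Longrightarrow> dim (piece Q i)
      < dim (piece N i)"
    "\<exists>G. finite G \<and> piece Q i = span G" for i
  proof -
    obtain F where F: "finite F" "piece N i = span F" using gen by blast
    note d = dim_mono_span[OF F QN sQ]
    show "dim (piece Q i) \<le> dim (piece N i)" by (rule d(1))
    show "piece Q i \<noteq> piece N i \<Longrightarrow> dim (piece Q i) < dim (piece N i)" by (rule d(2))
    show "\<exists>G. finite G \<and> piece Q i = span G" by (rule d(3))
  qed
  have subQ: "{i. piece Q i \<noteq> {0}} \<subseteq> {i. piece N i \<noteq> {0}}" using Q0 by auto
  have QD: "Q \<in> Df"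
    using zero_diff_Df_iff[OF zQ] dims(3) finite_subset[OF subQ fin] by blast
  have ab: "a \<le> b" by (simp add: b_def)
  have y_notin: "y \<notin> piece Q a" using y g(2) unitv_nonzero ab by (simp add: Q \<rho>_def b_def)
  have "total_dim Q = (\<Sum>i | piece N i \<noteq> {0}. dim (piece Q i))"
    unfolding total_dim_def
    by (rule sum.mono_neutral_left[OF fin subQ]) (use dim_span[of "{}"]
        dim_eq_card_independent[OF independent_empty] in simp)
  also have "\<dots> < total_dim N"
    unfolding total_dim_def
  proof (rule sum_strict_mono_ex1[OF fin])
    have "piece N a \<noteq> {0}" using y(1) y_notin subspace_0[OF sQ[of a]] by auto
    then show "\<exists>i\<in>{i. piece N i \<noteq> {0}}. dim (piece Q i) < dim (piece N i)"
      using dims(2)[of a] y(1) y_notin by blast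
  qed (use dims(1) in blast)
  finally have dimQ: "total_dim Q < total_dim N" .
  have ds: "direct_sum N (E a b) Q"
  proof (rule dmor_direct_sum[OF N(2) E_Df QD j _ rho, of "\<lambda>i x. x" "\<lambda>i x. x - j i (\<rho> i x)"])
    show "dg_map Q N (\<lambda>i x. x)"
      unfolding dg_map_def using QN by (auto simp: Q lin_on_ident)
    have m: "dg_map N N (\<lambda>i x. x - j i (\<rho> i x))"
      using dg_map_sub[OF M dg_map_id dg_map_comp[OF rho j]] by (simp add: gcomp_def)
    have "\<rho> i (x - j i (\<rho> i x)) = 0" if "x \<in> piece N i" for i x
      using rl(3)[OF that map_in[OF j map_in[OF rho that]]] rj[OF map_in[OF rho that]] by simp
    then show "dg_map N Q (\<lambda>i x. x - j i (\<rho> i x))"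
      using dg_mapD[OF m] unfolding dg_map_def Q(2,3) by (simp add: Q(1) Pi_iff)
    show "x - j i (\<rho> i x) = x" if "x \<in> piece Q i" for i x
      using that map_linear(1)[OF zero_diff_module[OF E_zero_diff] j] by (simp add: Q)
  qed (use rj in \<open>auto simp: Q\<close>)
  show thesis by (rule that[OF ab zQ QD ds dimQ])
qed

section \<open>Finite direct sums of interval modules\<close>

text \<open>Summands are split off one at a time, which replaces indexed families by an induction;
  \<open>I\<close> restricts the intervals that may occur.\<close>

inductive built :: "(int \<times> int) set \<Rightarrow> 'v dgm \<Rightarrow> bool" for I where
  built_zero: "zero_object X \<Longrightarrow> built I X"
| built_sum: "X \<in> Df \<Longrightarrow> Y \<in> Df \<Longrightarrow> (a, b) \<in> I \<Longrightarrow> a \<le> b \<Longrightarrow> direct_sum X (E a b) Y \<Longrightarrow> built I Y \<Longrightarrow> built I X"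

lemma built_iso:
  assumes "built I X" "isomorphic X Y" "Y \<in> Df"
  shows "built I Y"
  using assms(1)
proof cases
  case built_zero
  then show ?thesis using zero_object_iso[OF _ assms(2,3)] built.built_zero by blast
next
  case (built_sum Z a b)
  then show ?thesis
    using direct_sum_iso_sum[OF _ assms(2) _ assms(3) E_Df] built.built_sum[OF assms(3)] by blast
qed

lemma built_all:
  assumes "X \<in> Df"
  shows "built UNIV X"
proof -
  have "built UNIV N" if "zero_diff N" "N \<in> Df" for N
    using that
  proof (induction "total_dim N" arbitrary: N rule: less_induct)
    case less
    show ?case
    proof (cases "\<forall>i. piece N i = {0}")
      case True
      then show ?thesis using zero_diff_zero_object[OF less.prems] built_zero by blast
    next
      case False
      then obtain k where "piece N k \<noteq> {0}" by blast
      then obtain a b Q where Q: "a \<le> b" "zero_diff Q" "Q \<in> Df" "direct_sum N (E a b) Q"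
          "total_dim Q < total_dim N"
        by (rule split_off_interval[OF less.prems])
      show ?thesis
        by (rule built_sum[OF less.prems(2) Q(3) _ Q(1,4) less.hyps[OF Q(5,2,3)]]) simp
    qed
  qed
  moreover obtain N where N: "zero_diff N" "N \<in> Df" "isomorphic X N" by (rule formality[OF assms])
  ultimately show ?thesis using built_iso[OF _ isomorphic_sym[OF N(3) assms N(2)] assms] by blast
qed

lemma subcategoryD:
  assumes "subcategory A"
  shows "X \<in> A \<Longrightarrow> X \<in> Df" "zero_object X \<Longrightarrow> X \<in> A"
    "X \<in> A \<Longrightarrow> Y \<in> A \<Longrightarrow> S \<in> Df \<Longrightarrow> direct_sum S X Y \<Longrightarrow> S \<in> A"
    "S \<in> A \<Longrightarrow> X \<in> Df \<Longrightarrow> Y \<in> Df \<Longrightarrow> direct_sum S X Y \<Longrightarrow> X \<in> A \<and> Y \<in> A"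
proof -
  note as = assms[unfolded subcategory_def]
  note S = as[THEN conjunct1] as[THEN conjunct2, THEN conjunct1]
    as[THEN conjunct2, THEN conjunct2, THEN conjunct1] as[THEN conjunct2, THEN conjunct2, THEN
        conjunct2]
  show "X \<in> A \<Longrightarrow> X \<in> Df" using S(1) by (rule subsetD)
  show "zero_object X \<Longrightarrow> X \<in> A" by (rule S(2)[rule_format])
  show "X \<in> A \<Longrightarrow> Y \<in> A \<Longrightarrow> S \<in> Df \<Longrightarrow> direct_sum S X Y \<Longrightarrow> S \<in> A" by (rule S(3)[rule_format])
  show "S \<in> A \<Longrightarrow> X \<in> Df \<Longrightarrow> Y \<in> Df \<Longrightarrow> direct_sum S X Y \<Longrightarrow> X \<in> A \<and> Y \<in> A"
    by (rule S(4)[rule_format])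
qed

text \<open>An object isomorphic to \<open>X\<close> is a direct sum of \<open>X\<close> and a zero
  object, so closure under direct sums covers isomorphisms.\<close>

lemma subcategory_iso:
  assumes "subcategory A" "X \<in> A" "isomorphic X Y" "Y \<in> Df"
  shows "Y \<in> A"
proof -
  obtain Z where Z: "zero_object Z" using zero_object_exists by blast
  note X = subcategoryD(1)[OF assms(1,2)]
  have "direct_sum Y X Z" by (rule direct_sum_zero[OF Z isomorphic_sym[OF assms(3) X assms(4)]
      assms(4) X])
  then show ?thesis by (rule subcategoryD(3)[OF assms(1,2) subcategoryD(2)[OF assms(1) Z] assms(4)])
qed

text \<open>Closure under direct summands passes along the decomposition of
  \<open>built_all\<close>: each interval split off and each remainder stays in
  \<open>A\<close>.\<close>

lemma subcategory_built:
  assumes "subcategory A" "X \<in> A"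
  shows "built {(a, b). E a b \<in> A} X"
  using built_all[OF subcategoryD(1)[OF assms]] assms(2)
proof (induction rule: built.induct)
  case (built_zero X)
  show ?case by (rule built.built_zero[OF built_zero(1)])
next
  case (built_sum X Y a b)
  have EY: "E a b \<in> A \<and> Y \<in> A"
    by (rule subcategoryD(4)[OF assms(1) \<open>X \<in> A\<close> E_Df \<open>Y \<in> Df\<close> \<open>direct_sum X (E a b) Y\<close>])
  then have bY: "built {(a, b). E a b \<in> A} Y" using built_sum by simp
  have mem: "(a, b) \<in> {(a, b). E a b \<in> A}" using EY by simp
  show ?case
    by (rule built.built_sum[OF \<open>X \<in> Df\<close> \<open>Y \<in> Df\<close> mem \<open>a \<le> b\<close> \<open>direct_sum X (E a b) Y\<close> bY])
qed

section \<open>Intervals as pairwise non-isomorphic indecomposable objects\<close>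

text \<open>The degree 0 part of the composite is the product of the degree 0 parts. It is the
  identity, so both coefficients are nonzero, and the inequalities of \<open>fwd_pair\<close> in
  both directions force equal ends.\<close>

lemma E_split_unique:
  assumes ab: "a \<le> b" and f: "f \<in> dHom (E a b) (E c d)" and g: "g \<in> dHom (E c d) (E a b)"
      and cd: "c \<le> d"
    and gf: "g \<cdot> f = dId (E a b)"
  shows "a = c \<and> b = d"
proof -
  obtain \<alpha> \<tau> where f': "hok a b c d \<alpha> \<tau>" "f = hmor a b c d \<alpha> \<tau>" by (rule hom_E_normal_form[OF f ab])
  obtain \<beta> \<sigma> where g': "hok c d a b \<beta> \<sigma>" "g = hmor c d a b \<beta> \<sigma>" by (rule hom_E_normal_form[OF g cd])
  note z = E_zero_diff
  have "rmor (E a b) (E a b) (\<lambda>i x. sM b \<beta> i (sM d \<alpha> i x))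
      (\<lambda>i x. sM b \<beta> (i + 2) (tM b \<tau> i x) + tM d \<sigma> i (sM d \<alpha> i x)) = rmor (E a b) (E a b) (\<lambda>i x. x)
          (\<lambda>i x. 0)"
    using gf unfolding f' g' hmor_def rmor_comp[OF z z z hok_htmap[OF f'(1)] hok_htmap[OF g'(1)]]
        dId_rmor[OF z] .
  then have "sM b \<beta> a (sM d \<alpha> a unitv) = unitv"
    unfolding rmor_eq_iff[OF z z htmap_comp[OF z z z hok_htmap[OF f'(1)] hok_htmap[OF g'(1)]]
        zero_diff_resolves(1)[OF z]]
    using E_unitv[of a a b] ab by blast
  then have "\<alpha> \<noteq> 0" "\<beta> \<noteq> 0" using unitv_nonzero by (auto simp: sM_def split: if_splits)
  then show ?thesis using f'(1) g'(1) by (auto simp: hok_def fwd_pair_def)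
qed

lemma E_iso_unique:
  assumes "isomorphic (E a b) (E c d)" "a \<le> b" "c \<le> d"
  shows "a = c \<and> b = d"
proof -
  obtain f g where "arr f" "dm f = E a b" "cd f = E c d" "arr g" "dm g = E c d" "cd g = E a b"
    "g \<cdot> f = dId (E a b)" by (rule isomorphicE[OF assms(1) E_Df E_Df]) blast
  then show ?thesis by (intro E_split_unique[OF assms(2) _ _ assms(3), of f g]) simp_all
qed

text \<open>An interval has no nonzero endomorphism of degree 2, so its endomorphisms are scalars.
  The idempotent belonging to a summand is then 0 or 1, and one of the two summands is zero.\<close>

lemma E_indecomposable:
  assumes ab: "a \<le> b"
  shows "indecomposable (E a b)"
  unfolding indecomposable_def
proof (intro conjI ballI impI E_Df E_nonzero[OF ab])
  fix A B assume D: "A \<in> Df" "B \<in> Df" and "direct_sum (E a b) A B"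
  then obtain i1 i2 q1 q2 where bp: "biprod (E a b) A B i1 i2 q1 q2" using direct_sum_iff[OF E_Df]
      by blast
  note bd = biprodD[OF bp]
  have "i1 \<cdot> q1 \<in> dHom (E a b) (E a b)" using bd by simp
  then obtain \<alpha> \<tau> where e: "hok a b a b \<alpha> \<tau>" "i1 \<cdot> q1 = hmor a b a b \<alpha> \<tau>"
    by (rule hom_E_normal_form[OF _ ab])
  have "\<tau> = 0" using e(1) by (auto simp: hok_def ext_pair_def)
  have ok: "hok a b a b r 0" for r using ab by (simp add: hok_def fwd_pair_def)
  have "hmor a b a b \<alpha> 0 \<cdot> hmor a b a b \<alpha> 0 = hmor a b a b (\<alpha> * \<alpha>) 0"
    by (rule hmor_comp[OF ok ok ok]) (auto simp: sM_def tM_def)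
  moreover have "i1 \<cdot> q1 \<cdot> (i1 \<cdot> q1) = i1 \<cdot> q1" using bd by (simp add: comp_reduce[OF bd(16)])
  ultimately have "hmor a b a b (\<alpha> * \<alpha>) 0 = hmor a b a b \<alpha> 0" using e(2) \<open>\<tau> = 0\<close> by simp
  then have "\<alpha> * \<alpha> = \<alpha>" using hmor_eq_degree0[OF ok ok _ ab] by blast
  then consider "\<alpha> = 0" | "\<alpha> = 1" by auto
  then show "zero_object A \<or> zero_object B"
  proof cases
    case 1
    then have "i1 \<cdot> q1 = dZero (E a b) (E a b)" using e(2) \<open>\<tau> = 0\<close> hmor_zero by simp
    then have "q1 \<cdot> (i1 \<cdot> q1 \<cdot> i1) = dZero A A" using bd(1-15) by simp
    moreover have "q1 \<cdot> (i1 \<cdot> q1 \<cdot> i1) = dId A" using bd by simp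
    ultimately show ?thesis using D by (simp add: zero_object_def)
  next
    case 2
    then have id: "i1 \<cdot> q1 = dId (E a b)" using e(2) \<open>\<tau> = 0\<close> hmor_id[OF ab] by simp
    have "q2 \<cdot> (i1 \<cdot> q1) = q2" unfolding id using bd by simp
    moreover have "q2 \<cdot> (i1 \<cdot> q1) = dZero (E a b) B" using bd by (simp add: comp_reduce[OF bd(19)])
    ultimately have "dId B = dZero (E a b) B \<cdot> i2" using bd(17) by simp
    then have "dId B = dZero B B" using bd(1-15) by simp
    then show ?thesis using D by (simp add: zero_object_def)
  qed
qed

lemma indecomposable_interval:
  assumes "indecomposable X"
  shows "\<exists>a b. a \<le> b \<and> isomorphic X (E a b)"
proof -
  have X: "X \<in> Df" "\<not> zero_object X" using assms by (auto simp: indecomposable_def)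
  from built_all[OF X(1)] show ?thesis
  proof cases
    case built_zero
    then show ?thesis using X by blast
  next
    case (built_sum Y a b)
    then have "zero_object Y"
      using assms E_nonzero[of a b] E_Df unfolding indecomposable_def by blast
    then show ?thesis
      using direct_sum_zero_iso[OF \<open>direct_sum X (E a b) Y\<close> _ X(1) E_Df] \<open>a \<le> b\<close> by blast
  qed
qed

end

subsection \<open>Coordinates\<close>

text \<open>Each arrow shortens an interval at the top or lengthens it at the bottom, but it is not
  given which of the two arrows out of an arc does which. The ambiguity is resolved at the boundary:
  an interval of length one has a single admissible move, whereas an arc with
  \<open>n - m \<ge> 3\<close> has two arrows with different targets, so intervals of length one can
  only sit at arcs \<open>(m, m + 2)\<close>. From there the labelling spreads inwards by
  injectivity.\<close>

lemma labelling_rigid: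
  fixes \<phi> :: "int \<times> int \<Rightarrow> int \<times> int"
  assumes inj: "inj_on \<phi> arcs" and img: "\<phi> ` arcs = {(a, b). a \<le> b}"
    and up: "\<And>m n. n - m \<ge> 2 \<Longrightarrow> \<phi> (m, n + 1) \<in> {(fst (\<phi> (m, n))
        - 1, snd (\<phi> (m, n))), (fst (\<phi> (m, n)), snd (\<phi> (m, n)) - 1)}"
    and down: "\<And>m n. n - m \<ge> 3 \<Longrightarrow> \<phi> (m + 1, n) \<in> {(fst (\<phi> (m, n))
        - 1, snd (\<phi> (m, n))), (fst (\<phi> (m, n)), snd (\<phi> (m, n)) - 1)}"
  obtains s where "\<And>m n. n - m \<ge> 2 \<Longrightarrow> \<phi> (m, n) = (s - n + 2, s - m)"
proof -
  have arcs: "(m, n) \<in> arcs \<longleftrightarrow> n - m \<ge> 2" for m n by (simp add: arcs_def)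
  have inj': "m = m' \<and> n = n'" if "\<phi> (m, n) = \<phi> (m', n')" "n - m \<ge> 2" "n' - m' \<ge> 2" for m n m' n'
    using inj_onD[OF inj that(1)] that(2,3) arcs by auto
  have valid: "fst (\<phi> (m, n)) \<le> snd (\<phi> (m, n))" if "n - m \<ge> 2" for m n
  proof -
    have "\<phi> (m, n) \<in> {(a, b). a \<le> b}" unfolding img[symmetric] using that by (simp add: arcs)
    then show ?thesis by auto
  qed
  have simple: "n = m + 2" if mn: "n - m \<ge> 2" and c: "\<phi> (m, n) = (c, c)" for m n c
  proof (rule ccontr)
    assume "n \<noteq> m + 2"
    then have mn3: "n - m \<ge> 3" using mn by simp
    have v: "fst (\<phi> (m, n + 1)) \<le> snd (\<phi> (m, n + 1))" "fst (\<phi> (m + 1, n)) \<le> snd (\<phi> (m + 1, n))"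
      by (rule valid, use mn3 in simp)+
    have "\<phi> (m, n + 1) = (c - 1, c)"
      using up[OF mn] v(1) unfolding c by auto
    moreover have "\<phi> (m + 1, n) = (c - 1, c)"
      using down[OF mn3] v(2) unfolding c by auto
    ultimately show False using inj'[of m "n + 1" "m + 1" n] mn3 by simp
  qed
  \<comment> \<open>The arcs \<open>(m, m + 4)\<close> and \<open>(m + 1, m + 3)\<close> share the
    two moves of \<open>(c - 1, c)\<close> between them, and only the second arc can carry an
    interval of length one.\<close>
  have next_simple: "\<phi> (m + 1, m + 1 + 2) = (c - 1, c - 1)" if c: "\<phi> (m, m + 2) = (c, c)" for m c
  proof -
    have idx: "m + 2 + 1 = m + 3" "m + 3 + 1 = m + 4" by simp_all
    have "fst (\<phi> (m, m + 3)) \<le> snd (\<phi> (m, m + 3))" by (rule valid) simp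
    then have 1: "\<phi> (m, m + 3) = (c - 1, c)"
      using up[of "m + 2" m] unfolding idx c by auto
    have 2: "\<phi> (m, m + 4) \<in> {(c - 2, c), (c - 1, c - 1)}"
      using up[of "m + 3" m] unfolding idx 1 by auto
    have 3: "\<phi> (m + 1, m + 3) \<in> {(c - 2, c), (c - 1, c - 1)}"
      using down[of "m + 3" m] unfolding 1 by auto
    have "\<phi> (m, m + 4) \<noteq> (c - 1, c - 1)" using simple[of "m + 4" m "c - 1"] by auto
    then have "\<phi> (m + 1, m + 3) = (c - 1, c - 1)"
      using 2 3 inj'[of m "m + 4" "m + 1" "m + 3"] by auto
    then show ?thesis by (simp add: ac_simps)
  qed
  have iter: "\<phi> (m + int j, m + int j + 2) = (c - int j, c - int j)" if c: "\<phi> (m, m + 2) = (c, c)"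
      for m c j
  proof (induction j)
    case (Suc j)
    then show ?case using next_simple[OF Suc] by (simp add: ac_simps)
  qed (use c in simp)
  have ex_simple: "\<exists>m. \<phi> (m, m + 2) = (c, c)" for c
  proof -
    have "(c, c) \<in> \<phi> ` arcs" unfolding img by simp
    then obtain m n where "n - m \<ge> 2" "\<phi> (m, n) = (c, c)" by (auto simp: arcs image_iff)
    then show ?thesis using simple by metis
  qed
  obtain s where s: "\<phi> (s, s + 2) = (0, 0)" using ex_simple by blast
  have base: "\<phi> (m, m + 2) = (s - m, s - m)" for m
  proof (cases "s \<le> m")
    case True
    then show ?thesis using iter[OF s, of "nat (m - s)"] by simp
  next
    case False
    \<comment> \<open>The iteration only moves to the right, so arcs to the left of \<open>s\<close>
      need another argument. Surjectivity provides an arc with the expected interval; moving right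
      from it reaches \<open>(0, 0)\<close>, and injectivity locates it.\<close>
    obtain m' where m': "\<phi> (m', m' + 2) = (s - m, s - m)" using ex_simple by blast
    have "\<phi> (m' + (s - m), m' + (s - m) + 2) = (0, 0)"
      using iter[OF m', of "nat (s - m)"] False by simp
    then have "m' + (s - m) = s"
      using inj'[of "m' + (s - m)" "m' + (s - m) + 2" s "s + 2"] s by auto
    then show ?thesis using m' by simp
  qed
  have "\<forall>m. \<phi> (m, m + 2 + int k) = (s - m - int k, s - m)" for k
  proof (induction k rule: less_induct)
    case (less k)
    show ?case
    proof (cases k)
      case 0
      then show ?thesis using base by simp
    next
      case (Suc j)
      show ?thesis
      proof
        fix m
        have pj: "\<phi> (m, m + 2 + int j) = (s - m - int j, s - m)" using less[of j] Suc by simp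
        have idx: "m + 2 + int j + 1 = m + 2 + int k" "s - m - int j - 1 = s - m - int k"
            using Suc by simp_all
        have "m + 2 + int j - m \<ge> 2" by simp
        from up[OF this]
        have *: "\<phi> (m, m + 2 + int k) \<in> {(s - m - int k, s - m), (s - m - int j, s - m - 1)}"
          unfolding pj fst_conv snd_conv idx .
        \<comment> \<open>The other move is excluded: its result already labels an arc that starts
          in \<open>m + 1\<close>, or it is not an interval if \<open>j = 0\<close>.\<close>
        have "\<phi> (m, m + 2 + int k) \<noteq> (s - m - int j, s - m - 1)"
        proof (cases j)
          case 0
          moreover have "fst (\<phi> (m, m + 2 + int k)) \<le> snd (\<phi> (m, m + 2 + int k))" by (rule valid) simp
          ultimately show ?thesis by auto
        next
          case (Suc i)
          have "\<phi> (m + 1, m + 1 + 2 + int i) = (s - (m + 1) - int i, s - (m + 1))"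
            by (rule spec[OF less]) (use Suc \<open>k = Suc j\<close> in simp)
          then have "\<phi> (m + 1, m + 1 + 2 + int i) = (s - m - int j, s - m - 1)"
            using Suc by simp
          then show ?thesis
            using inj'[of m "m + 2 + int k" "m + 1" "m + 1 + 2 + int i"] by auto
        qed
        then show "\<phi> (m, m + 2 + int k) = (s - m - int k, s - m)" using * by blast
      qed
    qed
  qed
  note all = this
  show thesis
  proof (rule that[of s])
    fix m n :: int assume "n - m \<ge> 2"
    then show "\<phi> (m, n) = (s - n + 2, s - m)" using spec[OF all[of "nat (n - m - 2)"], of m] by simp
  qed
qed

context dg_universe
begin

section \<open>Irreducible morphisms and the labelling\<close>

lemma irreducible_iso:
  assumes irr: "irreducible_mor X Y f" and D: "X \<in> Df" "Y \<in> Df" "X' \<in> Df" "Y' \<in> Df"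
    and iso: "isomorphic X X'" "isomorphic Y Y'"
  shows "\<exists>f'. irreducible_mor X' Y' f'"
proof -
  obtain u u' where u: "arr u" "dm u = X" "cd u = X'" "arr u'" "dm u' = X'" "cd u' = X"
    "u' \<cdot> u = dId X" "u \<cdot> u' = dId X'" by (rule isomorphicE[OF iso(1) D(1,3)])
  obtain v v' where v: "arr v" "dm v = Y" "cd v = Y'" "arr v'" "dm v' = Y'" "cd v' = Y"
    "v' \<cdot> v = dId Y" "v \<cdot> v' = dId Y'" by (rule isomorphicE[OF iso(2) D(2,4)])
  note r = comp_reduce[OF u(7)] comp_reduce[OF u(8)] comp_reduce[OF v(7)] comp_reduce[OF v(8)]
  have f: "arr f" "dm f = X" "cd f = Y" using irr D by (auto simp: irreducible_mor_def arr_iff)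
  have nm: "\<And>k. arr k \<Longrightarrow> dm k = Y \<Longrightarrow> cd k = X \<Longrightarrow> k \<cdot> f \<noteq> dId X"
    and ne: "\<And>k. arr k \<Longrightarrow> dm k = Y \<Longrightarrow> cd k = X \<Longrightarrow> f \<cdot> k \<noteq> dId Y"
    using irr f D by (auto simp: irreducible_mor_def split_mono_def split_epi_def)
  have fac: "split_mono X W g \<or> split_epi W Y h"
    if "W \<in> Df" "arr g" "dm g = X" "cd g = W" "arr h" "dm h = W" "cd h = Y" "f = h \<cdot> g" for W g h
    using irr that unfolding irreducible_mor_def by simp
  let ?f = "v \<cdot> (f \<cdot> u')"
  have "irreducible_mor X' Y' ?f"
    unfolding irreducible_mor_def
  proof (intro conjI ballI impI)
    show "?f \<in> dHom X' Y'" using f u v by simp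
    show "\<not> split_mono X' Y' ?f"
    proof
      assume "split_mono X' Y' ?f"
      then obtain k where k: "arr k" "dm k = Y'" "cd k = X'" "k \<cdot> ?f = dId X'"
        using D unfolding split_mono_def by (auto simp: arr_iff)
      have "(u' \<cdot> (k \<cdot> v)) \<cdot> f = u' \<cdot> ((k \<cdot> ?f) \<cdot> u)" using k(1-3) u v f by simp
      also have "\<dots> = dId X" unfolding k(4) using u by simp
      finally show False using nm[of "u' \<cdot> (k \<cdot> v)"] k(1-3) u v by simp
    qed
    show "\<not> split_epi X' Y' ?f"
    proof
      assume "split_epi X' Y' ?f"
      then obtain k where k: "arr k" "dm k = Y'" "cd k = X'" "?f \<cdot> k = dId Y'"
        using D unfolding split_epi_def by (auto simp: arr_iff)
      have "f \<cdot> (u' \<cdot> (k \<cdot> v)) = v' \<cdot> ((?f \<cdot> k) \<cdot> v)" using k(1-3) u v f by (simp add: r)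
      also have "\<dots> = dId Y" unfolding k(4) using v by simp
      finally show False using ne[of "u' \<cdot> (k \<cdot> v)"] k(1-3) u v by simp
    qed
    fix W g h assume W: "W \<in> Df" "g \<in> dHom X' W" "h \<in> dHom W Y'" "?f = h \<cdot> g"
    have g: "arr g" "dm g = X'" "cd g = W" and h: "arr h" "dm h = W" "cd h = Y'"
      using W D by (auto simp: arr_iff)
    have "f = v' \<cdot> (?f \<cdot> u)" using u v f by (simp add: r)
    also have "\<dots> = (v' \<cdot> h) \<cdot> (g \<cdot> u)" unfolding W(4) using u v g h by simp
    finally have "split_mono X W (g \<cdot> u) \<or> split_epi W Y (v' \<cdot> h)"
      using fac[OF W(1), of "g \<cdot> u" "v' \<cdot> h"] u v g h by simp
    then show "split_mono X' W g \<or> split_epi W Y' h"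
    proof
      assume "split_mono X W (g \<cdot> u)"
      then obtain k where k: "arr k" "dm k = W" "cd k = X" "k \<cdot> (g \<cdot> u) = dId X"
        using D W unfolding split_mono_def by (auto simp: arr_iff)
      have "(u \<cdot> k) \<cdot> g = u \<cdot> ((k \<cdot> (g \<cdot> u)) \<cdot> u')" using k(1-3) u g by simp
      also have "\<dots> = dId X'" unfolding k(4) using u by simp
      finally show ?thesis
        using k(1-3) u g unfolding split_mono_def by (intro disjI1 conjI bexI[of _ "u \<cdot> k"]) simp_all
    next
      assume "split_epi W Y (v' \<cdot> h)"
      then obtain k where k: "arr k" "dm k = Y" "cd k = W" "v' \<cdot> h \<cdot> k = dId Y"
        using D W unfolding split_epi_def by (auto simp: arr_iff)
      have "h \<cdot> (k \<cdot> v') = v \<cdot> ((v' \<cdot> h \<cdot> k) \<cdot> v')" using k(1-3) v h by (simp add: r)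
      also have "\<dots> = dId Y'" unfolding k(4) using v by simp
      finally show ?thesis
        using k(1-3) v h unfolding split_epi_def by (intro disjI2 conjI bexI[of _ "k \<cdot> v'"]) simp_all
    qed
  qed
  then show ?thesis ..
qed

text \<open>If \<open>f\<close> factors through an interval, irreducibility and
  \<open>E_split_unique\<close> identify this interval with one of the ends (\<open>mid\<close>). A
  map of degree 0 factors through all intervals between the ends, which leaves a single unit step. A
  map of degree 2 factors through a source longer at the bottom, and the zero map through two zero
  maps; neither is irreducible.\<close>

lemma irreducible_interval:
  assumes irr: "irreducible_mor (E a b) (E c d) f" and ab: "a \<le> b" and cd: "c \<le> d"
  shows "(c, d) = (a - 1, b) \<or> (c, d) = (a, b - 1)"
proof -
  have f: "f \<in> dHom (E a b) (E c d)" "\<not> split_mono (E a b) (E c d) f"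
    and fac: "\<And>W g h. W \<in> Df \<Longrightarrow> g \<in> dHom (E a b) W \<Longrightarrow> h \<in> dHom W (E c d) \<Longrightarrow> f = h \<cdot> g \<Longrightarrow>
      split_mono (E a b) W g \<or> split_epi W (E c d) h"
    using irr unfolding irreducible_mor_def by blast+
  obtain \<alpha> \<tau> where ok: "hok a b c d \<alpha> \<tau>" and f_eq: "f = hmor a b c d \<alpha> \<tau>"
    by (rule hom_E_normal_form[OF f(1) ab])
  have mid: "(p, q) = (a, b) \<or> (p, q) = (c, d)"
    if pq: "p \<le> q" and g: "g \<in> dHom (E a b) (E p q)" and h: "h \<in> dHom (E p q) (E c d)" and "f = h \<cdot> g"
    for p q g h
  proof -
    have "split_mono (E a b) (E p q) g \<or> split_epi (E p q) (E c d) h"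
      by (rule fac[OF E_Df g h \<open>f = h \<cdot> g\<close>])
    then show ?thesis
    proof
      assume "split_mono (E a b) (E p q) g"
      then obtain k where "k \<in> dHom (E p q) (E a b)" "k \<cdot> g = dId (E a b)"
        unfolding split_mono_def by blast
      then show ?thesis using E_split_unique[OF ab g _ pq] by blast
    next
      assume "split_epi (E p q) (E c d) h"
      then obtain k where "k \<in> dHom (E c d) (E p q)" "h \<cdot> k = dId (E c d)"
        unfolding split_epi_def by blast
      then show ?thesis using E_split_unique[OF cd _ h pq] by blast
    qed
  qed
  consider (fwd) "\<alpha> \<noteq> 0" | (ext) "\<alpha> = 0" "\<tau> \<noteq> 0" | (zero) "\<alpha> = 0" "\<tau> = 0" by blast
  then show ?thesis
  proof cases
    case fwd
    then have cond: "c \<le> a" "a \<le> d" "d \<le> b" using ok by (auto simp: hok_def fwd_pair_def)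
    then have "\<tau> = 0" using ok by (auto simp: hok_def ext_pair_def)
    have through: "(p, q) = (a, b) \<or> (p, q) = (c, d)" if "c \<le> p" "p \<le> a" "d \<le> q" "q \<le> b" for p q
    proof (rule mid)
      have ok1: "hok a b p q 1 0" and ok2: "hok p q c d \<alpha> 0"
        using that cond by (auto simp: hok_def fwd_pair_def)
      show "f = hmor p q c d \<alpha> 0 \<cdot> hmor a b p q 1 0"
        unfolding f_eq \<open>\<tau> = 0\<close>
        by (rule hmor_comp[OF ok1 ok2, symmetric])
          (use ok \<open>\<tau> = 0\<close> that in \<open>auto simp: sM_def tM_def\<close>)
      show "hmor a b p q 1 0 \<in> dHom (E a b) (E p q)" "hmor p q c d \<alpha> 0 \<in> dHom (E p q) (E c d)"
        using ok1 ok2 by simp_all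
      show "p \<le> q" using that cond by simp
    qed
    have "(c, d) \<noteq> (a, b)"
    proof
      assume eq: "(c, d) = (a, b)"
      have ok': "hok a b a b r 0" for r using ab by (simp add: hok_def fwd_pair_def)
      have "hmor a b a b (inverse \<alpha>) 0 \<cdot> hmor a b a b \<alpha> 0 = hmor a b a b 1 0"
        by (rule hmor_comp[OF ok' ok' ok']) (auto simp: sM_def tM_def fwd)
      then have "split_mono (E a b) (E c d) f"
        unfolding split_mono_def
        using eq f(1) f_eq \<open>\<tau> = 0\<close> hmor_id[OF ab] ok'[of "inverse \<alpha>"]
        by (intro conjI bexI[of _ "hmor a b a b (inverse \<alpha>) 0"]) simp_all
      then show False using f(2) by blast
    qed
    \<comment> \<open>The image \<open>E a d\<close> of the map lies between the ends.\<close>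
    moreover have "a = c \<or> b = d" using through[of a d] cond by auto
    moreover have "c = a - 1" if "b = d" "c < a" using through[of "a - 1" b] that by auto
    moreover have "d = b - 1" if "a = c" "d < b" using through[of a "b - 1"] that cond by auto
    ultimately show ?thesis using cond by auto
  next
    case ext
    then have cond: "a + 2 \<le> c" "c \<le> b + 2" "b + 2 \<le> d" using ok by (auto simp: hok_def ext_pair_def)
    have "(a - 1, b) = (a, b) \<or> (a - 1, b) = (c, d)"
    proof (rule mid)
      have ok1: "hok a b (a - 1) b 1 0" and ok2: "hok (a - 1) b c d 0 \<tau>"
        using cond ab by (auto simp: hok_def fwd_pair_def ext_pair_def)
      show "f = hmor (a - 1) b c d 0 \<tau> \<cdot> hmor a b (a - 1) b 1 0"
        unfolding f_eq ext(1)
        by (rule hmor_comp[OF ok1 ok2, symmetric]) (use ok ext in \<open>auto simp: sM_def tM_def\<close>)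
      show "hmor a b (a - 1) b 1 0 \<in> dHom (E a b) (E (a - 1) b)"
        "hmor (a - 1) b c d 0 \<tau> \<in> dHom (E (a - 1) b) (E c d)"
        using ok1 ok2 by simp_all
    qed (use ab in simp)
    then show ?thesis using cond by auto
  next
    case zero
    let ?g = "dZero (E a b) (E a b)" and ?h = "dZero (E a b) (E c d)"
    have "f = ?h \<cdot> ?g" using zero f_eq hmor_zero by (simp add: E_Df)
    then have "split_mono (E a b) (E a b) ?g \<or> split_epi (E a b) (E c d) ?h"
      by (intro fac) (simp_all add: E_Df)
    then show ?thesis
    proof
      assume "split_mono (E a b) (E a b) ?g"
      then obtain k where "k \<in> dHom (E a b) (E a b)" "k \<cdot> ?g = dId (E a b)"
          unfolding split_mono_def by blast
      then have "dId (E a b) = dZero (E a b) (E a b)" by (simp add: arr_iff E_Df)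
      then show ?thesis using E_nonzero[OF ab] E_Df by (simp add: zero_object_def)
    next
      assume "split_epi (E a b) (E c d) ?h"
      then obtain k where "k \<in> dHom (E c d) (E a b)" "?h \<cdot> k = dId (E c d)"
          unfolding split_epi_def by blast
      then have "dId (E c d) = dZero (E c d) (E c d)" by (simp add: arr_iff E_Df)
      then show ?thesis using E_nonzero[OF cd] E_Df by (simp add: zero_object_def)
    qed
  qed
qed

text \<open>Arcs and intervals parametrise the same isomorphism classes, so the labelling induces a
  bijection between them. It turns arrows of the quiver into unit moves of intervals, and
  \<open>labelling_rigid\<close> leaves only a shift \<open>s\<close>.\<close>

lemma AR_labelling_intervals:
  assumes "AR_labelling L"
  obtains s where "\<And>m n. n - m \<ge> 2 \<Longrightarrow> isomorphic (L (m, n)) (E (s - n + 2) (s - m))"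
    "\<And>m n. n - m \<ge> 2 \<Longrightarrow> L (m, n) \<in> Df"
proof -
  have ind: "indecomposable (L x)" if "x \<in> arcs" for x
    using assms that unfolding AR_labelling_def by blast
  have uni: "\<exists>!x. x \<in> arcs \<and> isomorphic X (L x)" if "indecomposable X" for X
    using assms that unfolding AR_labelling_def by blast
  have "\<forall>(m, n)\<in>arcs. \<forall>b\<in>arcs. (\<exists>f. irreducible_mor (L (m, n)) (L b) f) \<longleftrightarrow>
        b = (m, n + 1) \<or> (n - m \<ge> 3 \<and> b = (m + 1, n))"
    using assms unfolding AR_labelling_def by (elim conjE)
  then have arrow: "(\<exists>f. irreducible_mor (L (m, n)) (L b) f) \<longleftrightarrow> b = (m, n + 1) \<or> (n - m \<ge> 3 \<and>
      b = (m + 1, n))"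
    if "(m, n) \<in> arcs" "b \<in> arcs" for m n b
    using that by fast
  have LD: "L x \<in> Df" if "x \<in> arcs" for x
    using ind[OF that] by (simp add: indecomposable_def)
  have "\<forall>x. \<exists>y. x \<in> arcs \<longrightarrow> fst y \<le> snd y \<and> isomorphic (L x) (E (fst y) (snd y))"
    using indecomposable_interval[OF ind] by (metis fst_conv snd_conv)
  then obtain \<phi> where \<phi>: "\<And>x. x \<in> arcs \<Longrightarrow> fst (\<phi> x) \<le> snd (\<phi> x)"
    "\<And>x. x \<in> arcs \<Longrightarrow> isomorphic (L x) (E (fst (\<phi> x)) (snd (\<phi> x)))"
    using choice[of "\<lambda>x y. x \<in> arcs \<longrightarrow> fst y \<le> snd y \<and> isomorphic (L x) (E (fst y) (snd y))"] by blast
  have inj: "inj_on \<phi> arcs"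
  proof (rule inj_onI)
    fix x y assume xy: "x \<in> arcs" "y \<in> arcs" "\<phi> x = \<phi> y"
    have "isomorphic (E (fst (\<phi> x)) (snd (\<phi> x))) (L y)"
      using isomorphic_sym[OF \<phi>(2)[OF xy(2)] LD[OF xy(2)] E_Df] xy(3) by simp
    then have "isomorphic (L x) (L y)"
      by (rule isomorphic_trans[OF \<phi>(2)[OF xy(1)] _ LD[OF xy(1)] E_Df LD[OF xy(2)]])
    then show "x = y" using uni[OF ind[OF xy(1)]] xy isomorphic_refl[OF LD[OF xy(1)]] by blast
  qed
  have img: "\<phi> ` arcs = {(a, b). a \<le> b}"
  proof (intro equalityI subsetI)
    fix y assume "y \<in> \<phi> ` arcs"
    then show "y \<in> {(a, b). a \<le> b}" using \<phi>(1) by (auto simp: case_prod_beta)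
  next
    fix y :: "int \<times> int" assume "y \<in> {(a, b). a \<le> b}"
    then obtain a b where y: "y = (a, b)" "a \<le> b" by auto
    obtain x where x: "x \<in> arcs" "isomorphic (E a b) (L x)" using uni[OF E_indecomposable[OF
        y(2)]] by blast
    have "isomorphic (E a b) (E (fst (\<phi> x)) (snd (\<phi> x)))"
      by (rule isomorphic_trans[OF x(2) \<phi>(2)[OF x(1)] E_Df LD[OF x(1)] E_Df])
    then have "(a, b) = \<phi> x" using E_iso_unique[OF _ y(2) \<phi>(1)[OF x(1)]] by (simp add: prod_eq_iff)
    then show "y \<in> \<phi> ` arcs" using y x by blast
  qed
  have step: "\<phi> y \<in> {(fst (\<phi> x) - 1, snd (\<phi> x)), (fst (\<phi> x), snd (\<phi> x) - 1)}"
    if xy: "x \<in> arcs" "y \<in> arcs" "irreducible_mor (L x) (L y) f" for x y f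
  proof -
    obtain f' where "irreducible_mor (E (fst (\<phi> x)) (snd (\<phi> x))) (E (fst (\<phi> y)) (snd (\<phi> y))) f'"
      using irreducible_iso[OF xy(3) LD[OF xy(1)] LD[OF xy(2)] E_Df E_Df \<phi>(2)[OF xy(1)]
          \<phi>(2)[OF xy(2)]] by blast
    from irreducible_interval[OF this \<phi>(1)[OF xy(1)] \<phi>(1)[OF xy(2)]]
        show ?thesis by (simp add: prod_eq_iff)
  qed
  have up: "\<phi> (m, n + 1) \<in> {(fst (\<phi> (m, n)) - 1, snd (\<phi> (m, n))), (fst (\<phi> (m, n)), snd (\<phi> (m, n)) - 1)}"
    if "n - m \<ge> 2" for m n
  proof -
    have "(m, n) \<in> arcs" "(m, n + 1) \<in> arcs" using that by (auto simp: arcs_def)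
    then show ?thesis using arrow[of m n "(m, n + 1)"] step by blast
  qed
  have down: "\<phi> (m + 1, n) \<in> {(fst (\<phi> (m, n)) - 1, snd (\<phi> (m, n))), (fst (\<phi> (m, n)), snd (\<phi> (m,
      n)) - 1)}"
    if "n - m \<ge> 3" for m n
  proof -
    have "(m, n) \<in> arcs" "(m + 1, n) \<in> arcs" using that by (auto simp: arcs_def)
    then show ?thesis using arrow[of m n "(m + 1, n)"] step that by blast
  qed
  obtain s where s: "\<And>m n. n - m \<ge> 2 \<Longrightarrow> \<phi> (m, n) = (s - n + 2, s - m)"
    using labelling_rigid[OF inj img up down] by metis
  show thesis
  proof (rule that[of s])
    fix m n :: int assume "n - m \<ge> 2"
    then have "(m, n) \<in> arcs" by (simp add: arcs_def)
    then show "isomorphic (L (m, n)) (E (s - n + 2) (s - m))" "L (m, n) \<in> Df"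
      using \<phi>(2)[of "(m, n)"] s[OF \<open>n - m \<ge> 2\<close>] LD by simp_all
  qed
qed

subsection \<open>Precovers\<close>

lemma copair:
  assumes bp: "biprod S A B i1 i2 q1 q2" and u: "arr u" "dm u = A" "cd u = D" and w: "arr w"
      "dm w = B" "cd w = D"
  shows "arr (u \<cdot> q1 \<boxplus> w \<cdot> q2)" "dm (u \<cdot> q1 \<boxplus> w \<cdot> q2) = S" "cd (u \<cdot> q1 \<boxplus> w \<cdot> q2) = D"
    "(u \<cdot> q1 \<boxplus> w \<cdot> q2) \<cdot> i1 = u" "(u \<cdot> q1 \<boxplus> w \<cdot> q2) \<cdot> i2 = w"
proof -
  note b = biprodD[OF bp]
  have D: "D \<in> Df" using arrD(2)[OF u(1)] u(3) by simp
  show "arr (u \<cdot> q1 \<boxplus> w \<cdot> q2)" "dm (u \<cdot> q1 \<boxplus> w \<cdot> q2) = S" "cd (u \<cdot> q1 \<boxplus> w \<cdot> q2) = D"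
    using b u w by simp_all
  have "(u \<cdot> q1 \<boxplus> w \<cdot> q2) \<cdot> i1 = (u \<cdot> q1) \<cdot> i1 \<boxplus> (w \<cdot> q2) \<cdot> i1"
    by (rule comp_add_left) (use b(1-15) u w in simp_all)
  then show "(u \<cdot> q1 \<boxplus> w \<cdot> q2) \<cdot> i1 = u" using b u w D by simp
  have "(u \<cdot> q1 \<boxplus> w \<cdot> q2) \<cdot> i2 = (u \<cdot> q1) \<cdot> i2 \<boxplus> (w \<cdot> q2) \<cdot> i2"
    by (rule comp_add_left) (use b(1-15) u w in simp_all)
  then show "(u \<cdot> q1 \<boxplus> w \<cdot> q2) \<cdot> i2 = w" using b u w D by simp
qed

lemma precover_iff:
  assumes A: "subcategory A" and D: "D \<in> Df"
  shows "precover A D X f \<longleftrightarrow> X \<in> A \<and> arr f \<and> dm f = X \<and> cd f = D \<and>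
    (\<forall>f'. arr f' \<and> dm f' \<in> A \<and> cd f' = D \<longrightarrow> (\<exists>g. arr g \<and> dm g = dm f' \<and> cd g = X \<and> f' = f \<cdot> g))"
proof (cases "X \<in> A")
  case True
  note X = subcategoryD(1)[OF A True]
  show ?thesis
  proof
    assume p: "precover A D X f"
    then have f: "arr f \<and> dm f = X \<and> cd f = D" using X D by (simp add: precover_def arr_iff)
    have "\<exists>g. arr g \<and> dm g = dm f' \<and> cd g = X \<and> f' = f \<cdot> g" if f': "arr f'" "dm f' \<in> A"
        "cd f' = D" for f'
    proof -
      have "f' \<in> dHom (dm f') D" using f' by simp
      then obtain g where g: "g \<in> dHom (dm f') X" "f' = f \<cdot> g"
        using p f'(2) unfolding precover_def by blast
      have "arr g" "dm g = dm f'" "cd g = X" using dHom_dm_cd[OF g(1) _ X] f'(1) by simp_all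
      then show ?thesis using g(2) by blast
    qed
    then show "X \<in> A \<and> arr f \<and> dm f = X \<and> cd f = D \<and>
      (\<forall>f'. arr f' \<and> dm f' \<in> A \<and> cd f' = D \<longrightarrow> (\<exists>g. arr g \<and> dm g = dm f' \<and> cd g = X \<and> f' = f \<cdot> g))"
      using True f by blast
  next
    assume p: "X \<in> A \<and> arr f \<and> dm f = X \<and> cd f = D \<and>
      (\<forall>f'. arr f' \<and> dm f' \<in> A \<and> cd f' = D \<longrightarrow> (\<exists>g. arr g \<and> dm g = dm f' \<and> cd g = X \<and> f' = f \<cdot> g))"
    show "precover A D X f"
      unfolding precover_def
    proof (intro conjI ballI True)
      show "f \<in> dHom X D" using p by simp
      fix X' f' assume X': "X' \<in> A" "f' \<in> dHom X' D"
      note f' = dHom_dm_cd[OF X'(2) subcategoryD(1)[OF A X'(1)] D]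
      obtain g where g: "arr g" "dm g = dm f'" "cd g = X" "f' = f \<cdot> g" using p f' X'(1) by metis
      then show "\<exists>g\<in>dHom X' X. f' = f \<cdot> g" using f' by (intro bexI[of _ g]) simp_all
    qed
  qed
qed (simp add: precover_def)

text \<open>Copairing: the sum of the sources stays in \<open>A\<close>, and each given map is
  recovered along its injection. Precovers arise by finding a finite \<open>K\<close> through whose
  members all other maps factor.\<close>

lemma factor_through_sum:
  assumes A: "subcategory A" and fin: "finite K" and D: "D \<in> Df"
    and K: "\<And>h. h \<in> K \<Longrightarrow> arr h \<and> dm h \<in> A \<and> cd h = D"
  shows "\<exists>f. arr f \<and> dm f \<in> A \<and> cd f = D \<and>
    (\<forall>h\<in>K. \<exists>g. arr g \<and> dm g = dm h \<and> cd g = dm f \<and> h = f \<cdot> g)"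
  using fin K
proof (induction K rule: finite_induct)
  case empty
  obtain Z where Z: "zero_object Z" using zero_object_exists by blast
  then show ?case
    using subcategoryD(2)[OF A Z] zero_objectD(1)[OF Z] D by (intro exI[of _ "dZero Z D"]) simp
next
  case (insert h K)
  then obtain f where f: "arr f" "dm f \<in> A" "cd f = D"
    "\<And>k. k \<in> K \<Longrightarrow> \<exists>g. arr g \<and> dm g = dm k \<and> cd g = dm f \<and> k = f \<cdot> g" by blast
  have h: "arr h" "dm h \<in> A" "cd h = D" using insert.prems[of h] by auto
  have d: "dm f \<in> Df" "dm h \<in> Df" using f(1) h(1) by simp_all
  obtain S where S: "S \<in> Df" "direct_sum S (dm f) (dm h)" using direct_sum_exists[OF d] by blast
  obtain i1 i2 q1 q2 where bp: "biprod S (dm f) (dm h) i1 i2 q1 q2"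
    using S(2) direct_sum_iff[OF S(1) d] by blast
  note b = biprodD[OF bp] and c = copair[OF bp f(1) refl f(3) h(1) refl h(3)]
  let ?f = "f \<cdot> q1 \<boxplus> h \<cdot> q2"
  have SA: "S \<in> A" by (rule subcategoryD(3)[OF A f(2) h(2) S])
  have all: "\<exists>g. arr g \<and> dm g = dm k \<and> cd g = dm ?f \<and> k = ?f \<cdot> g" if k: "k \<in> insert h K" for k
  proof (cases "k = h")
    case True
    show ?thesis unfolding True by (rule exI[of _ i2]) (simp only: b c simp_thms)
  next
    case False
    then obtain g where g: "arr g" "dm g = dm k" "cd g = dm f" "k = f \<cdot> g" using f(4)[of k] k by blast
    have "?f \<cdot> (i1 \<cdot> g) = f \<cdot> g"
      by (rule comp_reduce[OF c(4)]) (simp_all only: b c g)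
    then show ?thesis using g b(4-6) c(2) by (intro exI[of _ "i1 \<cdot> g"]) simp
  qed
  have dA: "dm ?f \<in> A" unfolding c(2) by (rule SA)
  show ?case by (rule exI[of _ ?f], intro conjI ballI c(1) dA c(3), rule all)
qed

text \<open>A map out of a direct sum is the sum of its restrictions, so factorisations only have to
  be found on interval modules.\<close>

lemma factor_built:
  assumes "built I X" and f: "arr f" "dm f = W" "cd f = D"
    and E: "\<And>a b h. (a, b) \<in> I \<Longrightarrow> a \<le> b \<Longrightarrow> arr h \<Longrightarrow> dm h = E a b \<Longrightarrow> cd h = D \<Longrightarrow>
      \<exists>g. arr g \<and> dm g = E a b \<and> cd g = W \<and> h = f \<cdot> g"
    and h: "arr h" "dm h = X" "cd h = D"
  shows "\<exists>g. arr g \<and> dm g = X \<and> cd g = W \<and> h = f \<cdot> g"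
  using assms(1) h
proof (induction arbitrary: h rule: built.induct)
  case (built_zero X)
  have d: "X \<in> Df" "W \<in> Df" "D \<in> Df" using zero_objectD(1)[OF built_zero(1)] arrD(1,2)[OF f(1)]
      f(2,3) by auto
  have "h = dZero X D" using zero_objectD(3)[OF built_zero(1), of h] built_zero by simp
  then show ?case using d f by (intro exI[of _ "dZero X W"]) simp
next
  case (built_sum X Y a b)
  obtain i1 i2 q1 q2 where bp: "biprod X (E a b) Y i1 i2 q1 q2"
    using direct_sum_iff[OF \<open>X \<in> Df\<close> E_Df \<open>Y \<in> Df\<close>] \<open>direct_sum X (E a b) Y\<close> by blast
  note bd = biprodD[OF bp] and hh = \<open>arr h\<close> \<open>dm h = X\<close> \<open>cd h = D\<close>
  obtain g1 where g1: "arr g1" "dm g1 = E a b" "cd g1 = W" "h \<cdot> i1 = f \<cdot> g1"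
    using E[OF \<open>(a, b) \<in> I\<close> \<open>a \<le> b\<close>, of "h \<cdot> i1"] bd(4-6) hh by auto
  obtain g2 where g2: "arr g2" "dm g2 = Y" "cd g2 = W" "h \<cdot> i2 = f \<cdot> g2"
    using built_sum.IH[of "h \<cdot> i2"] bd(7-9) hh by auto
  have "h = h \<cdot> i1 \<cdot> q1 \<boxplus> h \<cdot> i2 \<cdot> q2" by (rule biprod_expand(2)[OF bp hh(1,2)])
  also have "\<dots> = f \<cdot> (g1 \<cdot> q1) \<boxplus> f \<cdot> (g2 \<cdot> q2)" unfolding g1(4) g2(4) using f g1(1-3) g2(1-3)
      bd(4-15) by simp
  also have "\<dots> = f \<cdot> (g1 \<cdot> q1 \<boxplus> g2 \<cdot> q2)"
    by (rule comp_add_right[symmetric]) (use f g1(1-3) g2(1-3) bd(4-15) in simp_all)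
  finally show ?case
    using f g1(1-3) g2(1-3) bd(4-15) by (intro exI[of _ "g1 \<cdot> q1 \<boxplus> g2 \<cdot> q2"]) simp
qed

text \<open>Factorisations are found in the two components of the target separately; with
  \<open>built_all\<close> this reduces arbitrary objects to intervals.\<close>

lemma precover_sum:
  assumes A: "subcategory A" and D: "D \<in> Df" "D1 \<in> Df" "D2 \<in> Df" "direct_sum D D1 D2"
    and p1: "precover A D1 X1 f1" and p2: "precover A D2 X2 f2"
  shows "\<exists>X f. precover A D X f"
proof -
  note P1 = p1[unfolded precover_iff[OF A D(2)]] and P2 = p2[unfolded precover_iff[OF A D(3)]]
  have X: "X1 \<in> Df" "X2 \<in> Df" using P1 P2 subcategoryD(1)[OF A] by blast+
  obtain S where S: "S \<in> Df" "direct_sum S X1 X2" using direct_sum_exists[OF X] by blast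
  obtain j1 j2 r1 r2 where bS: "biprod S X1 X2 j1 j2 r1 r2" using direct_sum_iff[OF S(1) X] S(2)
      by blast
  obtain i1 i2 q1 q2 where bD: "biprod D D1 D2 i1 i2 q1 q2" using direct_sum_iff[OF D(1-3)] D(4)
      by blast
  note s = biprodD[OF bS] and d = biprodD[OF bD]
  have f1: "arr f1" "dm f1 = X1" "cd f1 = D1" and f2: "arr f2" "dm f2 = X2" "cd f2 = D2"
      using P1 P2 by auto
  have u: "arr (i1 \<cdot> f1)" "dm (i1 \<cdot> f1) = X1" "cd (i1 \<cdot> f1) = D"
    and w: "arr (i2 \<cdot> f2)" "dm (i2 \<cdot> f2) = X2" "cd (i2 \<cdot> f2) = D"
    using f1 f2 d(4-9) by simp_all
  note c = copair[OF bS u w]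
  let ?f = "i1 \<cdot> f1 \<cdot> r1 \<boxplus> i2 \<cdot> f2 \<cdot> r2"
  have "precover A D S ?f"
    unfolding precover_iff[OF A D(1)]
  proof (intro conjI allI impI c(1-3))
    show "S \<in> A" using subcategoryD(3)[OF A _ _ S] P1 P2 by blast
    fix h assume h: "arr h \<and> dm h \<in> A \<and> cd h = D"
    then have h1: "arr (q1 \<cdot> h)" "dm (q1 \<cdot> h) = dm h" "cd (q1 \<cdot> h) = D1"
      and h2: "arr (q2 \<cdot> h)" "dm (q2 \<cdot> h) = dm h" "cd (q2 \<cdot> h) = D2"
      using d(10-15) by simp_all
    obtain g1 where g1: "arr g1" "dm g1 = dm h" "cd g1 = X1" "q1 \<cdot> h = f1 \<cdot> g1"
      using P1 h h1 by metis
    obtain g2 where g2: "arr g2" "dm g2 = dm h" "cd g2 = X2" "q2 \<cdot> h = f2 \<cdot> g2"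
      using P2 h h2 by metis
    let ?g = "j1 \<cdot> g1 \<boxplus> j2 \<cdot> g2"
    have "?f \<cdot> ?g = ?f \<cdot> (j1 \<cdot> g1) \<boxplus> ?f \<cdot> (j2 \<cdot> g2)"
      by (rule comp_add_right) (use c(1-3) g1(1-3) g2(1-3) s(4-9) in simp_all)
    also have "?f \<cdot> (j1 \<cdot> g1) = i1 \<cdot> f1 \<cdot> g1"
      by (rule comp_reduce[OF c(4)]) (simp_all only: c(1-3) g1(1-3) s(4-9))
    also have "?f \<cdot> (j2 \<cdot> g2) = i2 \<cdot> f2 \<cdot> g2"
      by (rule comp_reduce[OF c(5)]) (simp_all only: c(1-3) g2(1-3) s(4-9))
    also have "i1 \<cdot> f1 \<cdot> g1 = i1 \<cdot> (q1 \<cdot> h)" unfolding g1(4) using f1 g1(1-3) d(4-6) by simp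
    also have "i2 \<cdot> f2 \<cdot> g2 = i2 \<cdot> (q2 \<cdot> h)" unfolding g2(4) using f2 g2(1-3) d(7-9) by simp
    also have "i1 \<cdot> (q1 \<cdot> h) \<boxplus> i2 \<cdot> (q2 \<cdot> h) = h" using biprod_expand(1)[OF bD, of h] h by simp
    finally show "\<exists>g. arr g \<and> dm g = dm h \<and> cd g = S \<and> h = ?f \<cdot> g"
      using g1(1-3) g2(1-3) s(4-9) by (intro exI[of _ ?g]) simp
  qed
  then show ?thesis by blast
qed

lemma finite_bounded_below:
  fixes T :: "int set"
  assumes "\<And>a. a \<in> T \<Longrightarrow> a \<le> b" "\<And>a. a \<in> T \<Longrightarrow> l \<le> a"
  shows "finite T"
  by (rule finite_subset[of _ "{l..b}"]) (use assms in auto)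

lemma infinite_unbounded_above:
  fixes T :: "int set"
  assumes "infinite T" "\<And>a. a \<in> T \<Longrightarrow> l \<le> a"
  shows "\<exists>e\<in>T. d \<le> e"
proof (rule ccontr)
  assume "\<not> (\<exists>e\<in>T. d \<le> e)"
  then have "finite T" using finite_bounded_below[of T d l] assms(2) by force
  then show False using assms(1) by blast
qed

text \<open>Maps of degree 0 factor through the shortest interval with the given bottom that reaches
  \<open>d\<close>. If infinitely many intervals have top \<open>b\<close>, then their maps of degree two factor through one interval with bottom \<open>b + 2\<close>
  which reaches far enough up.\<close>

lemma interval_precover:
  assumes A: "subcategory A" and cd: "c \<le> d"
    and cond: "\<And>b. infinite {a. a \<le> b \<and> E a b \<in> A} \<Longrightarrow> infinite {e. b + 2 \<le> e \<and> E (b + 2) e \<in> A}"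
  shows "\<exists>X f. precover A (E c d) X f"
proof -
  \<comment> \<open>The shortest interval of \<open>A\<close> with bottom \<open>a\<close> that
    reaches \<open>d\<close>, encoded by the excess of its top over \<open>d\<close>. If
    \<open>A\<close> has none, the value is meaningless, so \<open>K1\<close> asks for membership
    again.\<close>
  define up where "up a = (LEAST n. E a (d + int n) \<in> A)" for a
  have up: "E a (d + int (up a)) \<in> A" "d + int (up a) \<le> b" if "E a b \<in> A" "d \<le> b" for a b
  proof -
    have ex: "E a (d + int (nat (b - d))) \<in> A" using that by simp
    show "E a (d + int (up a)) \<in> A" unfolding up_def by (rule LeastI[of "\<lambda>n. E a (d + int n)
        \<in> A", OF ex])
    have "up a \<le> nat (b - d)" unfolding up_def by (rule Least_le[of "\<lambda>n. E a (d + int n) \<in> A", OF ex])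
    then show "d + int (up a) \<le> b" using that(2) by linarith
  qed
  have "\<exists>e. infinite {a. a \<le> b \<and> E a b \<in> A} \<longrightarrow> d \<le> e \<and> b + 2 \<le> e \<and> E (b + 2) e \<in> A" for b
  proof (cases "infinite {a. a \<le> b \<and> E a b \<in> A}")
    case True
    then show ?thesis using infinite_unbounded_above[OF cond[OF True], of "b + 2" d] by auto
  qed simp
  then obtain far where far: "\<And>b. infinite {a. a \<le> b \<and> E a b \<in> A} \<Longrightarrow>
      d \<le> far b \<and> b + 2 \<le> far b \<and> E (b + 2) (far b) \<in> A"
    by metis
  obtain Z where Z: "zero_object Z" using zero_object_exists by blast
  note ZD = zero_objectD(1)[OF Z]
  define K1 where "K1 = (\<lambda>a. hmor a (d + int (up a)) c d 1 0) ` {a \<in> {c..d}. E a (d + int (up a)) \<in> A}"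
  \<comment> \<open>The source of a map of degree 2 into \<open>E c d\<close> has its top between
    \<open>c - 2\<close> and \<open>d - 2\<close>. If only finitely many intervals of
    \<open>A\<close> have the top \<open>b\<close>, all of their maps are kept; otherwise
    \<open>K3\<close> replaces them by the degree 0 map from the single module
    \<open>E (b + 2) (far b)\<close>.\<close>
  define K2 where "K2 = (\<Union>b\<in>{b \<in> {c - 2..d - 2}. finite {a. a \<le> b \<and> E a b \<in> A}}.
      (\<lambda>a. hmor a b c d 0 1) ` {a. a \<le> b \<and> E a b \<in> A \<and> a + 2 \<le> c})"
  define K3 where "K3 = (\<lambda>b. hmor (b + 2) (far b) c d 1 0) ` {b \<in> {c - 2..d - 2}. infinite {a. a \<le>
      b \<and> E a b \<in> A}}"
  define K where "K = insert (dZero Z (E c d)) (K1 \<union> K2 \<union> K3)"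
  have "finite K1"
    unfolding K1_def by (rule finite_imageI, rule finite_subset[of _ "{c..d}"]) auto
  moreover have "finite K2"
    unfolding K2_def
  proof (rule finite_UN_I)
    show "finite {b \<in> {c - 2..d - 2}. finite {a. a \<le> b \<and> E a b \<in> A}}"
      by (rule finite_subset[of _ "{c - 2..d - 2}"]) auto
    fix b assume "b \<in> {b \<in> {c - 2..d - 2}. finite {a. a \<le> b \<and> E a b \<in> A}}"
    then have "finite {a. a \<le> b \<and> E a b \<in> A}" by blast
    then show "finite ((\<lambda>a. hmor a b c d 0 1) ` {a. a \<le> b \<and> E a b \<in> A \<and> a + 2 \<le> c})"
      by (rule finite_imageI[OF finite_subset[rotated]]) auto
  qed
  moreover have "finite K3"
    unfolding K3_def by (rule finite_imageI, rule finite_subset[of _ "{c - 2..d - 2}"]) auto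
  ultimately have finK: "finite K" by (simp add: K_def)
  have K: "arr h \<and> dm h \<in> A \<and> cd h = E c d" if "h \<in> K" for h
  proof -
    consider "h = dZero Z (E c d)" | "h \<in> K1" | "h \<in> K2" | "h \<in> K3" using \<open>h \<in> K\<close> by (auto simp: K_def)
    then show ?thesis
    proof cases
      case 1
      then show ?thesis using ZD E_Df subcategoryD(2)[OF A Z] by simp
    next
      case 2
      then obtain a where "h = hmor a (d + int (up a)) c d 1 0" "c \<le> a" "a \<le> d"
          "E a (d + int (up a)) \<in> A"
        by (auto simp: K1_def)
      moreover from this have "hok a (d + int (up a)) c d 1 0" by (simp add: hok_def fwd_pair_def)
      ultimately show ?thesis by simp
    next
      case 3
      then obtain a b where "h = hmor a b c d 0 1" "c - 2 \<le> b" "b \<le> d - 2" "E a b \<in> A" "a + 2 \<le> c"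
        by (auto simp: K2_def)
      moreover from this have "hok a b c d 0 1" by (simp add: hok_def ext_pair_def)
      ultimately show ?thesis by simp
    next
      case 4
      then obtain b where "h = hmor (b + 2) (far b) c d 1 0" "c - 2 \<le> b" "b \<le> d - 2"
        "infinite {a. a \<le> b \<and> E a b \<in> A}" by (auto simp: K3_def)
      moreover from this have "hok (b + 2) (far b) c d 1 0" using far[of b]
          by (simp add: hok_def fwd_pair_def)
      ultimately show ?thesis using far[of b] by simp
    qed
  qed
  obtain f where f: "arr f" "dm f \<in> A" "cd f = E c d"
    "\<And>h. h \<in> K \<Longrightarrow> \<exists>g. arr g \<and> dm g = dm h \<and> cd g = dm f \<and> h = f \<cdot> g"
    using factor_through_sum[OF A finK E_Df K] by blast
  have via: "\<exists>g. arr g \<and> dm g = E a b \<and> cd g = dm f \<and> k = f \<cdot> g"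
    if h: "h \<in> K" and g: "arr g" "dm g = E a b" "cd g = dm h" "k = h \<cdot> g" for a b k h g
  proof -
    obtain g' where g': "arr g'" "dm g' = dm h" "cd g' = dm f" "h = f \<cdot> g'" using f(4)[OF h] by blast
    have "k = f \<cdot> (g' \<cdot> g)" unfolding g(4) using g'(4) g'(1-3) g(1-3) f(1) comp_assoc[of g g' f] by simp
    then show ?thesis using g' g by (intro exI[of _ "g' \<cdot> g"]) simp
  qed
  have E: "\<exists>g. arr g \<and> dm g = E a b \<and> cd g = dm f \<and> k = f \<cdot> g"
    if I: "(a, b) \<in> {(a, b). E a b \<in> A}" and ab: "a \<le> b" and k: "arr k" "dm k = E a b"
        "cd k = E c d" for a b k
  proof -
    have abA: "E a b \<in> A" using I by simp
    have "k \<in> dHom (E a b) (E c d)" using k by simp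
    then obtain \<alpha> \<tau> where ok: "hok a b c d \<alpha> \<tau>" and k_eq: "k = hmor a b c d \<alpha> \<tau>"
      by (rule hom_E_normal_form[OF _ ab])
    consider (fwd) "\<alpha> \<noteq> 0" | (ext) "\<alpha> = 0" "\<tau> \<noteq> 0" | (zero) "\<alpha> = 0" "\<tau> = 0" by blast
    then show ?thesis
    proof cases
      case fwd
      then have co: "c \<le> a" "a \<le> d" "d \<le> b" using ok by (auto simp: hok_def fwd_pair_def)
      then have t0: "\<tau> = 0" using ok by (auto simp: hok_def ext_pair_def)
      let ?u = "d + int (up a)"
      have ok1: "hok a b a ?u \<alpha> 0" and ok2: "hok a ?u c d 1 0"
        using co up(2)[OF abA co(3)] by (auto simp: hok_def fwd_pair_def)
      have "hmor a ?u c d 1 0 \<in> K1"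
        unfolding K1_def by (rule imageI) (use co up(1)[OF abA co(3)] in simp)
      then have "hmor a ?u c d 1 0 \<in> K" by (simp add: K_def)
      moreover have "k = hmor a ?u c d 1 0 \<cdot> hmor a b a ?u \<alpha> 0"
        unfolding k_eq t0
        by (rule hmor_comp[OF ok1 ok2, symmetric]) (use ok t0 in \<open>auto simp: sM_def tM_def\<close>)
      ultimately show ?thesis using via[of "hmor a ?u c d 1 0" "hmor a b a ?u \<alpha> 0"] ok1 ok2 by simp
    next
      case ext
      then have co: "a + 2 \<le> c" "c \<le> b + 2" "b + 2 \<le> d" using ok by (auto simp: hok_def ext_pair_def)
      show ?thesis
      proof (cases "finite {a. a \<le> b \<and> E a b \<in> A}")
        case True
        have ok1: "hok a b a b \<tau> 0" and ok2: "hok a b c d 0 1"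
          using co ab by (auto simp: hok_def fwd_pair_def ext_pair_def)
        have "hmor a b c d 0 1 \<in> K2"
          unfolding K2_def by (rule UN_I[of b], use co True in simp, rule imageI)
              (use co abA ab in simp)
        then have "hmor a b c d 0 1 \<in> K" by (simp add: K_def)
        moreover have "k = hmor a b c d 0 1 \<cdot> hmor a b a b \<tau> 0"
          unfolding k_eq ext(1)
          by (rule hmor_comp[OF ok1 ok2, symmetric]) (use ok ext in \<open>auto simp: sM_def tM_def\<close>)
        ultimately show ?thesis using via[of "hmor a b c d 0 1" "hmor a b a b \<tau> 0"] ok1 ok2 by simp
      next
        case False
        note fb = far[OF False]
        have ok1: "hok a b (b + 2) (far b) 0 \<tau>" and ok2: "hok (b + 2) (far b) c d 1 0"
          using co ab fb by (auto simp: hok_def fwd_pair_def ext_pair_def)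
        have "hmor (b + 2) (far b) c d 1 0 \<in> K3"
          unfolding K3_def by (rule imageI) (use co False in simp)
        then have "hmor (b + 2) (far b) c d 1 0 \<in> K" by (simp add: K_def)
        moreover have "k = hmor (b + 2) (far b) c d 1 0 \<cdot> hmor a b (b + 2) (far b) 0 \<tau>"
          unfolding k_eq ext(1)
          by (rule hmor_comp[OF ok1 ok2, symmetric]) (use ok ext co in \<open>auto simp: sM_def tM_def\<close>)
        ultimately show ?thesis
          using via[of "hmor (b + 2) (far b) c d 1 0" "hmor a b (b + 2) (far b) 0 \<tau>"] ok1 ok2 by simp
      qed
    next
      case zero
      have "k = dZero Z (E c d) \<cdot> dZero (E a b) Z" using zero k_eq hmor_zero ZD E_Df by simp
      moreover have "dZero Z (E c d) \<in> K" by (simp add: K_def)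
      ultimately show ?thesis using via[of "dZero Z (E c d)" "dZero (E a b) Z"] ZD E_Df by simp
    qed
  qed
  have "precover A (E c d) (dm f) f"
    unfolding precover_iff[OF A E_Df]
  proof (intro conjI allI impI f(1,2,3) refl)
    fix h assume h: "arr h \<and> dm h \<in> A \<and> cd h = E c d"
    then have hA: "dm h \<in> A" by blast
    show "\<exists>g. arr g \<and> dm g = dm h \<and> cd g = dm f \<and> h = f \<cdot> g"
      by (rule factor_built[OF subcategory_built[OF A hA] f(1) refl f(3) E]) (use h in auto)
  qed
  then show ?thesis by blast
qed

section \<open>The obstruction, and the criterion in terms of intervals\<close>

text \<open>No nonzero map of degree 0 leads from \<open>E a b\<close> to
  \<open>E (b + 2) d\<close>, so a nonzero composite has degree 2 and exactly one factor of degree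
  2. If that is \<open>f\<close>, the inequalities force \<open>q = b\<close> and
  \<open>p \<le> a\<close>; if it is \<open>g\<close>, they force \<open>p = b + 2\<close> and
  \<open>d \<le> q\<close>. Both are excluded.\<close>

lemma comp_zero_E:
  assumes g: "g \<in> dHom (E a b) (E p q)" and f: "f \<in> dHom (E p q) (E (b + 2) d)"
    and ab: "a \<le> b" and pq: "p \<le> q" and n1: "\<not> (q = b \<and> p \<le> a)" and n2: "\<not> (p = b + 2 \<and> d \<le> q)"
  shows "f \<cdot> g = dZero (E a b) (E (b + 2) d)"
proof -
  obtain \<alpha> \<tau> where ok: "hok a b p q \<alpha> \<tau>" and g_eq: "g = hmor a b p q \<alpha> \<tau>"
    by (rule hom_E_normal_form[OF g ab])
  obtain \<alpha>' \<tau>' where ok': "hok p q (b + 2) d \<alpha>' \<tau>'" and f_eq: "f = hmor p q (b + 2) d \<alpha>' \<tau>'"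
    by (rule hom_E_normal_form[OF f pq])
  have ok0: "hok a b (b + 2) d 0 0" by (simp add: hok_def)
  have z: "\<alpha> = 0 \<or> \<alpha>' = 0" "\<alpha> = 0 \<or> \<tau>' = 0" "\<tau> = 0 \<or> \<alpha>' = 0"
    using ok ok' n1 n2 by (auto simp: hok_def fwd_pair_def ext_pair_def)
  have "f \<cdot> g = hmor a b (b + 2) d 0 0"
    unfolding f_eq g_eq by (rule hmor_comp[OF ok ok' ok0]) (use z in \<open>auto simp: sM_def tM_def\<close>)
  then show ?thesis using hmor_zero by simp
qed

text \<open>One bound \<open>l\<close> serves all maps at once: \<open>X\<close> has finitely many
  interval summands, and \<open>a\<close> is taken below the bottoms of all of them, which rules out
  the first exception in \<open>comp_zero_E\<close>. The assumption on \<open>I\<close> rules out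
  the second.\<close>

lemma comp_zero_built:
  assumes "built I X" "arr f" "dm f = X" "cd f = E (b + 2) d" "\<And>e. (b + 2, e) \<in> I \<Longrightarrow> e < d"
  shows "\<exists>l. \<forall>a g. a < l \<longrightarrow> a \<le> b \<longrightarrow> arr g \<longrightarrow> dm g = E a b \<longrightarrow> cd g = X \<longrightarrow>
    f \<cdot> g = dZero (E a b) (E (b + 2) d)"
  using assms(1-4)
proof (induction arbitrary: f rule: built.induct)
  case (built_zero X)
  have "f = dZero X (E (b + 2) d)" using zero_objectD(3)[OF built_zero(1), of f] built_zero by simp
  then show ?case using E_Df by simp
next
  case (built_sum X Y p q)
  obtain i1 i2 q1 q2 where bp: "biprod X (E p q) Y i1 i2 q1 q2"
    using direct_sum_iff[OF \<open>X \<in> Df\<close> E_Df \<open>Y \<in> Df\<close>] \<open>direct_sum X (E p q) Y\<close> by blast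
  note bd = biprodD[OF bp] and ff = \<open>arr f\<close> \<open>dm f = X\<close> \<open>cd f = E (b + 2) d\<close>
  obtain l where l: "\<And>a g. a < l \<Longrightarrow> a \<le> b \<Longrightarrow> arr g \<Longrightarrow> dm g = E a b \<Longrightarrow> cd g = Y \<Longrightarrow>
    f \<cdot> i2 \<cdot> g = dZero (E a b) (E (b + 2) d)"
    using built_sum.IH[of "f \<cdot> i2"] bd(7-9) ff by auto
  have "f \<cdot> g = dZero (E a b) (E (b + 2) d)"
    if a: "a < min l p" "a \<le> b" and g: "arr g" "dm g = E a b" "cd g = X" for a g
  proof -
    have "f \<cdot> g = f \<cdot> (i1 \<cdot> (q1 \<cdot> g) \<boxplus> i2 \<cdot> (q2 \<cdot> g))"
      using biprod_expand(1)[OF bp g(1,3)] by simp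
    also have "\<dots> = f \<cdot> (i1 \<cdot> (q1 \<cdot> g)) \<boxplus> f \<cdot> (i2 \<cdot> (q2 \<cdot> g))"
      by (rule comp_add_right) (use bd(4-15) ff g in simp_all)
    also have "f \<cdot> (i1 \<cdot> (q1 \<cdot> g)) = f \<cdot> i1 \<cdot> (q1 \<cdot> g)" using bd(4-15) ff g by simp
    also have "f \<cdot> i1 \<cdot> (q1 \<cdot> g) = dZero (E a b) (E (b + 2) d)"
    proof (rule comp_zero_E[OF _ _ a(2) \<open>p \<le> q\<close>])
      show "q1 \<cdot> g \<in> dHom (E a b) (E p q)" "f \<cdot> i1 \<in> dHom (E p q) (E (b + 2) d)"
        using bd(4-15) ff g by simp_all
      show "\<not> (q = b \<and> p \<le> a)" using a by simp
      show "\<not> (p = b + 2 \<and> d \<le> q)" using assms(5)[of q] \<open>(p, q) \<in> I\<close> by auto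
    qed
    also have "f \<cdot> (i2 \<cdot> (q2 \<cdot> g)) = f \<cdot> i2 \<cdot> (q2 \<cdot> g)" using bd(4-15) ff g by simp
    also have "f \<cdot> i2 \<cdot> (q2 \<cdot> g) = dZero (E a b) (E (b + 2) d)"
      by (rule l) (use a bd(4-15) g in simp_all)
    finally show ?thesis using E_Df by simp
  qed
  then show ?case by blast
qed

text \<open>If the top \<open>b\<close> occurs infinitely often but the bottom \<open>b + 2\<close>
  only finitely often, \<open>E (b + 2) d\<close> with \<open>d\<close> beyond all these tops has no
  precover: the nonzero map of degree 2 from \<open>E a b\<close> cannot factor once
  \<open>a\<close> is small. The converse assembles precovers of intervals along the decomposition
  of an object.\<close>

lemma precovering_intervals:
  assumes A: "subcategory A"
  shows "precovering A \<longleftrightarrow> (\<forall>b. infinite {a. a \<le> b \<and> E a b \<in> A} \<longrightarrow> infinite {e. b + 2 \<le> e \<and> E (b + 2)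
      e \<in> A})"
proof
  assume pc: "precovering A"
  show "\<forall>b. infinite {a. a \<le> b \<and> E a b \<in> A} \<longrightarrow> infinite {e. b + 2 \<le> e \<and> E (b + 2) e \<in> A}"
  proof (intro allI impI notI)
    fix b assume inf: "infinite {a. a \<le> b \<and> E a b \<in> A}" and fin: "finite {e. b + 2 \<le> e \<and> E (b + 2)
        e \<in> A}"
    \<comment> \<open>Strictly above every top over the bottom \<open>b + 2\<close>. Inserting
      \<open>b + 2\<close> keeps the maximum defined when there is no such top, and makes
      \<open>E (b + 2) d\<close> nonzero.\<close>
    define d where "d = Max (insert (b + 2) {e. b + 2 \<le> e \<and> E (b + 2) e \<in> A}) + 1"
    have d: "e < d" if "b + 2 \<le> e" "E (b + 2) e \<in> A" for e
      using Max_ge[of "insert (b + 2) {e. b + 2 \<le> e \<and> E (b + 2) e \<in> A}" e] fin that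
      unfolding d_def by simp
    have bd: "b + 2 < d"
      using Max_ge[of "insert (b + 2) {e. b + 2 \<le> e \<and> E (b + 2) e \<in> A}" "b + 2"]
          fin unfolding d_def by simp
    obtain X f where "precover A (E (b + 2) d) X f" using pc E_Df unfolding precovering_def by blast
    note P = this[unfolded precover_iff[OF A E_Df]]
    have XA: "X \<in> A" and f: "arr f" "dm f = X" "cd f = E (b + 2) d" using P by auto
    have small: "e < d" if "(b + 2, e) \<in> {(a, b). E a b \<in> A}" for e
      using that d[of e] bd by (cases "b + 2 \<le> e") auto
    obtain l where l: "\<And>a g. a < l \<Longrightarrow> a \<le> b \<Longrightarrow> arr g \<Longrightarrow> dm g = E a b \<Longrightarrow> cd g = X \<Longrightarrow>
        f \<cdot> g = dZero (E a b) (E (b + 2) d)"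
      using comp_zero_built[OF subcategory_built[OF A XA] f small] by blast
    have "\<exists>a. a < l \<and> a \<le> b \<and> E a b \<in> A"
      using inf finite_bounded_below[of "{a. a \<le> b \<and> E a b \<in> A}" b l] by force
    then obtain a where a: "a < l" "a \<le> b" "E a b \<in> A" by blast
    have ok: "hok a b (b + 2) d 0 1" using a bd by (simp add: hok_def ext_pair_def)
    obtain g where g: "arr g" "dm g = E a b" "cd g = X" "hmor a b (b + 2) d 0 1 = f \<cdot> g"
      using P ok a(3) by (metis hmor_arr)
    then have "hmor a b (b + 2) d 0 1 = dZero (E a b) (E (b + 2) d)" using l[OF a(1,2) g(1-3)] by simp
    then have "(1::'k) = 0" by (rule hmor_ext_nonzero[OF a(2), rotated]) (use bd in simp)
    then show False by simp
  qed
next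
  assume cond: "\<forall>b. infinite {a. a \<le> b \<and> E a b \<in> A} \<longrightarrow> infinite {e. b + 2 \<le> e \<and> E (b + 2) e \<in> A}"
  have "\<exists>X f. precover A D X f" if "built UNIV D" for D
    using that
  proof (induction rule: built.induct)
    case (built_zero D)
    note D = zero_objectD(1)[OF built_zero]
    have "precover A D D (dZero D D)"
      unfolding precover_iff[OF A D]
    proof (intro conjI allI impI)
      show "D \<in> A" by (rule subcategoryD(2)[OF A built_zero])
      fix h assume h: "arr h \<and> dm h \<in> A \<and> cd h = D"
      then have "h = dZero (dm h) D" using zero_objectD(2)[OF built_zero, of h] by simp
      then show "\<exists>g. arr g \<and> dm g = dm h \<and> cd g = D \<and> h = dZero D D \<cdot> g"
        using h D by (intro exI[of _ h]) simp
    qed (use D in simp_all)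
    then show ?case by blast
  next
    case (built_sum D Y c d)
    obtain X1 f1 where p1: "precover A (E c d) X1 f1"
      using interval_precover[OF A \<open>c \<le> d\<close>] cond by blast
    obtain X2 f2 where p2: "precover A Y X2 f2" using built_sum.IH by blast
    show ?case
      by (rule precover_sum[OF A \<open>D \<in> Df\<close> E_Df \<open>Y \<in> Df\<close> \<open>direct_sum D (E c d) Y\<close> p1 p2])
  qed
  then show "precovering A" unfolding precovering_def using built_all by blast
qed

section \<open>From intervals back to arcs\<close>

text \<open>Fixing one end of an arc fixes one end of its interval, and the free ends correspond
  under a reflection of the integers, which preserves infinitude.\<close>

lemma fountains_intervals:
  assumes A: "subcategory A" and L: "AR_labelling L"
  obtains s where "\<And>n. right_fountain (arcs_of L A) n \<longleftrightarrow> infinite {a. a \<le> s - n \<and> E a (s - n) \<in> A}"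
    "\<And>n. left_fountain (arcs_of L A) n \<longleftrightarrow> infinite {e. s - n + 2 \<le> e \<and> E (s - n + 2) e \<in> A}"
proof -
  obtain s where s: "\<And>m n. n - m \<ge> 2 \<Longrightarrow> isomorphic (L (m, n)) (E (s - n + 2) (s - m))"
    "\<And>m n. n - m \<ge> 2 \<Longrightarrow> L (m, n) \<in> Df"
    by (rule AR_labelling_intervals[OF L]) blast
  have mem: "(m, n) \<in> arcs_of L A \<longleftrightarrow> n - m \<ge> 2 \<and> E (s - n + 2) (s - m) \<in> A" for m n
    using subcategory_iso[OF A _ s(1) E_Df] subcategory_iso[OF A _ isomorphic_sym[OF s(1) s(2)
        E_Df] s(2)]
    by (auto simp: arcs_of_def arcs_def)
  have img: "x \<in> (\<lambda>a. k - a) ` T \<longleftrightarrow> k - x \<in> T" for k x :: int and T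
    by (auto intro!: image_eqI[of _ _ "k - x"])
  have inj: "finite ((\<lambda>a. k - a) ` T) \<longleftrightarrow> finite T" for k :: int and T
    by (rule finite_image_iff) (auto simp: inj_on_def)
  show thesis
  proof (rule that[of s])
    fix n
    \<comment> \<open>The interval of the arc \<open>(n, m)\<close> has bottom
      \<open>a = s - m + 2\<close>, whence \<open>m = s + 2 - a\<close>.\<close>
    have "{m. (n, m) \<in> arcs_of L A} = (\<lambda>a. s + 2 - a) ` {a. a \<le> s - n \<and> E a (s - n) \<in> A}"
      by (rule set_eqI) (auto simp: mem img algebra_simps)
    then show "right_fountain (arcs_of L A) n \<longleftrightarrow> infinite {a. a \<le> s - n \<and> E a (s - n) \<in> A}"
      by (simp add: right_fountain_def inj)
    have "{m. (m, n) \<in> arcs_of L A} = (\<lambda>e. s - e) ` {e. s - n + 2 \<le> e \<and> E (s - n + 2) e \<in> A}"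
      by (rule set_eqI) (auto simp: mem img)
    then show "left_fountain (arcs_of L A) n \<longleftrightarrow> infinite {e. s - n + 2 \<le> e \<and> E (s - n + 2) e \<in> A}"
      by (simp add: left_fountain_def inj)
  qed
qed

lemma precovering_iff_fountains:
  assumes L: "AR_labelling L" and A: "subcategory A"
  shows "precovering A \<longleftrightarrow> (\<forall>n. right_fountain (arcs_of L A) n \<longrightarrow> fountain (arcs_of L A) n)"
proof -
  obtain s where s: "\<And>n. right_fountain (arcs_of L A) n \<longleftrightarrow> infinite {a. a \<le> s - n \<and> E a (s - n) \<in> A}"
    "\<And>n. left_fountain (arcs_of L A) n \<longleftrightarrow> infinite {e. s - n + 2 \<le> e \<and> E (s - n + 2) e \<in> A}"
    by (rule fountains_intervals[OF A L]) blast
  have shift: "(\<forall>b. P b) \<longleftrightarrow> (\<forall>n. P (s - n))" for P :: "int \<Rightarrow> bool"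
    by (metis diff_diff_eq2 add_diff_cancel_left')
  show ?thesis
    unfolding precovering_intervals[OF A]
    by (subst shift[of "\<lambda>b. infinite {a. a \<le> b \<and> E a b \<in> A} \<longrightarrow> infinite {e. b + 2 \<le> e \<and> E (b + 2)
        e \<in> A}"])
      (simp add: fountain_def s)
qed

end

theorem theorem2p2:
  fixes scale :: "'k::field \<Rightarrow> 'v::ab_group_add \<Rightarrow> 'v"
    and L :: "int \<times> int \<Rightarrow> 'v dgm"
    and A :: "'v dgm set"
  assumes "dg_universe scale"
    and "dg_universe.AR_labelling scale L"
    and "dg_universe.subcategory scale A"
  shows "dg_universe.precovering scale A \<longleftrightarrow>
           (\<forall>n. right_fountain (arcs_of L A) n \<longrightarrow>
                fountain (arcs_of L A) n)"
  by (rule dg_universe.precovering_iff_fountains[OF assms])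

end
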